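(* Let $a=\{a_n(t): n\in\mathbb{N}, t>0\}$ be any subexponential rate function. There exists a dense $G_\delta$ subset $G\subset\mathcal{M}$ (in the weak topology) such that for each $T\in G$ the upper slow entropy of $T$ with respect to $a_n(t)$ is infinite, i.e. $\text{s-}\overline{\mathcal{H}}^{\mu}_{a}(T)=\infty$.
   Context: $(X,\mathcal{B},\mu)$ is a standard probability space (isomorphic to $[0,1]$ with Lebesgue measure). $\mathcal{M}$ is the set of invertible $\mu$-preserving maps $T:X\to X$ (identified modulo null sets), with the weak topology, i.e. the topology induced by the strong operator topology on the Koopman operators $U_T$. A rate function is a family $a=\{a_n(t): n\in\mathbb{N},t>0\}$ of positive reals with $a_n(t)\ge a_n(s)$ for $t>s$ and $\lim_{n\to\infty}a_n(t)=\infty$ for each $t>0$. It is subexponential if for all $\beta>1$ and $t>0$, $\lim_{n\to\infty} a_n(t)/\beta^n=0$. For words $w,w'$ of length $n$, the normalized Hamming distance $d(w,w')$ is $\frac1n$ times the number of positions where $w$ and $w'$ differ. For a finite measurable partition $P=\{p_1,\dots,p_r\}$, $T\in\mathcal{M}$ and $x\in X$, let $\vec{P}_n(x)=\langle w_1,\dots,w_n\rangle\in\{1,\dots,r\}^n$ with $T^{i-1}x\in p_{w_i}$. For $w\in\{1,\dots,r\}^n$ let $B^{T,P}_{\varepsilon}(w)=\{x\in X: d(\vec{P}_n(x),w)<\varepsilon\}$. Define $$S_P(T,n,\varepsilon,\delta)=\min\Big\{k:\exists v_1,\dots,v_k\in\{1,\dots,r\}^n,\ \mu\Big(\bigcup_{i=1}^k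 B^{T,P}_\varepsilon(v_i)\Big)\ge 1-\delta\Big\}.$$ Upper slow entropy: let $\overline{\mathcal{G}}(\varepsilon,\delta,P)=\{t>0:\limsup_{n\to\infty} S_P(T,n,\varepsilon,\delta)/a_n(t)>0\}$; let $\text{s-}\overline{\mathcal{H}}(\varepsilon,\delta,P)=\sup\overline{\mathcal{G}}(\varepsilon,\delta,P)$ if this set is nonempty and $0$ otherwise; $\text{s-}\overline{\mathcal{H}}^\mu_a(T,P)=\lim_{\delta\to0}\lim_{\varepsilon\to0}\text{s-}\overline{\mathcal{H}}(\varepsilon,\delta,P)$; and $\text{s-}\overline{\mathcal{H}}^\mu_a(T)=\sup_P \text{s-}\overline{\mathcal{H}}^\mu_a(T,P)$, the supremum over finite measurable partitions $P$. *)

theory Defs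
  imports "HOL-Analysis.Analysis"
begin

section \<open>Standard probability spaces\<close>

definition isomorphic_mod_null :: "'a measure \<Rightarrow> 'b measure \<Rightarrow> bool" where
  "isomorphic_mod_null M N \<longleftrightarrow>
    (\<exists>A \<in> null_sets M. \<exists>B \<in> null_sets N. \<exists>f.
       let M' = restrict_space M (space M - A); N' = restrict_space N (space N - B) in
         bij_betw f (space M - A) (space N - B) \<and>
         f \<in> measurable M' N' \<and>
         inv_into (space M - A) f \<in> measurable N' M' \<and>
         distr M' N' f = N')"

text \<open>Both usual conventions are covered: the sigma-algebra may correspond to the Borel sets or
  to the Lebesgue measurable sets of the unit interval.\<close>

definition standard_prob_space :: "'a measure \<Rightarrow> bool" where
  "standard_prob_space M \<longleftrightarrow>
     isomorphic_mod_null M (restrict_space lborel {0..1::real}) \<or>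
     isomorphic_mod_null M (lebesgue_on {0..1::real})"

section \<open>Invertible measure-preserving maps and the weak topology\<close>

text \<open>On a standard space, an automorphism defined off a null set is bijective on an invariant
  conull measurable set and can be extended by the identity, so every class
  modulo null sets has a representative that is bijective everywhere.\<close>

definition mpt :: "'a measure \<Rightarrow> ('a \<Rightarrow> 'a) set" where
  "mpt M = {T. T \<in> measurable M M \<and> bij_betw T (space M) (space M) \<and>
               inv_into (space M) T \<in> measurable M M \<and> distr M M T = M}"

definition mpt_rel :: "'a measure \<Rightarrow> (('a \<Rightarrow> 'a) \<times> ('a \<Rightarrow> 'a)) set" where
  "mpt_rel M = {(S, T). S \<in> mpt M \<and> T \<in> mpt M \<and> (AE x in M. S x = T x)}"

definition mpt_classes :: "'a measure \<Rightarrow> ('a \<Rightarrow> 'a) set set" where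
  "mpt_classes M = mpt M // mpt_rel M"

definition L2_functions :: "'a measure \<Rightarrow> ('a \<Rightarrow> complex) set" where
  "L2_functions M = {f \<in> borel_measurable M. integrable M (\<lambda>x. (cmod (f x))\<^sup>2)}"

definition L2_dist :: "'a measure \<Rightarrow> ('a \<Rightarrow> complex) \<Rightarrow> ('a \<Rightarrow> complex) \<Rightarrow> real" where
  "L2_dist M f g = sqrt (LINT x|M. (cmod (f x - g x))\<^sup>2)"

definition koopman :: "('a \<Rightarrow> 'a) \<Rightarrow> ('a \<Rightarrow> complex) \<Rightarrow> 'a \<Rightarrow> complex" where
  "koopman T f = f \<circ> T"

text \<open>The strong operator topology is the initial topology of the evaluations
  \<open>U \<mapsto> U f\<close> into \<open>L\<^sup>2\<close>. Its pullback along the Koopman representation is generated by the balls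
  of the pseudometrics \<open>\<parallel>U\<^sub>S f - U\<^sub>T f\<parallel>\<close>. These do not depend on the representative of
  a class, so \<open>\<exists>S\<in>c\<close> is the same as \<open>\<forall>S\<in>c\<close> below.\<close>

definition weak_topology :: "'a measure \<Rightarrow> ('a \<Rightarrow> 'a) set topology" where
  "weak_topology M = topology_generated_by
     {{c \<in> mpt_classes M. \<exists>S\<in>c. L2_dist M (koopman S f) (koopman T f) < e} | f T e.
        f \<in> L2_functions M \<and> T \<in> mpt M \<and> e > 0}"

lemma equiv_mpt_rel: "equiv (mpt M) (mpt_rel M)"
proof (rule equivI)
  show "trans (mpt_rel M)"
  proof (rule transI)
    fix S T U assume "(S, T) \<in> mpt_rel M" "(T, U) \<in> mpt_rel M"
    then have *: "S \<in> mpt M" "U \<in> mpt M" "AE x in M. S x = T x" "AE x in M. T x = U x"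
      by (simp_all add: mpt_rel_def)
    from *(3,4) have "AE x in M. S x = U x"
      by eventually_elim simp
    with * show "(S, U) \<in> mpt_rel M"
      by (simp add: mpt_rel_def)
  qed
  show "sym (mpt_rel M)"
    by (rule symI) (simp add: mpt_rel_def eq_commute)
qed (auto simp: mpt_rel_def refl_on_def)

lemma topspace_weak_topology: "topspace (weak_topology M) = mpt_classes M"
proof
  show "topspace (weak_topology M) \<subseteq> mpt_classes M"
    unfolding weak_topology_def topology_generated_by_topspace by blast
  show "mpt_classes M \<subseteq> topspace (weak_topology M)"
  proof
    fix c assume c: "c \<in> mpt_classes M"
    then obtain T where T: "T \<in> mpt M" "c = mpt_rel M `` {T}"
      unfolding mpt_classes_def by (rule quotientE)
    then have "T \<in> c"
      using equiv_class_self[OF equiv_mpt_rel] by simp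
    define U where "U = {c \<in> mpt_classes M.
      \<exists>S\<in>c. L2_dist M (koopman S (\<lambda>_. 0)) (koopman T (\<lambda>_. 0)) < 1}"
    have "L2_dist M (koopman T (\<lambda>_. 0)) (koopman T (\<lambda>_. 0)) < 1"
      by (simp add: L2_dist_def)
    with c \<open>T \<in> c\<close> have "c \<in> U"
      unfolding U_def by blast
    moreover have "(\<lambda>_. 0) \<in> L2_functions M" "(1::real) > 0"
      by (simp_all add: L2_functions_def)
    ultimately show "c \<in> topspace (weak_topology M)"
      unfolding weak_topology_def topology_generated_by_topspace using T(1) U_def by blast
  qed
qed

section \<open>Rate functions\<close>

definition rate_function :: "(nat \<Rightarrow> real \<Rightarrow> real) \<Rightarrow> bool" where
  "rate_function a \<longleftrightarrow>
     (\<forall>n\<ge>1. \<forall>t>0. a n t > 0) \<and>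
     (\<forall>n\<ge>1. \<forall>s>0. \<forall>t>s. a n t \<ge> a n s) \<and>
     (\<forall>t>0. filterlim (\<lambda>n. a n t) at_top sequentially)"

definition subexponential :: "(nat \<Rightarrow> real \<Rightarrow> real) \<Rightarrow> bool" where
  "subexponential a \<longleftrightarrow> (\<forall>\<beta>>1. \<forall>t>0. (\<lambda>n. a n t / \<beta> ^ n) \<longlonglongrightarrow> 0)"

section \<open>Upper slow entropy\<close>

text \<open>A pair \<open>(r, p)\<close> encodes the partition \<open>{p 1, \<dots>, p r}\<close>. Cells may be empty. The values of
  \<open>p\<close> outside \<open>{1..r}\<close> are irrelevant.\<close>

definition finite_partitions :: "'a measure \<Rightarrow> (nat \<times> (nat \<Rightarrow> 'a set)) set" where
  "finite_partitions M = {(r, p). (\<forall>j\<in>{1..r}. p j \<in> sets M) \<and>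
     disjoint_family_on p {1..r} \<and> (\<Union>j\<in>{1..r}. p j) = space M}"

definition words :: "nat \<Rightarrow> nat \<Rightarrow> nat list set" where
  "words r n = {w. length w = n \<and> set w \<subseteq> {1..r}}"

definition hamming :: "nat list \<Rightarrow> nat list \<Rightarrow> real" where
  "hamming w w' = real (card {i. i < length w \<and> w ! i \<noteq> w' ! i}) / real (length w)"

definition cell_of :: "nat \<times> (nat \<Rightarrow> 'a set) \<Rightarrow> 'a \<Rightarrow> nat" where
  "cell_of P x = (THE j. j \<in> {1..fst P} \<and> x \<in> snd P j)"

definition name_of :: "('a \<Rightarrow> 'a) \<Rightarrow> nat \<times> (nat \<Rightarrow> 'a set) \<Rightarrow> nat \<Rightarrow> 'a \<Rightarrow> nat list" where
  "name_of T P n x = map (\<lambda>i. cell_of P ((T ^^ i) x)) [0..<n]"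

definition hamming_ball ::
    "'a measure \<Rightarrow> ('a \<Rightarrow> 'a) \<Rightarrow> nat \<times> (nat \<Rightarrow> 'a set) \<Rightarrow> real \<Rightarrow> nat list \<Rightarrow> 'a set" where
  "hamming_ball M T P \<epsilon> w = {x \<in> space M. hamming (name_of T P (length w) x) w < \<epsilon>}"

definition covering_number ::
    "'a measure \<Rightarrow> nat \<times> (nat \<Rightarrow> 'a set) \<Rightarrow> ('a \<Rightarrow> 'a) \<Rightarrow> nat \<Rightarrow> real \<Rightarrow> real \<Rightarrow> nat" where
  "covering_number M P T n \<epsilon> \<delta> = (LEAST k. \<exists>vs. length vs = k \<and> set vs \<subseteq> words (fst P) n \<and>
     measure M (\<Union>v\<in>set vs. hamming_ball M T P \<epsilon> v) \<ge> 1 - \<delta>)"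

definition upper_slow_set ::
    "'a measure \<Rightarrow> (nat \<Rightarrow> real \<Rightarrow> real) \<Rightarrow> ('a \<Rightarrow> 'a) \<Rightarrow> nat \<times> (nat \<Rightarrow> 'a set) \<Rightarrow>
       real \<Rightarrow> real \<Rightarrow> real set" where
  "upper_slow_set M a T P \<epsilon> \<delta> =
     {t. t > 0 \<and> limsup (\<lambda>n. ereal (real (covering_number M P T n \<epsilon> \<delta>) / a n t)) > 0}"

definition upper_slow_value ::
    "'a measure \<Rightarrow> (nat \<Rightarrow> real \<Rightarrow> real) \<Rightarrow> ('a \<Rightarrow> 'a) \<Rightarrow> nat \<times> (nat \<Rightarrow> 'a set) \<Rightarrow>
       real \<Rightarrow> real \<Rightarrow> ereal" where
  "upper_slow_value M a T P \<epsilon> \<delta> =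
     (if upper_slow_set M a T P \<epsilon> \<delta> = {} then 0
      else (SUP t \<in> upper_slow_set M a T P \<epsilon> \<delta>. ereal t))"

text \<open>Both one-sided limits exist in \<^typ>\<open>ereal\<close>, since the covering numbers are antitone in
  \<open>\<epsilon>\<close> and in \<open>\<delta>\<close>.\<close>

definition upper_slow_entropy_partition ::
    "'a measure \<Rightarrow> (nat \<Rightarrow> real \<Rightarrow> real) \<Rightarrow> ('a \<Rightarrow> 'a) \<Rightarrow> nat \<times> (nat \<Rightarrow> 'a set) \<Rightarrow> ereal" where
  "upper_slow_entropy_partition M a T P =
     Lim (at_right 0) (\<lambda>\<delta>. Lim (at_right 0) (\<lambda>\<epsilon>. upper_slow_value M a T P \<epsilon> \<delta>))"

definition upper_slow_entropy ::
    "'a measure \<Rightarrow> (nat \<Rightarrow> real \<Rightarrow> real) \<Rightarrow> ('a \<Rightarrow> 'a) \<Rightarrow> ereal" where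
  "upper_slow_entropy M a T = (SUP P \<in> finite_partitions M. upper_slow_entropy_partition M a T P)"

end

theory Submission
  imports Defs "HOL-Probability.Probability"
begin

text \<open>
  Let \<open>u\<close> be a coordinate that identifies the space with the unit interval, and colour a point by the
  half of the interval that contains it. Call a transformation rich if, for some \<open>\<beta> > 1\<close>, every
  Hamming ball of radius \<open>1/8\<close> in the space of colour words of length \<open>n\<close> has measure at most
  \<open>3/2 \<beta>\<^sup>-\<^sup>n\<close>, for \<open>n\<close> a multiple of 8 (\<open>exponentially_many_words\<close>). Then at least
  \<open>\<beta>\<^sup>n / 3\<close> balls are needed to cover half of the space, and this exceeds every subexponential rate.

  The set \<open>G\<close> is the intersection over \<open>R \<ge> 1\<close> of the sets \<open>beats_rate a R\<close>, which demand that the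
  covering number for radius \<open>1/8\<close> and error \<open>1/2\<close> exceeds \<open>R a\<^sub>n(R)\<close> at some \<open>n \<ge> R\<close>. Each of these
  sets is open: words of a fixed length depend continuously on the transformation, and a lower
  bound on a covering number is a finite family of strict inequalities between measures. Since
  covering numbers only grow when the radius and the error shrink, and \<open>a\<^sub>n(t)\<close> is monotone in \<open>t\<close>, every
  member of \<open>G\<close> has all \<open>t > 0\<close> in its upper slow set, whatever the radius below \<open>1/8\<close>.

  A rich transformation belongs to all the sets \<open>beats_rate a R\<close> at once, so the density of \<open>G\<close> reduces
  to the density of rich transformations. A weak neighbourhood of \<open>S\<close> only sees
  into which of \<open>N\<close> equal cells of the coordinate a point is sent, up to small measure
  (\<open>weak_neighbourhood_by_cells\<close>). At that resolution \<open>S\<close> agrees, up to small measure, with a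
  permutation \<open>\<pi>\<close> of finitely many finer cells (\<open>permutation_approximation\<close>). The permutation is now
  made random: in each step, with a small probability \<open>1/w\<close>, the cell is replaced by a uniformly
  distributed one, and otherwise it moves by \<open>\<pi>\<close>. The randomness is supplied by the remaining digits of
  the coordinate, arranged as a two-sided sequence and shifted, so that this random walk is
  realised by an invertible measure-preserving map of the interval
  (locales \<open>skew_shift\<close> and \<open>resampling_shift\<close>), and it differs from \<open>\<pi>\<close> only on a set of measure \<open>1/w\<close>.

  Why is the random walk rich, with a radius that does not depend on \<open>w\<close> and \<open>\<pi>\<close>? Between
  two resamplings the walk follows an orbit of \<open>\<pi>\<close> from a uniformly distributed start. Both colours
  occupy half of the cells, so a stretch of length \<open>l\<close> disagrees with any prescribed word
  in \<open>l/2\<close> places on average. To turn this average into an exponential bound, give the weight \<open>z\<^sup>m\<close>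
  to a walk with \<open>m\<close> mismatches, where \<open>1 - z\<close> is comparable to the resampling probability \<open>q\<close>. The mean weight
  then decays like \<open>(1 - q/4)\<^sup>n\<close>, which is faster than \<open>z\<^sup>n\<^sup>/\<^sup>8\<close> (\<open>weight_decay\<close>, \<open>rate_bound\<close>), and
  Markov's inequality gives the claim.
\<close>

section \<open>Permutations that match two colourings\<close>

text \<open>
  Choose the permutation with the fewest mismatches between \<open>\<psi>\<close> and \<open>\<nu> \<circ> \<pi>\<close>. If some \<open>k0\<close> of
  colour \<open>j\<close> is mismatched, then the whole fibre of \<open>\<nu>\<close> over \<open>j\<close> is already used by correctly matched
  points, so the mismatches over \<open>j\<close> are exactly the excess of the fibre of \<open>\<psi>\<close>. If none is mismatched,
  the truncated subtraction makes the bound trivial.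
\<close>

lemma permutation_matching_fibres:
  fixes \<psi> \<nu> :: "'k \<Rightarrow> 'j"
  assumes F: "finite F"
  shows "\<exists>\<pi>. \<pi> permutes F \<and>
    (\<forall>j. card {k\<in>F. \<psi> k = j \<and> \<nu> (\<pi> k) \<noteq> j} \<le> card {k\<in>F. \<psi> k = j} - card {k\<in>F. \<nu> k = j})"
proof -
  define mis where "mis \<pi> = {k\<in>F. \<nu> (\<pi> k) \<noteq> \<psi> k}" for \<pi>
  have "id permutes F" by (rule permutes_id)
  then obtain \<pi> where \<pi>: "\<pi> permutes F" and
    least: "\<And>\<rho>. \<rho> permutes F \<Longrightarrow> card (mis \<pi>) \<le> card (mis \<rho>)"
    using ex_has_least_nat[of "\<lambda>\<pi>. \<pi> permutes F" id "\<lambda>\<pi>. card (mis \<pi>)"] by blast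
  have fin: "finite (mis \<rho>)" for \<rho> using F by (simp add: mis_def)
  have "card {k\<in>F. \<psi> k = j \<and> \<nu> (\<pi> k) \<noteq> j} \<le> card {k\<in>F. \<psi> k = j} - card {k\<in>F. \<nu> k = j}" for j
  proof (cases "\<exists>k0\<in>F. \<psi> k0 = j \<and> \<nu> (\<pi> k0) \<noteq> j")
    case False
    then have "{k\<in>F. \<psi> k = j \<and> \<nu> (\<pi> k) \<noteq> j} = {}" by auto
    then show ?thesis by (metis card.empty le0)
  next
    case True
    then obtain k0 where k0: "k0 \<in> F" "\<psi> k0 = j" "\<nu> (\<pi> k0) \<noteq> j" by auto
    \<comment> \<open>Otherwise exchanging the images of \<open>k0\<close> and \<open>k\<close> would repair \<open>k0\<close> without a new mismatch.\<close>
    have *: "\<psi> k = j" if k: "k \<in> F" "\<nu> (\<pi> k) = j" for k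
    proof (rule ccontr)
      assume kj: "\<psi> k \<noteq> j"
      define \<rho> where "\<rho> = \<pi> \<circ> Transposition.transpose k0 k"
      have \<rho>: "\<rho> permutes F"
        unfolding \<rho>_def using permutes_compose[OF permutes_swap_id[OF k0(1) k(1)] \<pi>] .
      have "mis \<rho> \<subseteq> mis \<pi> - {k0}"
      proof
        fix x assume x: "x \<in> mis \<rho>"
        consider "x = k0" | "x = k" "x \<noteq> k0" | "x \<noteq> k" "x \<noteq> k0" by auto
        then show "x \<in> mis \<pi> - {k0}"
        proof cases
          case 1 then show ?thesis using x k0 k by (simp add: mis_def \<rho>_def)
        next
          case 2 then show ?thesis using kj k by (simp add: mis_def)
        next
          case 3 then show ?thesis using x by (simp add: mis_def \<rho>_def)
        qed
      qed
      moreover have "k0 \<in> mis \<pi>" using k0 by (simp add: mis_def)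
      ultimately have "card (mis \<rho>) < card (mis \<pi>)"
        using fin by (intro psubset_card_mono) auto
      then show False using least[OF \<rho>] by simp
    qed
    have "bij_betw \<pi> {k\<in>F. \<nu> (\<pi> k) = j} {k\<in>F. \<nu> k = j}"
    proof (rule bij_betw_imageI)
      show "inj_on \<pi> {k\<in>F. \<nu> (\<pi> k) = j}" using permutes_inj[OF \<pi>] by (auto simp: inj_on_def)
      show "\<pi> ` {k\<in>F. \<nu> (\<pi> k) = j} = {k\<in>F. \<nu> k = j}"
      proof safe
        fix k assume "k \<in> F" then show "\<pi> k \<in> F" using permutes_in_image[OF \<pi>] by simp
      next
        fix k assume k: "k \<in> F" "j = \<nu> k"
        then obtain k' where "k' \<in> F" "k = \<pi> k'" using permutes_image[OF \<pi>] by blast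
        with k show "k \<in> \<pi> ` {x\<in>F. \<nu> (\<pi> x) = \<nu> k}" by auto
      qed
    qed
    then have c: "card {k\<in>F. \<nu> (\<pi> k) = j} = card {k\<in>F. \<nu> k = j}" by (rule bij_betw_same_card)
    have "{k\<in>F. \<psi> k = j} = {k\<in>F. \<psi> k = j \<and> \<nu> (\<pi> k) \<noteq> j} \<union> {k\<in>F. \<nu> (\<pi> k) = j}"
      using * by auto
    then have "card {k\<in>F. \<psi> k = j} = card {k\<in>F. \<psi> k = j \<and> \<nu> (\<pi> k) \<noteq> j} + card {k\<in>F. \<nu> (\<pi> k) = j}"
      using F by (subst card_Un_disjoint[symmetric]) auto
    then show ?thesis using c by simp
  qed
  with \<pi> show ?thesis by blast
qed

section \<open>An exponential moment bound for a resampled walk\<close>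

text \<open>
  The convex function \<open>h \<mapsto> z\<^sup>h\<close> lies below its chord over \<open>{0..l}\<close>. This turns a bound on the average
  number of mismatches in a stretch of length \<open>l\<close> into one on the average weight.
\<close>

lemma power_le_chord:
  fixes z :: real
  assumes z: "0 \<le> z" "z \<le> 1" and h: "h \<le> l"
  shows "real l * z ^ h \<le> real l - real h * (1 - z ^ l)"
proof -
  have bern: "real h * z ^ m * (1 - z) \<le> 1 - z ^ h" if "h \<le> m" for m
  proof -
    have "real h * z ^ m = (\<Sum>i<h. z ^ m)" by simp
    also have "\<dots> \<le> (\<Sum>i<h. z ^ i)"
      using that z by (intro sum_mono power_decreasing) auto
    finally have "real h * z ^ m * (1 - z) \<le> (\<Sum>i<h. z ^ i) * (1 - z)"
      using z by (intro mult_right_mono) auto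
    also have "\<dots> = 1 - z ^ h" by (metis one_diff_power_eq mult.commute)
    finally show ?thesis .
  qed
  have "real h * (1 - z ^ l) \<le> real l * (1 - z ^ h)"
    using h
  proof (induction l rule: dec_induct)
    case base then show ?case by simp
  next
    case (step m)
    have "real h * (1 - z ^ Suc m) = real h * (1 - z ^ m) + real h * z ^ m * (1 - z)"
      by (simp add: algebra_simps)
    also have "\<dots> \<le> real m * (1 - z ^ h) + (1 - z ^ h)"
      using step bern[OF step(1)] by linarith
    finally show ?case by (simp add: algebra_simps)
  qed
  then show ?thesis by (simp add: algebra_simps)
qed

definition mismatch :: "'c list \<Rightarrow> 'c list \<Rightarrow> nat" where
  "mismatch xs ys = card {i. i < length xs \<and> xs ! i \<noteq> ys ! i}"

lemma mismatch_Nil [simp]: "mismatch [] ys = 0"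
  by (simp add: mismatch_def)

lemma mismatch_Cons [simp]:
  "mismatch (x # xs) (y # ys) = (if x = y then 0 else 1) + mismatch xs ys"
proof -
  have "{i. i < length (x # xs) \<and> (x # xs) ! i \<noteq> (y # ys) ! i} =
      {i. i = 0 \<and> x \<noteq> y} \<union> Suc ` {i. i < length xs \<and> xs ! i \<noteq> ys ! i}" (is "?A = ?B \<union> ?C")
    by (auto simp: less_Suc_eq_0_disj)
  moreover have "card (?B \<union> ?C) = card ?B + card ?C"
    by (rule card_Un_disjoint) auto
  moreover have "card ?C = mismatch xs ys"
    by (simp add: mismatch_def card_image)
  ultimately show ?thesis by (simp add: mismatch_def)
qed

text \<open>
  A walk on the states below \<open>K\<close>, driven by letters below \<open>K * w\<close>: the \<open>K\<close> smallest
  letters rotate the state by every possible amount and thus resample it uniformly when the letter is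
  random, which happens with probability \<open>1 / w\<close>. All other letters apply \<open>\<pi>\<close>. By the condition
  on \<open>col\<close>, no colour is carried by more than half of the states.
\<close>

locale resampling_walk =
  fixes K w :: nat and \<pi> :: "nat \<Rightarrow> nat" and col :: "nat \<Rightarrow> nat"
  assumes K: "0 < K" and w: "0 < w" and \<pi>: "\<pi> permutes {..<K}"
    and balanced: "\<And>c. K \<le> 2 * card {i\<in>{..<K}. col i \<noteq> c}"
begin

definition step :: "nat \<Rightarrow> nat \<Rightarrow> nat" where
  "step a i = (if a < K then (i + a) mod K else \<pi> i)"

fun walk :: "nat \<Rightarrow> nat list \<Rightarrow> nat list" where
  "walk i [] = []"
| "walk i (a # as) = i # walk (step a i) as"

definition letters :: "nat \<Rightarrow> nat list set" where
  "letters n = {as. set as \<subseteq> {..<K * w} \<and> length as = n}"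

lemma length_walk [simp]: "length (walk i as) = length as"
  by (induction as arbitrary: i) auto

lemma finite_letters [simp]: "finite (letters n)"
  unfolding letters_def by (rule finite_lists_length_eq) simp

lemma sum_letters_Suc: "(\<Sum>as\<in>letters (Suc n). f as) = (\<Sum>a<K * w. \<Sum>as\<in>letters n. f (a # as))"
proof -
  have "(\<Sum>as\<in>letters (Suc n). f as) = (\<Sum>(as, a)\<in>letters n \<times> {..<K * w}. f (a # as))"
    unfolding letters_def lists_length_Suc_eq
    by (subst sum.reindex) (auto simp: inj_on_def case_prod_unfold)
  also have "\<dots> = (\<Sum>as\<in>letters n. \<Sum>a<K * w. f (a # as))"
    by (rule sum.cartesian_product[symmetric])
  finally show ?thesis by (subst sum.swap)
qed

lemma inj_on_rotate: "inj_on (\<lambda>a. (i + a) mod K) {..<K}"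
proof -
  have le: "a = b" if "a < K" "b < K" "(i + a) mod K = (i + b) mod K" "a \<le> b" for a b
  proof -
    have "K dvd b - a" using that mod_eq_dvd_iff_nat[of "i + a" "i + b" K] by simp
    moreover have "b - a < K" using that by simp
    ultimately have "b - a = 0" by (meson nat_dvd_not_less gr_zeroI)
    then show ?thesis using that by simp
  qed
  show ?thesis
  proof (rule inj_onI)
    fix a b assume "a \<in> {..<K}" "b \<in> {..<K}" "(i + a) mod K = (i + b) mod K"
    then show "a = b" using le[of a b] le[of b a] by (cases "a \<le> b") auto
  qed
qed

lemma sum_rotate:
  fixes f :: "nat \<Rightarrow> 'b::comm_monoid_add"
  shows "(\<Sum>a<K. f ((i + a) mod K)) = (\<Sum>j<K. f j)"
proof (rule sum.reindex_bij_betw)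
  have "(\<lambda>a. (i + a) mod K) ` {..<K} = {..<K}"
    using K by (intro endo_inj_surj inj_on_rotate) auto
  then show "bij_betw (\<lambda>a. (i + a) mod K) {..<K} {..<K}" by (intro bij_betw_imageI inj_on_rotate)
qed

lemma \<pi>_less: "i < K \<Longrightarrow> \<pi> i < K"
  using permutes_in_image[OF \<pi>] by auto

lemma sum_\<pi>_pow:
  fixes f :: "nat \<Rightarrow> 'b::comm_monoid_add"
  shows "(\<Sum>i<K. f ((\<pi> ^^ k) i)) = (\<Sum>i<K. f i)"
  by (rule sum.reindex_bij_betw) (rule bij_betw_funpow[OF permutes_imp_bij[OF \<pi>]])

context
  fixes q z :: real
  assumes q: "q = 1 / real w" and z: "z = 1 - 3 * q / 4"
begin

text \<open>
  The mean of \<open>z\<^sup>m\<close>, where \<open>m\<close> is the number of mismatches between \<open>v\<close> and the colours of the walk that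
  starts at \<open>i\<close> and is driven by random letters.
\<close>

definition weight :: "nat list \<Rightarrow> nat \<Rightarrow> real" where
  "weight v i = (\<Sum>as\<in>letters (length v). z ^ mismatch (map col (walk i as)) v) / real (K * w) ^ length v"

text \<open>The mismatches of an orbit of \<open>\<pi>\<close> with \<open>ps\<close>, that is, of a stretch without resampling.\<close>

definition past :: "nat list \<Rightarrow> nat \<Rightarrow> nat" where
  "past ps i = card {k. k < length ps \<and> col ((\<pi> ^^ k) i) \<noteq> ps ! k}"

lemma q_bounds: "0 < q" "q \<le> 1" using w by (auto simp: q)

lemma z_bounds: "0 < z" "z \<le> 1" using q_bounds by (auto simp: z)

lemma weight_Nil [simp]: "weight [] i = 1"
proof -
  have "letters 0 = {[]}" by (auto simp: letters_def)
  then show ?thesis by (simp add: weight_def)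
qed

lemma weight_Cons:
  "weight (c # v) i = z ^ (if col i = c then 0 else 1) * ((\<Sum>a<K * w. weight v (step a i)) / real (K * w))"
proof -
  have "(\<Sum>as\<in>letters (Suc (length v)). z ^ mismatch (map col (walk i as)) (c # v)) =
    (\<Sum>a<K * w. \<Sum>as\<in>letters (length v). z ^ (if col i = c then 0 else 1) * z ^ mismatch (map col (walk (step a i) as)) v)"
    unfolding sum_letters_Suc by (simp add: power_add)
  also have "\<dots> = z ^ (if col i = c then 0 else 1) * (\<Sum>a<K * w. \<Sum>as\<in>letters (length v). z ^ mismatch (map col (walk (step a i) as)) v)"
    by (simp add: sum_distrib_left)
  finally show ?thesis by (simp add: weight_def sum_divide_distrib[symmetric] divide_simps)
qed

lemma weight_nonneg: "0 \<le> weight v i"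
  using z_bounds by (auto simp: weight_def intro!: sum_nonneg divide_nonneg_nonneg)

lemma step_average:
  "(\<Sum>a<K * w. f (step a i)) / real (K * w) = q * ((\<Sum>j<K. f j) / real K) + (1 - q) * f (\<pi> i)"
  for f :: "nat \<Rightarrow> real"
proof -
  have "K \<le> K * w" using w by simp
  then have "{..<K * w} = {..<K} \<union> {K..<K * w}" by (rule ivl_disj_un_one(2)[symmetric])
  moreover have "sum g ({..<K} \<union> {K..<K * w}) = sum g {..<K} + sum g {K..<K * w}" for g :: "nat \<Rightarrow> real"
    by (rule sum.union_disjoint) auto
  ultimately have "(\<Sum>a<K * w. f (step a i)) = (\<Sum>a<K. f (step a i)) + (\<Sum>a\<in>{K..<K * w}. f (step a i))"
    by metis
  also have "(\<Sum>a<K. f (step a i)) = (\<Sum>a<K. f ((i + a) mod K))"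
    by (rule sum.cong) (auto simp: step_def)
  also have "\<dots> = (\<Sum>j<K. f j)" by (rule sum_rotate)
  also have "(\<Sum>a\<in>{K..<K * w}. f (step a i)) = real (K * w - K) * f (\<pi> i)"
    by (simp add: step_def)
  finally have *: "(\<Sum>a<K * w. f (step a i)) = (\<Sum>j<K. f j) + (real K * real w - real K) * f (\<pi> i)"
    using \<open>K \<le> K * w\<close> by (simp add: of_nat_diff)
  show ?thesis unfolding * q using K w by (simp add: field_simps)
qed

text \<open>
  For a uniformly distributed \<open>i\<close> each point of its \<open>\<pi>\<close>-orbit is uniformly distributed too. Hence at every position the
  colour differs from the prescribed one for at least half of the states.
\<close>

lemma past_average: "(\<Sum>i<K. z ^ past ps i) \<le> real K * (1 + z ^ length ps) / 2"
proof (cases "ps = []")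
  case True then show ?thesis by (simp add: past_def)
next
  case False
  define l where "l = length ps"
  have l: "0 < l" using False by (simp add: l_def)
  have pl: "past ps i \<le> l" for i
  proof -
    have "past ps i \<le> card {..<l}" unfolding past_def l_def by (rule card_mono) auto
    then show ?thesis by simp
  qed
  have past_sum: "past ps i = (\<Sum>k<l. if col ((\<pi> ^^ k) i) \<noteq> ps ! k then 1 else 0)" for i
    unfolding past_def l_def[symmetric] by (simp add: sum.If_cases Int_def)
  have "(\<Sum>i<K. past ps i) = (\<Sum>k<l. \<Sum>i<K. if col ((\<pi> ^^ k) i) \<noteq> ps ! k then 1 else 0)"
    unfolding past_sum by (rule sum.swap)
  also have "\<dots> = (\<Sum>k<l. card {i\<in>{..<K}. col i \<noteq> ps ! k})"
    by (subst sum_\<pi>_pow[where f = "\<lambda>i. if col i \<noteq> _ then 1 else 0"]) (simp add: sum.If_cases Int_def)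
  finally have "2 * (\<Sum>i<K. past ps i) = (\<Sum>k<l. 2 * card {i\<in>{..<K}. col i \<noteq> ps ! k})"
    by (simp add: sum_distrib_left)
  also have "\<dots> \<ge> (\<Sum>k<l. K)" by (rule sum_mono) (rule balanced)
  finally have "l * K \<le> 2 * (\<Sum>i<K. past ps i)" by simp
  then have half: "real l * real K \<le> 2 * (\<Sum>i<K. real (past ps i))"
    by (metis of_nat_le_iff of_nat_mult of_nat_numeral of_nat_sum)
  have zl: "0 \<le> 1 - z ^ l" using z_bounds by (simp add: power_le_one)
  have "real l * (\<Sum>i<K. z ^ past ps i) \<le> (\<Sum>i<K. real l - real (past ps i) * (1 - z ^ l))"
    unfolding sum_distrib_left using z_bounds pl by (intro sum_mono power_le_chord) auto
  also have "\<dots> = real K * real l - (1 - z ^ l) * (\<Sum>i<K. real (past ps i))"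
    by (simp add: sum_subtractf sum_distrib_left mult.commute)
  also have "\<dots> \<le> real K * real l - (1 - z ^ l) * (real l * real K / 2)"
    using half zl by (intro diff_left_mono mult_left_mono) auto
  also have "\<dots> = real l * (real K * (1 + z ^ l) / 2)" by (simp add: field_simps)
  finally show ?thesis using l by (simp add: l_def)
qed

lemma past_snoc: "past (ps @ [c]) i = past ps i + (if col ((\<pi> ^^ length ps) i) = c then 0 else 1)"
proof -
  have "{k. k < length (ps @ [c]) \<and> col ((\<pi> ^^ k) i) \<noteq> (ps @ [c]) ! k} =
    {k. k < length ps \<and> col ((\<pi> ^^ k) i) \<noteq> ps ! k} \<union> {k. k = length ps \<and> col ((\<pi> ^^ length ps) i) \<noteq> c}"
    (is "?A = ?B \<union> ?C") by (auto simp: nth_append less_Suc_eq)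
  moreover have "card (?B \<union> ?C) = card ?B + card ?C" by (rule card_Un_disjoint) auto
  ultimately show ?thesis by (auto simp: past_def)
qed

text \<open>
  The statement is generalised over the stretch \<open>ps\<close> since the last resampling, so that it can be proved by
  induction on the word still to come. In one step the stretch grows, or a
  resampling closes it with the weight of \<open>past_average\<close> and starts afresh. The ansatz
  \<open>(x + y z\<^sup>l) \<lambda>\<^sup>n\<close> for the bound is preserved if \<open>y = x / 2\<close>, \<open>\<lambda> = 1 - q / 4\<close> and \<open>z = 1 - 3 q / 4\<close>.
\<close>

lemma weight_decay_past:
  "(\<Sum>i<K. z ^ past ps i * weight v ((\<pi> ^^ length ps) i)) \<le>
     real K * (1 - q / 4) ^ length v * (2 + z ^ length ps) / 2"
proof (induction v arbitrary: ps)
  case Nil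
  have "(\<Sum>i<K. z ^ past ps i) \<le> real K * (1 + z ^ length ps) / 2" by (rule past_average)
  then show ?case by (simp add: field_simps)
next
  case (Cons c v)
  define Z where "Z = z ^ length ps"
  define \<Lambda> where "\<Lambda> = (1 - q / 4) ^ length v"
  have Z: "0 \<le> Z" using z_bounds by (simp add: Z_def)
  have \<Lambda>: "0 \<le> \<Lambda>" using q_bounds by (simp add: \<Lambda>_def)
  define F where "F = (\<Sum>j<K. weight v j) / real K"
  have F: "F \<le> \<Lambda> * 3 / 2"
    using Cons.IH[of "[]"] K by (simp add: F_def past_def \<Lambda>_def field_simps)
  have "z ^ past ps i * weight (c # v) ((\<pi> ^^ length ps) i) =
      q * F * z ^ past (ps @ [c]) i + (1 - q) * (z ^ past (ps @ [c]) i * weight v ((\<pi> ^^ length (ps @ [c])) i))" for i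
    unfolding weight_Cons step_average past_snoc F_def by (simp add: power_add algebra_simps)
  then have "(\<Sum>i<K. z ^ past ps i * weight (c # v) ((\<pi> ^^ length ps) i)) =
      q * F * (\<Sum>i<K. z ^ past (ps @ [c]) i) +
      (1 - q) * (\<Sum>i<K. z ^ past (ps @ [c]) i * weight v ((\<pi> ^^ length (ps @ [c])) i))"
    by (simp only: sum.distrib sum_distrib_left)
  also have "\<dots> \<le> q * (\<Lambda> * 3 / 2) * (real K * (1 + z * Z) / 2) + (1 - q) * (real K * \<Lambda> * (2 + z * Z) / 2)"
  proof (intro add_mono mult_mono mult_left_mono F)
    show "(\<Sum>i<K. z ^ past (ps @ [c]) i) \<le> real K * (1 + z * Z) / 2"
      using past_average[of "ps @ [c]"] by (simp add: Z_def)
    show "(\<Sum>i<K. z ^ past (ps @ [c]) i * weight v ((\<pi> ^^ length (ps @ [c])) i)) \<le> real K * \<Lambda> * (2 + z * Z) / 2"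
      using Cons.IH[of "ps @ [c]"] by (simp add: Z_def \<Lambda>_def)
      show "0 \<le> F" unfolding F_def by (intro divide_nonneg_nonneg sum_nonneg weight_nonneg) simp
    show "0 \<le> (\<Sum>i<K. z ^ past (ps @ [c]) i)" using z_bounds by (intro sum_nonneg zero_le_power) simp
  qed (use q_bounds z_bounds \<Lambda> weight_nonneg in \<open>auto intro!: sum_nonneg mult_nonneg_nonneg\<close>)
  also have "\<dots> = real K * \<Lambda> / 2 * (2 - q / 2 + z * (1 + q / 2) * Z)"
    by (simp add: field_simps)
  \<comment> \<open>This comparison of the coefficients of \<open>Z\<close> determines \<open>z\<close>. The constant coefficients agree by the choice of \<open>1 - q / 4\<close>.\<close>
  also have "\<dots> \<le> real K * \<Lambda> / 2 * (2 - q / 2 + (1 - q / 4) * Z)"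
  proof -
    have "z * (1 + q / 2) = 1 - q / 4 - 3 / 8 * q\<^sup>2" unfolding z by (simp add: field_simps power2_eq_square)
    then have "z * (1 + q / 2) \<le> 1 - q / 4" by simp
    then show ?thesis using \<Lambda> Z by (intro mult_left_mono add_left_mono mult_right_mono) auto
  qed
  also have "\<dots> = real K * (1 - q / 4) ^ length (c # v) * (2 + z ^ length ps) / 2"
    by (simp add: \<Lambda>_def Z_def field_simps)
  finally show ?case .
qed

lemma weight_decay: "(\<Sum>i<K. weight v i) \<le> real K * (1 - q / 4) ^ length v * 3 / 2"
  using weight_decay_past[of "[]" v] by (simp add: past_def)

text \<open>This is what permits the radius \<open>1 / 8\<close>: eight steps gain more than a single mismatch costs.\<close>

lemma rate_bound: "(1 - q / 4) ^ 8 < z"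
proof -
  have "(1 - q / 4)\<^sup>2 \<le> 1 - 7 / 16 * q"
    using q_bounds mult_right_le_one_le[of q q] by (simp add: power2_eq_square field_simps)
  then have "((1 - q / 4)\<^sup>2)\<^sup>2 \<le> (1 - 7 / 16 * q)\<^sup>2"
    using q_bounds by (intro power_mono) auto
  also have "\<dots> \<le> 1 - 2 / 3 * q"
    using q_bounds mult_right_le_one_le[of q q] by (simp add: power2_eq_square field_simps)
  finally have "(((1 - q / 4)\<^sup>2)\<^sup>2)\<^sup>2 \<le> (1 - 2 / 3 * q)\<^sup>2"
    using q_bounds by (intro power_mono) auto
  also have "\<dots> < 1 - 3 / 4 * q"
    using q_bounds mult_right_le_one_le[of q q] by (simp add: power2_eq_square field_simps)
  finally show ?thesis by (simp add: z)
qed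

text \<open>Markov's inequality for the weight, written as a count of the walks.\<close>

lemma few_walks_near_word:
  assumes m: "8 * m \<le> length v"
  shows "real (card {(i, as). i < K \<and> as \<in> letters (length v) \<and> mismatch (map col (walk i as)) v \<le> m}) \<le>
    3 / 2 * ((1 - q / 4) ^ length v / z ^ m) * real K * real (K * w) ^ length v" (is "real (card ?A) \<le> _")
proof -
  have sub: "?A \<subseteq> {..<K} \<times> letters (length v)" by auto
  have "z ^ m * real (card ?A) = (\<Sum>p\<in>?A. z ^ m)" by simp
  also have "\<dots> \<le> (\<Sum>(i, as)\<in>?A. z ^ mismatch (map col (walk i as)) v)"
    using z_bounds by (intro sum_mono) (auto intro: power_decreasing)
  also have "\<dots> \<le> (\<Sum>(i, as)\<in>{..<K} \<times> letters (length v). z ^ mismatch (map col (walk i as)) v)"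
    using sub z_bounds by (intro sum_mono2) auto
  also have "\<dots> = (\<Sum>i<K. weight v i) * real (K * w) ^ length v"
    using K w by (simp add: sum.cartesian_product[symmetric] weight_def sum_divide_distrib[symmetric])
  also have "\<dots> \<le> (real K * (1 - q / 4) ^ length v * 3 / 2) * real (K * w) ^ length v"
    by (intro mult_right_mono weight_decay) auto
  finally show ?thesis using z_bounds by (simp add: field_simps)
qed

end

end

section \<open>Cells of the unit interval and expansions in a base\<close>

lemma sets_Collect_count:
  assumes "f \<in> measurable M (count_space UNIV)"
  shows "{x \<in> space M. Q (f x)} \<in> sets M"
proof -
  have "f -` {i. Q i} \<inter> space M \<in> sets M" by (rule measurable_sets[OF assms]) simp
  moreover have "f -` {i. Q i} \<inter> space M = {x \<in> space M. Q (f x)}" by auto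
  ultimately show ?thesis by (simp only:)
qed

lemma sets_Collect_xor:
  assumes "{x \<in> space M. P x} \<in> sets M" "{x \<in> space M. Q x} \<in> sets M"
  shows "{x \<in> space M. P x \<noteq> Q x} \<in> sets M"
proof -
  let ?A = "{x \<in> space M. P x}" and ?B = "{x \<in> space M. Q x}"
  have "(?A - ?B) \<union> (?B - ?A) \<in> sets M" by (intro sets.Un sets.Diff assms)
  moreover have "(?A - ?B) \<union> (?B - ?A) = {x \<in> space M. P x \<noteq> Q x}" by auto
  ultimately show ?thesis by (simp only:)
qed

text \<open>The position of \<open>y\<close> among \<open>N\<close> consecutive cells of length \<open>1 / N\<close>.\<close>

definition idx :: "nat \<Rightarrow> real \<Rightarrow> nat" where
  "idx N y = nat \<lfloor>real N * y\<rfloor>"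

abbreviation unit_interval :: "real measure" where
  "unit_interval \<equiv> restrict_space lborel {0..<1}"

lemma idx_less: "0 < N \<Longrightarrow> 0 \<le> y \<Longrightarrow> y < 1 \<Longrightarrow> idx N y < N"
  unfolding idx_def by (subst nat_less_iff) (auto simp: floor_less_iff)

lemma idx_eq_iff: "0 \<le> y \<Longrightarrow> idx N y = j \<longleftrightarrow> real j \<le> real N * y \<and> real N * y < real j + 1"
proof -
  assume "0 \<le> y"
  then have "idx N y = j \<longleftrightarrow> \<lfloor>real N * y\<rfloor> = int j" by (auto simp: idx_def nat_eq_iff)
  then show ?thesis by (simp add: floor_eq_iff)
qed

lemma idx_bounds: "0 \<le> y \<Longrightarrow> real (idx N y) \<le> real N * y \<and> real N * y < real (idx N y) + 1"
  using idx_eq_iff[of y N "idx N y"] by simp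

lemma idx_mult_div:
  assumes "0 \<le> y" "0 < K"
  shows "idx (N * K) y div K = idx N y"
proof -
  have "\<lfloor>real N * y\<rfloor> = \<lfloor>(real (N * K) * y) / real_of_int (int K)\<rfloor>"
    using assms by simp
  also have "\<dots> = \<lfloor>real (N * K) * y\<rfloor> div int K"
    by (rule floor_divide_real_eq_div) simp
  finally show ?thesis
    using assms by (simp add: idx_def nat_div_distrib)
qed

lemma idx_vimage:
  assumes "0 < N" "j < N"
  shows "{y \<in> {0..<1}. idx N y = j} = {real j / real N..<(real j + 1) / real N}"
proof (intro set_eqI iffI)
  fix y assume y: "y \<in> {real j / real N..<(real j + 1) / real N}"
  have "real j + 1 \<le> real N" using assms by linarith
  then have "(real j + 1) / real N \<le> 1" using assms by (simp add: field_simps)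
  moreover have "0 \<le> real j / real N" by simp
  ultimately have "0 \<le> y" "y < 1" using y unfolding atLeastLessThan_iff by linarith+
  then show "y \<in> {y \<in> {0..<1}. idx N y = j}" using y assms by (simp add: idx_eq_iff field_simps)
next
  fix y assume y: "y \<in> {y \<in> {0..<1}. idx N y = j}"
  then have "real j \<le> real N * y" "real N * y < real j + 1"
    using idx_eq_iff[of y N j] by auto
  then show "y \<in> {real j / real N..<(real j + 1) / real N}" using assms by (simp add: field_simps)
qed

lemma borel_measurable_idx [measurable]: "idx N \<in> measurable borel (count_space UNIV)"
  unfolding idx_def by measurable

lemma space_unit_interval [simp]: "space unit_interval = {0..<1}"
  by (simp add: space_restrict_space)

lemma sets_unit_interval: "A \<in> sets unit_interval \<longleftrightarrow> A \<in> sets borel \<and> A \<subseteq> {0..<1}"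
  by (subst sets_restrict_space_iff) auto

lemma measurable_unit_intervalI: "f \<in> measurable borel N \<Longrightarrow> f \<in> measurable unit_interval N"
  by (rule measurable_restrict_space1) simp

lemma prob_space_unit_interval: "prob_space unit_interval"
  by (rule prob_spaceI) (simp add: emeasure_restrict_space)

lemma measure_unit_interval: "A \<in> sets borel \<Longrightarrow> A \<subseteq> {0..<1} \<Longrightarrow> measure unit_interval A = measure lborel A"
  by (rule measure_restrict_space) auto

lemma measure_idx:
  assumes "0 < N" "j < N"
  shows "measure unit_interval {y \<in> {0..<1}. idx N y = j} = 1 / real N"
proof -
  have "{real j / real N..<(real j + 1) / real N} \<subseteq> {0..<1}"
    using idx_vimage[OF assms] by blast
  then show ?thesis unfolding idx_vimage[OF assms]
    using assms by (subst measure_unit_interval) (auto simp: field_simps)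
qed

locale radix =
  fixes b :: nat
  assumes b: "2 \<le> b"
begin

definition digit :: "real \<Rightarrow> nat \<Rightarrow> nat" where
  "digit y k = idx (b ^ Suc k) y mod b"

fun prefix :: "(nat \<Rightarrow> nat) \<Rightarrow> nat \<Rightarrow> nat" where
  "prefix d 0 = 0"
| "prefix d (Suc m) = b * prefix d m + d m"

text \<open>
  The digit sequences that the points of the half-open unit interval produce. Excluding the sequences that
  end in \<open>b - 1\<close> makes the expansion unique, and this condition is invariant under permuting positions.
\<close>

definition expansion :: "(nat \<Rightarrow> nat) \<Rightarrow> bool" where
  "expansion d \<longleftrightarrow> (\<forall>k. d k < b) \<and> (\<forall>m. \<exists>k\<ge>m. d k \<noteq> b - 1)"

definition val :: "(nat \<Rightarrow> nat) \<Rightarrow> real" where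
  "val d = (\<Sum>k. real (d k) / real b ^ Suc k)"

lemma digit_less: "digit y k < b"
  using b by (simp add: digit_def)

lemma prefix_digit:
  assumes "0 \<le> y" "y < 1"
  shows "prefix (digit y) m = idx (b ^ m) y"
proof (induction m)
  case 0 then show ?case using idx_less[of 1 y] assms by simp
next
  case (Suc m)
  have "idx (b ^ m * b) y div b = idx (b ^ m) y"
    using assms b by (intro idx_mult_div) auto
  then have "idx (b ^ Suc m) y = b * idx (b ^ m) y + idx (b ^ Suc m) y mod b"
    by (metis mult_div_mod_eq power_Suc2)
  then show ?case using Suc by (simp add: digit_def)
qed

lemma prefix_less: "(\<And>k. k < m \<Longrightarrow> d k < b) \<Longrightarrow> prefix d m < b ^ m"
proof (induction m)
  case (Suc m)
  then have "prefix d m + 1 \<le> b ^ m" by (simp add: Suc_leI)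
  then have "b * (prefix d m + 1) \<le> b * b ^ m" by (rule mult_le_mono2)
  moreover have "d m < b" using Suc by simp
  ultimately show ?case by simp
qed simp

lemma prefix_eq_iff:
  assumes "\<And>k. k < m \<Longrightarrow> d k < b" "\<And>k. k < m \<Longrightarrow> e k < b"
  shows "prefix d m = prefix e m \<longleftrightarrow> (\<forall>k<m. d k = e k)"
  using assms
proof (induction m)
  case (Suc m)
  have lt: "d m < b" "e m < b" using Suc by auto
  have "prefix d (Suc m) = prefix e (Suc m) \<longleftrightarrow> prefix d m = prefix e m \<and> d m = e m"
  proof
    assume eq: "prefix d (Suc m) = prefix e (Suc m)"
    then have "prefix d (Suc m) mod b = prefix e (Suc m) mod b" by simp
    then have "d m = e m" using lt by simp
    with eq b show "prefix d m = prefix e m \<and> d m = e m" by simp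
  qed simp
  also have "\<dots> \<longleftrightarrow> (\<forall>k<Suc m. d k = e k)" using Suc by (auto simp: less_Suc_eq)
  finally show ?case .
qed simp

lemma summable_val: "(\<And>k. d k < b) \<Longrightarrow> summable (\<lambda>k. real (d k) / real b ^ Suc k)"
proof -
  assume d: "\<And>k. d k < b"
  have "summable (\<lambda>k. (1 / real b) ^ k)" using b by (intro summable_geometric) auto
  moreover have "norm (real (d k) / real b ^ Suc k) \<le> (1 / real b) ^ k" for k
  proof -
    have "real (d k) / real b ^ Suc k \<le> real b / real b ^ Suc k"
      using d[of k] by (intro divide_right_mono) auto
    also have "\<dots> = (1 / real b) ^ k" using b by (simp add: power_one_over)
    finally show ?thesis by simp
  qed
  ultimately show ?thesis by (rule summable_comparison_test'[where N = 0])
qed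

lemma val_max: "(\<lambda>k. real (b - 1) / real b ^ Suc k) sums 1"
proof -
  have "(\<lambda>k. real (b - 1) / real b * (1 / real b) ^ k) sums (real (b - 1) / real b * (1 / (1 - 1 / real b)))"
    using b by (intro sums_mult geometric_sums) auto
  moreover have "real (b - 1) / real b * (1 / (1 - 1 / real b)) = 1"
    using b by (simp add: field_simps of_nat_diff)
  moreover have "real (b - 1) / real b * (1 / real b) ^ k = real (b - 1) / real b ^ Suc k" for k
    by (simp add: power_one_over)
  ultimately show ?thesis by (simp only:)
qed

lemma val_bounds:
  assumes "expansion d"
  shows "0 \<le> val d" "val d < 1"
proof -
  have d: "d k < b" for k using assms by (simp add: expansion_def)
  show "0 \<le> val d" unfolding val_def by (intro suminf_nonneg summable_val d) simp
  obtain k0 where k0: "d k0 \<noteq> b - 1" using assms by (auto simp: expansion_def)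
  have s: "(\<lambda>k. real (b - 1) / real b ^ Suc k - real (d k) / real b ^ Suc k) sums (1 - val d)"
    unfolding val_def by (intro sums_diff val_max summable_sums summable_val d)
  have nn: "real (d k) / real b ^ Suc k \<le> real (b - 1) / real b ^ Suc k" for k
    using d[of k] by (intro divide_right_mono) auto
  have "0 < (\<Sum>k. real (b - 1) / real b ^ Suc k - real (d k) / real b ^ Suc k)"
  proof (rule suminf_pos2)
    show "summable (\<lambda>k. real (b - 1) / real b ^ Suc k - real (d k) / real b ^ Suc k)"
      using s by (rule sums_summable)
    have "d k0 < b - 1" using d[of k0] k0 by simp
    then show "0 < real (b - 1) / real b ^ Suc k0 - real (d k0) / real b ^ Suc k0"
      using b by (simp add: divide_strict_right_mono)
  qed (use nn in simp)
  then show "val d < 1" using s by (simp add: sums_iff)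
qed

text \<open>
  If \<open>d\<close> is an expansion, then so is its tail, whose value lies in the half-open unit interval. Then
  \<open>prefix d m\<close> is the integral part of \<open>b\<^sup>m val d\<close>.
\<close>

lemma val_shift:
  assumes "\<And>k. d k < b"
  shows "real b ^ m * val d = real (prefix d m) + val (\<lambda>k. d (k + m))"
proof (induction m)
  case 0 then show ?case by simp
next
  case (Suc m)
  let ?e = "\<lambda>k. d (k + m)"
  have sm: "summable (\<lambda>k. real (?e k) / real b ^ Suc k)" by (rule summable_val) (rule assms)
  have sm': "summable (\<lambda>k. real (d (k + Suc m)) / real b ^ Suc k)" by (rule summable_val) (rule assms)
  have "val ?e = real (d m) / real b + (\<Sum>k. real (?e (Suc k)) / real b ^ Suc (Suc k))"
    unfolding val_def using suminf_split_head[OF sm] by simp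
  also have "(\<Sum>k. real (?e (Suc k)) / real b ^ Suc (Suc k)) = (\<Sum>k. real (d (k + Suc m)) / real b ^ Suc k / real b)"
    by (simp add: field_simps)
  also have "\<dots> = val (\<lambda>k. d (k + Suc m)) / real b"
    unfolding val_def by (rule suminf_divide[OF sm'])
  finally have "real b * val ?e = real (d m) + val (\<lambda>k. d (k + Suc m))"
    using b by (simp add: field_simps)
  then show ?case using Suc by (simp add: algebra_simps)
qed

lemma expansion_shift: "expansion d \<Longrightarrow> expansion (\<lambda>k. d (k + m))"
proof -
  assume d: "expansion d"
  have "\<exists>k\<ge>i. d (k + m) \<noteq> b - 1" for i
  proof -
    obtain k where "i + m \<le> k" "d k \<noteq> b - 1" using d by (auto simp: expansion_def)
    then show ?thesis by (intro exI[of _ "k - m"]) auto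
  qed
  with d show ?thesis by (simp add: expansion_def)
qed

lemma idx_val:
  assumes "expansion d"
  shows "idx (b ^ m) (val d) = prefix d m"
proof -
  have "real b ^ m * val d = real (prefix d m) + val (\<lambda>k. d (k + m))"
    using assms by (intro val_shift) (simp add: expansion_def)
  then show ?thesis
    using val_bounds[OF assms] val_bounds[OF expansion_shift[OF assms]] by (subst idx_eq_iff) auto
qed

lemma digit_val: "expansion d \<Longrightarrow> digit (val d) = d"
  by (rule ext) (simp add: digit_def idx_val[of d "Suc _", simplified] expansion_def)

text \<open>If all digits from position \<open>m\<close> on were \<open>b - 1\<close>, the point would be the right end of its cell of level \<open>m\<close>, which is not in the cell.\<close>

lemma expansion_digit:
  assumes y: "0 \<le> y" "y < 1"
  shows "expansion (digit y)"
proof -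
  have "\<exists>k\<ge>m. digit y k \<noteq> b - 1" for m
  proof (rule ccontr)
    assume "\<not> (\<exists>k\<ge>m. digit y k \<noteq> b - 1)"
    then have *: "(\<lambda>k. digit y (k + m)) = (\<lambda>k. b - 1)" by auto
    define I where "I = idx (b ^ m) y"
    have I: "real b ^ m * y < real I + 1"
      using idx_eq_iff[OF y(1), of "b ^ m" I] by (simp add: I_def)
    have pr: "real (prefix (digit y) (m + j)) + 1 = real b ^ j * (real I + 1)" for j
    proof (induction j)
      case 0 then show ?case by (simp add: prefix_digit y I_def)
    next
      case (Suc j)
      have "digit y (m + j) = b - 1" using fun_cong[OF *, of j] by (simp add: add.commute)
      then have "real (prefix (digit y) (m + Suc j)) + 1 = real b * (real (prefix (digit y) (m + j)) + 1)"
        using b by (simp add: of_nat_diff algebra_simps)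
      then show ?case using Suc by simp
    qed
    have low: "real b ^ j * (real I + 1 - real b ^ m * y) \<le> 1" for j
    proof -
      have "real (prefix (digit y) (m + j)) \<le> real b ^ (m + j) * y"
        unfolding prefix_digit[OF y] using idx_bounds[OF y(1), of "b ^ (m + j)"] by simp
      then show ?thesis using pr[of j] by (simp add: algebra_simps power_add)
    qed
    obtain j where "1 / (real I + 1 - real b ^ m * y) < real b ^ j"
      using real_arch_pow[of "real b" "1 / (real I + 1 - real b ^ m * y)"] b by auto
    then have "1 < real b ^ j * (real I + 1 - real b ^ m * y)"
      using I by (simp add: field_simps)
    with low[of j] show False by simp
  qed
  then show ?thesis by (simp add: expansion_def digit_less)
qed

lemma val_digit:
  assumes y: "0 \<le> y" "y < 1"
  shows "val (digit y) = y"
proof (rule ccontr)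
  assume "val (digit y) \<noteq> y"
  then have pos: "0 < \<bar>val (digit y) - y\<bar>" by simp
  note e = expansion_digit[OF y]
  have close: "real b ^ m * \<bar>val (digit y) - y\<bar> < 1" for m
  proof -
    have "idx (b ^ m) (val (digit y)) = idx (b ^ m) y"
      using idx_val[OF e] prefix_digit[OF y] by simp
    then have "\<bar>real b ^ m * val (digit y) - real b ^ m * y\<bar> < 1"
      using idx_bounds[OF y(1), of "b ^ m"] idx_bounds[OF val_bounds(1)[OF e], of "b ^ m"]
      unfolding abs_less_iff by auto
    then show ?thesis by (simp add: abs_mult right_diff_distrib[symmetric])
  qed
  obtain m where "1 / \<bar>val (digit y) - y\<bar> < real b ^ m"
    using real_arch_pow[of "real b" "1 / \<bar>val (digit y) - y\<bar>"] b by auto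
  then show False using close[of m] pos by (simp add: field_simps)
qed

lemma measurable_digit [measurable]: "(\<lambda>y. digit y k) \<in> measurable borel (count_space UNIV)"
  unfolding digit_def by measurable

lemma measure_full_cylinder:
  assumes "\<And>k. k < m \<Longrightarrow> v k < b"
  shows "measure unit_interval {y \<in> {0..<1}. \<forall>k<m. digit y k = v k} = 1 / real b ^ m"
proof -
  have "{y \<in> {0..<1}. \<forall>k<m. digit y k = v k} = {y \<in> {0..<1}. idx (b ^ m) y = prefix v m}"
    using assms by (auto simp: prefix_digit[symmetric] prefix_eq_iff digit_less)
  moreover have "prefix v m < b ^ m" using assms by (rule prefix_less)
  ultimately show ?thesis
    using b measure_idx[of "b ^ m" "prefix v m"] by simp
qed

lemma sets_cylinder:
  assumes "finite J"
  shows "{y \<in> {0..<1}. \<forall>k\<in>J. digit y k = v k} \<in> sets unit_interval"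
proof -
  have "{y. \<forall>k\<in>J. digit y k = v k} \<in> sets borel" using assms by measurable
  then have "{y. \<forall>k\<in>J. digit y k = v k} \<inter> {0..<1} \<in> sets borel" by (rule sets.Int) simp
  moreover have "{y \<in> {0..<1}. \<forall>k\<in>J. digit y k = v k} = {y. \<forall>k\<in>J. digit y k = v k} \<inter> {0..<1}" by blast
  ultimately show ?thesis unfolding sets_unit_interval by simp
qed

text \<open>
  Digits are independent and uniformly distributed: the cylinder is a disjoint union of
  cylinders that prescribe all of the first \<open>m\<close> digits, and those are cells of length \<open>b\<^sup>-\<^sup>m\<close>.
\<close>

lemma measure_cylinder:
  assumes J: "finite J" and v: "\<And>k. k \<in> J \<Longrightarrow> v k < b"
  shows "measure unit_interval {y \<in> {0..<1}. \<forall>k\<in>J. digit y k = v k} = 1 / real b ^ card J"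
proof -
  obtain m where m: "J \<subseteq> {..<m}" using J by (meson finite_nat_iff_bounded)
  interpret prob_space unit_interval by (rule prob_space_unit_interval)
  define E where "E = PiE {..<m} (\<lambda>k. if k \<in> J then {v k} else {..<b})"
  have finE: "finite E" unfolding E_def by (rule finite_PiE) auto
  have cardE: "card E = b ^ (m - card J)"
  proof -
    have "card E = (\<Prod>k<m. if k \<in> J then 1 else b)"
      unfolding E_def by (subst card_PiE) (auto intro!: prod.cong)
    also have "\<dots> = b ^ card ({..<m} - J)"
      by (simp add: prod.If_cases Diff_eq)
    also have "card ({..<m} - J) = m - card J" using m J by (simp add: card_Diff_subset)
    finally show ?thesis .
  qed
  define C where "C e = {y \<in> {0..<1}. \<forall>k<m. digit y k = e k}" for e
  have E_less: "e k < b" if "e \<in> E" "k < m" for e k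
  proof -
    have "e k \<in> (if k \<in> J then {v k} else {..<b})" using that unfolding E_def PiE_iff by blast
    then show ?thesis using v by (auto split: if_splits)
  qed
  have "{y \<in> {0..<1}. \<forall>k\<in>J. digit y k = v k} = (\<Union>e\<in>E. C e)"
  proof (intro set_eqI iffI)
    fix y assume y: "y \<in> {y \<in> {0..<1}. \<forall>k\<in>J. digit y k = v k}"
    then have "restrict (digit y) {..<m} \<in> E" using m by (auto simp: E_def digit_less)
    moreover have "y \<in> C (restrict (digit y) {..<m})" using y by (auto simp: C_def)
    ultimately show "y \<in> (\<Union>e\<in>E. C e)" by blast
  next
    fix y assume "y \<in> (\<Union>e\<in>E. C e)"
    then obtain e where e: "e \<in> E" "y \<in> C e" by auto
    have "e k = v k" if "k \<in> J" for k
    proof -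
      have "k < m" using that m by auto
      then have "e k \<in> (if k \<in> J then {v k} else {..<b})" using e(1) unfolding E_def PiE_iff by blast
      then show ?thesis using that by simp
    qed
    then show "y \<in> {y \<in> {0..<1}. \<forall>k\<in>J. digit y k = v k}" using e(2) m by (auto simp: C_def)
  qed
  also have "measure unit_interval (\<Union>e\<in>E. C e) = (\<Sum>e\<in>E. measure unit_interval (C e))"
  proof (rule finite_measure_finite_Union[OF finE])
    have "C e \<in> sets unit_interval" for e
      using sets_cylinder[of "{..<m}" e] unfolding C_def Ball_def lessThan_iff by simp
    then show "C ` E \<subseteq> sets unit_interval" by auto
    show "disjoint_family_on C E"
      unfolding disjoint_family_on_def
    proof (intro ballI impI)
      fix e e' assume e: "e \<in> E" "e' \<in> E" "e \<noteq> e'"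
      have "\<not> (\<forall>k<m. e k = e' k)"
      proof
        assume "\<forall>k<m. e k = e' k"
        then have "e = e'" using e(1,2) unfolding E_def by (intro PiE_ext[of e "{..<m}" _ e']) auto
        with e(3) show False by simp
      qed
      then obtain k where "k < m" "e k \<noteq> e' k" by blast
      then show "C e \<inter> C e' = {}" by (auto simp: C_def)
    qed
  qed
  also have "\<dots> = (\<Sum>e\<in>E. 1 / real b ^ m)"
    unfolding C_def using E_less by (intro sum.cong refl measure_full_cylinder)
  also have "\<dots> = real b ^ (m - card J) / real b ^ m" by (simp add: cardE)
  also have "\<dots> = 1 / real b ^ card J"
  proof -
    have "card J \<le> m" using m card_mono[of "{..<m}" J] by simp
    then show ?thesis using b by (simp add: power_diff)
  qed
  finally show ?thesis .
qed

text \<open>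
  The cells of level \<open>m\<close> determine the distribution function up to an error of \<open>b\<^sup>-\<^sup>m\<close>.
  Only large \<open>m\<close> are required because short words can fail to prescribe the digits that select a permutation.
\<close>

lemma uniform_if_adic_uniform:
  assumes h: "h \<in> measurable unit_interval borel"
    and range: "\<And>y. y \<in> {0..<1} \<Longrightarrow> h y \<in> {0..<1}"
    and adic: "\<And>m j. m0 \<le> m \<Longrightarrow> j < b ^ m \<Longrightarrow>
      measure unit_interval {y \<in> {0..<1}. idx (b ^ m) (h y) = j} = 1 / real b ^ m"
  shows "distr unit_interval borel h = distr unit_interval borel (\<lambda>y. y)"
proof -
  interpret prob_space unit_interval by (rule prob_space_unit_interval)
  have id: "(\<lambda>y. y) \<in> measurable unit_interval borel" by (rule measurable_unit_intervalI) simp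
  define cut where "cut f t = {y \<in> {0..<1}. t < f y}" for f :: "real \<Rightarrow> real" and t
  have cut_sets: "cut f t \<in> sets unit_interval" if "f \<in> measurable unit_interval borel" for f t
  proof -
    have "{y \<in> space unit_interval. t < f y} \<in> sets unit_interval" using that by measurable
    then show ?thesis by (simp add: cut_def)
  qed
  have est: "(real (b ^ m) - real j - 1) / real b ^ m \<le> measure unit_interval (cut f t) \<and>
     measure unit_interval (cut f t) \<le> (real (b ^ m) - real j) / real b ^ m"
    if f: "f \<in> measurable unit_interval borel" "\<And>y. y \<in> {0..<1} \<Longrightarrow> f y \<in> {0..<1}"
      and ad: "\<And>j. j < b ^ m \<Longrightarrow> measure unit_interval {y \<in> {0..<1}. idx (b ^ m) (f y) = j} = 1 / real b ^ m"
      and t: "0 \<le> t" "t < 1" and j: "j = idx (b ^ m) t" for f t m j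
  proof -
    have jlt: "j < b ^ m" using t b idx_less[of "b ^ m" t] by (simp add: j)
    have jt: "real j \<le> real b ^ m * t" "real b ^ m * t < real j + 1"
      using idx_eq_iff[OF t(1), of "b ^ m" j] by (simp_all add: j)
    define A where "A i = {y \<in> {0..<1}. idx (b ^ m) (f y) = i}" for i
    have A_sets: "A i \<in> sets unit_interval" for i
      using sets_Collect_count[OF measurable_compose[OF f(1) borel_measurable_idx], where Q = "\<lambda>k. k = i"]
      unfolding A_def space_unit_interval .
    have mA: "measure unit_interval (\<Union>i\<in>I. A i) = real (card I) / real b ^ m" if "I \<subseteq> {..<b ^ m}" for I
    proof -
      have "measure unit_interval (\<Union>i\<in>I. A i) = (\<Sum>i\<in>I. measure unit_interval (A i))"
        using that A_sets by (intro finite_measure_finite_Union) (auto simp: disjoint_family_on_def A_def intro: finite_subset)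
      also have "\<dots> = (\<Sum>i\<in>I. 1 / real b ^ m)"
        unfolding A_def using that by (intro sum.cong refl ad) auto
      finally show ?thesis by simp
    qed
    have fy: "real (idx (b ^ m) (f y)) \<le> real b ^ m * f y \<and> real b ^ m * f y < real (idx (b ^ m) (f y)) + 1
        \<and> idx (b ^ m) (f y) < b ^ m" if "y \<in> {0..<1}" for y
      using idx_bounds[of "f y" "b ^ m"] f(2)[OF that] idx_less[of "b ^ m" "f y"] b by simp
    have bm: "0 < real b ^ m" using b by simp
    have "(\<Union>i\<in>{Suc j..<b ^ m}. A i) \<subseteq> cut f t"
    proof
      fix y assume "y \<in> (\<Union>i\<in>{Suc j..<b ^ m}. A i)"
      then have y: "y \<in> {0..<1}" "Suc j \<le> idx (b ^ m) (f y)" by (auto simp: A_def)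
      then have "real j + 1 \<le> real b ^ m * f y" using fy[OF y(1)] by linarith
      then have "real b ^ m * t < real b ^ m * f y" using jt by linarith
      then show "y \<in> cut f t" using y bm by (simp add: cut_def)
    qed
    then have "measure unit_interval (\<Union>i\<in>{Suc j..<b ^ m}. A i) \<le> measure unit_interval (cut f t)"
      using cut_sets[OF f(1)] by (intro finite_measure_mono)
    moreover have "measure unit_interval (\<Union>i\<in>{Suc j..<b ^ m}. A i) = (real (b ^ m) - real j - 1) / real b ^ m"
      using jlt by (subst mA) (auto simp: of_nat_diff)
    moreover have "cut f t \<subseteq> (\<Union>i\<in>{j..<b ^ m}. A i)"
    proof
      fix y assume "y \<in> cut f t"
      then have y: "y \<in> {0..<1}" "t < f y" by (auto simp: cut_def)
      then have "real b ^ m * t < real b ^ m * f y" using bm by simp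
      then have "real j < real (idx (b ^ m) (f y)) + 1" using jt fy[OF y(1)] by linarith
      then show "y \<in> (\<Union>i\<in>{j..<b ^ m}. A i)" using y fy[OF y(1)] by (auto simp: A_def)
    qed
    then have "measure unit_interval (cut f t) \<le> measure unit_interval (\<Union>i\<in>{j..<b ^ m}. A i)"
      using A_sets by (intro finite_measure_mono) auto
    moreover have "measure unit_interval (\<Union>i\<in>{j..<b ^ m}. A i) = (real (b ^ m) - real j) / real b ^ m"
      using jlt by (subst mA) (auto simp: of_nat_diff)
    ultimately show ?thesis by simp
  qed
  have eq: "measure unit_interval (cut h t) = measure unit_interval (cut (\<lambda>y. y) t)" for t
  proof -
    consider "t < 0" | "1 \<le> t" | "0 \<le> t" "t < 1" by linarith
    then show ?thesis
    proof cases
      case 1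
      then have "cut h t = cut (\<lambda>y. y) t" using range by (fastforce simp: cut_def)
      then show ?thesis by simp
    next
      case 2
      then have "cut h t = cut (\<lambda>y. y) t" using range by (fastforce simp: cut_def)
      then show ?thesis by simp
    next
      case 3
      have "\<bar>measure unit_interval (cut h t) - measure unit_interval (cut (\<lambda>y. y) t)\<bar> \<le> 1 / real b ^ m"
        if m: "m0 \<le> m" for m
      proof -
        have bm: "0 < real b ^ m" using b by simp
        have 1: "(real (b ^ m) - real (idx (b ^ m) t)) / real b ^ m - (real (b ^ m) - real (idx (b ^ m) t) - 1) / real b ^ m = 1 / real b ^ m"
          using bm by (simp add: field_simps)
        show ?thesis
          using est[OF h range adic[OF m] 3 refl] est[OF id _ _ 3 refl, of m] measure_idx[of "b ^ m"] b 1
          by (simp add: abs_le_iff)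
      qed
      then have *: "\<bar>measure unit_interval (cut h t) - measure unit_interval (cut (\<lambda>y. y) t)\<bar> * real b ^ m \<le> 1"
        if "m0 \<le> m" for m using that b by (simp add: field_simps)
      show ?thesis
      proof (rule ccontr)
        assume "measure unit_interval (cut h t) \<noteq> measure unit_interval (cut (\<lambda>y. y) t)"
        then have pos: "0 < \<bar>measure unit_interval (cut h t) - measure unit_interval (cut (\<lambda>y. y) t)\<bar>" (is "0 < ?\<Delta>") by simp
        obtain m where m: "1 / ?\<Delta> < real b ^ m" using real_arch_pow[of "real b" "1 / ?\<Delta>"] b by auto
        have "real b ^ m \<le> real b ^ (max m m0)" using b by (intro power_increasing) auto
        then have "1 / ?\<Delta> < real b ^ (max m m0)" using m by linarith
        then have "1 < ?\<Delta> * real b ^ (max m m0)" using pos by (simp add: field_simps)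
        then show False using *[of "max m m0"] by simp
      qed
    qed
  qed
  show ?thesis
  proof (rule measure_eqI_lessThan)
    fix t
    have em: "emeasure (distr unit_interval borel f) {t<..} = measure unit_interval (cut f t)"
      if f: "f \<in> measurable unit_interval borel" for f
    proof -
      have "f -` {t<..} \<inter> space unit_interval = cut f t" by (auto simp: cut_def)
      then show ?thesis using emeasure_distr[OF f, of "{t<..}"] emeasure_eq_measure[of "cut f t"] by simp
    qed
    show "emeasure (distr unit_interval borel h) {t<..} < \<infinity>" unfolding em[OF h] by simp
    show "emeasure (distr unit_interval borel h) {t<..} = emeasure (distr unit_interval borel (\<lambda>y. y)) {t<..}"
      unfolding em[OF h] em[OF id] eq ..
  qed simp_all
qed

end

section \<open>A skew product over the two-sided shift of digits\<close>

text \<open>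
  The positive positions carry a two-sided sequence: the odd positions 1, 3, 5, ... are the times 0, 1, 2, ...,
  and the even positions 2, 4, 6, ... are the times -1, -2, -3, .... After a step of
  the shift, position \<open>k\<close> holds what position \<open>shift_source k\<close> held before.
\<close>

definition shift_source :: "nat \<Rightarrow> nat" where
  "shift_source k = (if odd k then k + 2 else if k = 2 then 1 else k - 2)"

definition shift_target :: "nat \<Rightarrow> nat" where
  "shift_target k = (if k = 1 then 2 else if odd k then k - 2 else k + 2)"

lemma shift_inverses:
  assumes "0 < k"
  shows "shift_target (shift_source k) = k" "shift_source (shift_target k) = k"
    "0 < shift_source k" "0 < shift_target k" "k \<le> shift_source k + 2" "k \<le> shift_target k + 2"
  using assms by (auto simp: shift_source_def shift_target_def elim!: oddE evenE; presburger)+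

text \<open>
  Digit 0 is the state, moved by the permutation that the letter at time 0 (digit 1) selects, while the
  letters are shifted. The letter survives as digit 2, so the map can be inverted.
\<close>

locale skew_shift = radix +
  fixes \<phi> :: "nat \<Rightarrow> nat \<Rightarrow> nat"
  assumes \<phi>: "\<And>a. a < b \<Longrightarrow> \<phi> a permutes {..<b}"
begin

definition \<theta> :: "(nat \<Rightarrow> nat) \<Rightarrow> nat \<Rightarrow> nat" where
  "\<theta> d k = (if k = 0 then \<phi> (d 1) (d 0) else d (shift_source k))"

definition \<theta>_inv :: "(nat \<Rightarrow> nat) \<Rightarrow> nat \<Rightarrow> nat" where
  "\<theta>_inv d k = (if k = 0 then inv (\<phi> (d 2)) (d 0) else d (shift_target k))"

lemma \<phi>_less: "a < b \<Longrightarrow> i < b \<Longrightarrow> \<phi> a i < b" "a < b \<Longrightarrow> i < b \<Longrightarrow> inv (\<phi> a) i < b"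
  using permutes_in_image[OF \<phi>, of a i] permutes_in_image[OF permutes_inv[OF \<phi>], of a i] by auto

lemma \<theta>_inverse: "(\<And>k. d k < b) \<Longrightarrow> \<theta>_inv (\<theta> d) = d"
proof
  fix k assume d: "\<And>k. d k < b"
  have "shift_source 2 = 1" by (simp add: shift_source_def)
  then show "\<theta>_inv (\<theta> d) k = d k"
    using permutes_inverses(2)[OF \<phi>[OF d[of 1]]] shift_inverses[of k] by (auto simp: \<theta>_def \<theta>_inv_def)
qed

lemma \<theta>_inv_inverse: "(\<And>k. d k < b) \<Longrightarrow> \<theta> (\<theta>_inv d) = d"
proof
  fix k assume d: "\<And>k. d k < b"
  have "shift_target 1 = 2" by (simp add: shift_target_def)
  then show "\<theta> (\<theta>_inv d) k = d k"
    using permutes_inverses(1)[OF \<phi>[OF d[of 2]]] shift_inverses[of k] by (auto simp: \<theta>_def \<theta>_inv_def)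
qed

text \<open>
  A rearrangement of the positive positions moves no position to the left by more than 2, so it preserves
  the existence of digits other than \<open>b - 1\<close> arbitrarily far to the right.
\<close>

lemma expansion_permute:
  assumes d: "expansion d" and e: "\<And>k. 0 < k \<Longrightarrow> e k = d (f k)" "e 0 < b"
    and f: "\<And>k. 0 < k \<Longrightarrow> 0 < f' k \<and> f (f' k) = k \<and> k \<le> f' k + 2"
  shows "expansion e"
proof -
  have db: "d k < b" for k using d by (simp add: expansion_def)
  have "e k < b" for k using e db by (cases "k = 0") auto
  moreover have "\<exists>k\<ge>m. e k \<noteq> b - 1" for m
  proof -
    obtain k where k: "m + 3 \<le> k" "d k \<noteq> b - 1" using d by (auto simp: expansion_def)
    then have "e (f' k) \<noteq> b - 1" "m \<le> f' k" using e(1)[of "f' k"] f[of k] by auto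
    then show ?thesis by blast
  qed
  ultimately show ?thesis by (simp add: expansion_def)
qed

lemma expansion_\<theta>: "expansion d \<Longrightarrow> expansion (\<theta> d)"
proof -
  assume d: "expansion d"
  then have "d k < b" for k by (simp add: expansion_def)
  then have "\<theta> d 0 < b" by (simp add: \<theta>_def \<phi>_less)
  then show ?thesis
    by (rule expansion_permute[OF d, of "\<theta> d" shift_source shift_target, rotated])
      (simp_all only: shift_inverses \<theta>_def, simp_all)
qed

lemma expansion_\<theta>_inv: "expansion d \<Longrightarrow> expansion (\<theta>_inv d)"
proof -
  assume d: "expansion d"
  then have "d k < b" for k by (simp add: expansion_def)
  then have "\<theta>_inv d 0 < b" by (simp add: \<theta>_inv_def \<phi>_less)
  then show ?thesis
    by (rule expansion_permute[OF d, of "\<theta>_inv d" shift_target shift_source, rotated])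
      (simp_all only: shift_inverses \<theta>_inv_def, simp_all)
qed

definition g :: "real \<Rightarrow> real" where
  "g y = val (\<theta> (digit y))"

definition g_inv :: "real \<Rightarrow> real" where
  "g_inv y = val (\<theta>_inv (digit y))"

lemma g_range: "y \<in> {0..<1} \<Longrightarrow> g y \<in> {0..<1}"
  using val_bounds[OF expansion_\<theta>[OF expansion_digit]] by (auto simp: g_def)

lemma g_inv_range: "y \<in> {0..<1} \<Longrightarrow> g_inv y \<in> {0..<1}"
  using val_bounds[OF expansion_\<theta>_inv[OF expansion_digit]] by (auto simp: g_inv_def)

lemma digit_g: "y \<in> {0..<1} \<Longrightarrow> digit (g y) = \<theta> (digit y)"
  by (simp add: g_def digit_val expansion_\<theta> expansion_digit)

lemma digit_g_inv: "y \<in> {0..<1} \<Longrightarrow> digit (g_inv y) = \<theta>_inv (digit y)"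
  by (simp add: g_inv_def digit_val expansion_\<theta>_inv expansion_digit)

lemma g_inverses: "y \<in> {0..<1} \<Longrightarrow> g_inv (g y) = y" "y \<in> {0..<1} \<Longrightarrow> g (g_inv y) = y"
  unfolding g_def[of "g_inv y"] g_inv_def[of "g y"]
  by (simp_all add: digit_g digit_g_inv \<theta>_inverse \<theta>_inv_inverse digit_less val_digit)

lemma measurable_val_digits:
  assumes e: "\<And>d. e d 0 = h (d i) (d 0)" "\<And>d k. 0 < k \<Longrightarrow> e d k = d (f k)"
  shows "(\<lambda>y. val (e (digit y))) \<in> borel_measurable borel"
proof -
  have "(\<lambda>y. e (digit y) k) \<in> measurable borel (count_space UNIV)" for k
  proof (cases "k = 0")
    case True
    have "(\<lambda>y. h (digit y i) (digit y 0)) \<in> measurable borel (count_space UNIV)"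
      by (rule measurable_compose_countable[OF _ measurable_digit])
        (rule measurable_compose[OF measurable_digit], simp)
    then show ?thesis using True by (simp add: e(1))
  next
    case False
    then show ?thesis by (simp add: e(2))
  qed
  then have [measurable]: "(\<lambda>y. real (e (digit y) k)) \<in> borel_measurable borel" for k
    by (rule measurable_compose) simp
  show ?thesis unfolding val_def by measurable
qed

lemma measurable_g: "g \<in> borel_measurable borel"
  unfolding g_def[abs_def] by (rule measurable_val_digits) (simp_all add: \<theta>_def)

lemma measurable_g_inv: "g_inv \<in> borel_measurable borel"
  unfolding g_inv_def[abs_def] by (rule measurable_val_digits) (simp_all add: \<theta>_inv_def)

lemma measure_g_cylinder:
  assumes m: "3 \<le> m" and v: "\<And>k. k < m \<Longrightarrow> v k < b"
  shows "measure unit_interval {y \<in> {0..<1}. \<forall>k<m. digit (g y) k = v k} = 1 / real b ^ m"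
proof -
  \<comment> \<open>As \<open>m \<ge> 3\<close>, digit 2 of the image is prescribed. It is digit 1 of the source, which selects the
    permutation, so the condition on digit 0 of the image becomes one on digit 0 of the source.\<close>
  define J where "J = insert 0 (shift_source ` {1..<m})"
  define u where "u k = (if k = 0 then inv (\<phi> (v 2)) (v 0) else v (shift_target k))" for k
  have v2: "v 2 < b" using v m by simp
  have key: "(\<forall>k<m. \<theta> d k = v k) \<longleftrightarrow> (\<forall>k\<in>J. d k = u k)" for d
  proof -
    have "(\<forall>k<m. \<theta> d k = v k) \<longleftrightarrow> \<theta> d 0 = v 0 \<and> (\<forall>k\<in>{1..<m}. \<theta> d k = v k)"
    proof -
      have "{..<m} = insert 0 {1..<m}" using m by auto
      moreover have "(\<forall>k\<in>insert 0 {1..<m}. \<theta> d k = v k) \<longleftrightarrow> \<theta> d 0 = v 0 \<and> (\<forall>k\<in>{1..<m}. \<theta> d k = v k)"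
        by blast
      ultimately show ?thesis by (metis lessThan_iff)
    qed
    also have "\<dots> \<longleftrightarrow> \<theta> d 0 = v 0 \<and> (\<forall>k\<in>{1..<m}. d (shift_source k) = v k)"
      by (auto simp: \<theta>_def)
    also have "\<dots> \<longleftrightarrow> d 0 = u 0 \<and> (\<forall>k\<in>{1..<m}. d (shift_source k) = v k)"
    proof (rule iffI)
      assume *: "\<theta> d 0 = v 0 \<and> (\<forall>k\<in>{1..<m}. d (shift_source k) = v k)"
      moreover have "2 \<in> {1..<m}" "shift_source 2 = 1" using m by (auto simp: shift_source_def)
      ultimately have "d 1 = v 2" by metis
      with * show "d 0 = u 0 \<and> (\<forall>k\<in>{1..<m}. d (shift_source k) = v k)"
        using permutes_inverses(2)[OF \<phi>[OF v2]] unfolding \<theta>_def u_def by metis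
    next
      assume *: "d 0 = u 0 \<and> (\<forall>k\<in>{1..<m}. d (shift_source k) = v k)"
      moreover have "2 \<in> {1..<m}" "shift_source 2 = 1" using m by (auto simp: shift_source_def)
      ultimately have "d 1 = v 2" by metis
      with * show "\<theta> d 0 = v 0 \<and> (\<forall>k\<in>{1..<m}. d (shift_source k) = v k)"
        using permutes_inverses(1)[OF \<phi>[OF v2]] unfolding \<theta>_def u_def by metis
    qed
    also have "\<dots> \<longleftrightarrow> (\<forall>k\<in>J. d k = u k)"
      by (auto simp: J_def u_def shift_inverses)
    finally show ?thesis .
  qed
  have "y \<in> {0..<1} \<and> (\<forall>k<m. digit (g y) k = v k) \<longleftrightarrow> y \<in> {0..<1} \<and> (\<forall>k\<in>J. digit y k = u k)" for y
    by (rule conj_cong[OF refl]) (simp only: digit_g key)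
  then have "{y \<in> {0..<1}. \<forall>k<m. digit (g y) k = v k} = {y \<in> {0..<1}. \<forall>k\<in>J. digit y k = u k}"
    by (rule Collect_cong)
  moreover have "measure unit_interval {y \<in> {0..<1}. \<forall>k\<in>J. digit y k = u k} = 1 / real b ^ card J"
  proof (rule measure_cylinder)
    show "finite J" by (simp add: J_def)
    fix k assume "k \<in> J"
    then show "u k < b" using v m v2 by (auto simp: J_def u_def \<phi>_less shift_inverses)
  qed
  moreover have "card J = m"
  proof -
    have "inj_on shift_source {1..<m}"
      by (rule inj_on_inverseI[where g = shift_target]) (simp add: shift_inverses)
    moreover have "0 \<notin> shift_source ` {1..<m}"
    proof
      assume "0 \<in> shift_source ` {1..<m}"
      then obtain k where "k \<in> {1..<m}" "shift_source k = 0" by auto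
      with shift_inverses(3)[of k] show False by simp
    qed
    ultimately show ?thesis using m by (simp add: J_def card_image)
  qed
  ultimately show ?thesis by simp
qed

lemma distr_g: "distr unit_interval borel g = distr unit_interval borel (\<lambda>y. y)"
proof (rule uniform_if_adic_uniform[where ?m0.0 = 3])
  show "g \<in> borel_measurable unit_interval" by (rule measurable_unit_intervalI[OF measurable_g])
  fix m j :: nat assume m: "3 \<le> m" and j: "j < b ^ m"
  define y0 where "y0 = real j / real (b ^ m)"
  have "0 < b ^ m" using b by simp
  then have y0: "0 \<le> y0" "y0 < 1" using j by (auto simp: y0_def divide_simps simp flip: of_nat_power)
  have "idx (b ^ m) y0 = j" using \<open>0 < b ^ m\<close> by (simp add: y0_def idx_def)
  then have pr: "prefix (digit y0) m = j" using prefix_digit[OF y0] by simp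
  have "idx (b ^ m) (g y) = j \<longleftrightarrow> (\<forall>k<m. digit (g y) k = digit y0 k)" if "y \<in> {0..<1}" for y
    using g_range[OF that] pr prefix_digit[of "g y" m] prefix_eq_iff[of m "digit (g y)" "digit y0"] digit_less
    by simp
  then have "{y \<in> {0..<1}. idx (b ^ m) (g y) = j} = {y \<in> {0..<1}. \<forall>k<m. digit (g y) k = digit y0 k}" by auto
  then show "measure unit_interval {y \<in> {0..<1}. idx (b ^ m) (g y) = j} = 1 / real b ^ m"
    using measure_g_cylinder[OF m, of "digit y0"] digit_less by simp
qed (rule g_range)

lemma g_mpt: "g \<in> mpt unit_interval"
proof -
  have meas: "f \<in> measurable unit_interval unit_interval"
    if "f \<in> borel_measurable borel" "\<And>y. y \<in> {0..<1} \<Longrightarrow> f y \<in> {0..<1}" for f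
  proof (rule measurable_restrict_space2)
    show "f \<in> space unit_interval \<rightarrow> {0..<1}" unfolding space_unit_interval by (rule Pi_I) (rule that(2))
    show "f \<in> measurable unit_interval lborel"
      unfolding measurable_lborel1 by (rule measurable_unit_intervalI[OF that(1)])
  qed
  have g: "g \<in> measurable unit_interval unit_interval" by (rule meas[OF measurable_g g_range])
  have bij: "bij_betw g {0..<1} {0..<1}"
  proof (rule bij_betw_byWitness[where f' = g_inv])
    show "\<forall>y\<in>{0..<1}. g_inv (g y) = y" "\<forall>y\<in>{0..<1}. g (g_inv y) = y"
      by (rule ballI, erule g_inverses)+
    show "g ` {0..<1} \<subseteq> {0..<1}" "g_inv ` {0..<1} \<subseteq> {0..<1}"
      by (rule image_subsetI, erule g_range g_inv_range)+
  qed
  have inv_eq: "inv_into {0..<1} g y = g_inv y" if "y \<in> {0..<1}" for y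
    using bij_betw_imp_inj_on[OF bij] g_inv_range[OF that] g_inverses(2)[OF that] by (rule inv_into_f_eq)
  have "inv_into (space unit_interval) g \<in> measurable unit_interval unit_interval \<longleftrightarrow>
      g_inv \<in> measurable unit_interval unit_interval"
    by (rule measurable_cong) (simp add: inv_eq)
  then have inv: "inv_into (space unit_interval) g \<in> measurable unit_interval unit_interval"
    using meas[OF measurable_g_inv g_inv_range] by (rule iffD2)
  have "distr unit_interval unit_interval g = unit_interval"
  proof (rule measure_eqI)
    fix A assume "A \<in> sets (distr unit_interval unit_interval g)"
    then have A: "A \<in> sets unit_interval" by simp
    then have AB: "A \<in> sets borel" "A \<subseteq> {0..<1}" unfolding sets_unit_interval by blast+
    have "emeasure (distr unit_interval unit_interval g) A = emeasure (distr unit_interval borel g) A"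
      unfolding emeasure_distr[OF g A] emeasure_distr[OF measurable_unit_intervalI[OF measurable_g] AB(1)] ..
    also have "\<dots> = emeasure (distr unit_interval borel (\<lambda>y. y)) A" by (simp add: distr_g)
    also have "\<dots> = emeasure unit_interval A"
    proof -
      have "(\<lambda>y. y) -` A \<inter> space unit_interval = A" using AB by auto
      then show ?thesis using emeasure_distr[OF measurable_unit_intervalI[of "\<lambda>y. y" borel] AB(1)] by simp
    qed
    finally show "emeasure (distr unit_interval unit_interval g) A = emeasure unit_interval A" .
  qed (rule sets_distr)
  with g bij inv show ?thesis unfolding mpt_def mem_Collect_eq space_unit_interval by iprover
qed

lemma digit_g_pow: "y \<in> {0..<1} \<Longrightarrow> (g ^^ t) y \<in> {0..<1} \<and> digit ((g ^^ t) y) = (\<theta> ^^ t) (digit y)"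
proof (induction t)
  case (Suc t)
  then show ?case using g_range[of "(g ^^ t) y"] digit_g[of "(g ^^ t) y"] by auto
qed simp

end

context resampling_walk
begin

text \<open>
  A state below \<open>K\<close> is stored in the top part of a digit below \<open>K * w\<close>, whose remainder modulo \<open>w\<close> is left untouched.
\<close>

definition lift :: "nat \<Rightarrow> nat \<Rightarrow> nat" where
  "lift a i = (if i < K * w then w * step a (i div w) + i mod w else i)"

lemma step_less: "i < K \<Longrightarrow> step a i < K"
  using K \<pi>_less by (simp add: step_def)

lemma inj_step: "inj_on (step a) {..<K}"
proof (cases "a < K")
  case True
  have "inj_on (\<lambda>i. (a + i) mod K) {..<K}" by (rule inj_on_rotate)
  then show ?thesis using True by (simp add: step_def[abs_def] add.commute)
next
  case False
  then show ?thesis using permutes_inj[OF \<pi>] by (simp add: step_def inj_on_def)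
qed

lemma lift_div: "i < K * w \<Longrightarrow> lift a i div w = step a (i div w)"
  using w by (simp add: lift_def)

lemma lift_less: "i < K * w \<Longrightarrow> lift a i < K * w"
proof -
  assume i: "i < K * w"
  then have "step a (i div w) < K" using step_less by (simp add: less_mult_imp_div_less)
  then have "w * (step a (i div w) + 1) \<le> w * K" by (intro mult_le_mono2) simp
  moreover have "i mod w < w" using w by simp
  ultimately show ?thesis using i by (simp add: lift_def algebra_simps)
qed

lemma lift_permutes: "lift a permutes {..<K * w}"
proof (rule bij_imp_permutes)
  have "inj_on (lift a) {..<K * w}"
  proof (rule inj_onI)
    fix i j assume ij: "i \<in> {..<K * w}" "j \<in> {..<K * w}" "lift a i = lift a j"
    then have "step a (i div w) = step a (j div w)" using lift_div by (metis lessThan_iff)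
    then have "i div w = j div w"
      using ij inj_step[of a] by (auto simp: inj_on_def less_mult_imp_div_less)
    moreover have "i mod w = j mod w" using ij by (simp add: lift_def calculation)
    ultimately show "i = j" by (metis div_mult_mod_eq)
  qed
  then show "bij_betw (lift a) {..<K * w} {..<K * w}"
    using lift_less by (intro bij_betw_imageI endo_inj_surj) auto
qed (simp add: lift_def)

end

section \<open>Words of the resampling shift\<close>

locale resampling_shift = resampling_walk +
  assumes w2: "2 \<le> w"
begin

sublocale skew_shift "K * w" lift
proof
  have "1 * 2 \<le> K * w" using K w2 by (intro mult_le_mono) auto
  then show "2 \<le> K * w" by simp
qed (rule lift_permutes)

definition itinerary :: "nat \<Rightarrow> real \<Rightarrow> nat list" where
  "itinerary n y = map (\<lambda>t. col (idx K ((g ^^ t) y))) [0..<n]"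

lemma idx_digit:
  assumes "y \<in> {0..<1}"
  shows "idx K y = digit y 0 div w"
proof -
  have y: "0 \<le> y" "y < 1" using assms by auto
  have "digit y 0 = idx (K * w) y"
    using idx_less[OF _ y, of "K * w"] K w by (simp add: digit_def)
  then show ?thesis using idx_mult_div[OF y(1) w] by simp
qed

text \<open>The letters that drive the walk are the digits at odd positions, which the shift brings to position 1 one after the other.\<close>

lemma walk_\<theta>:
  assumes "\<And>k. d k < K * w"
  shows "map (\<lambda>t. (\<theta> ^^ t) d 0 div w) [0..<n] = walk (d 0 div w) (map (\<lambda>t. d (2 * t + 1)) [0..<n])"
  using assms
proof (induction n arbitrary: d)
  case (Suc n)
  have upt: "[0..<Suc n] = 0 # map Suc [0..<n]" by (simp add: upt_conv_Cons map_Suc_upt del: upt_Suc)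
  have \<theta>0: "\<theta> d 0 div w = step (d 1) (d 0 div w)"
    using Suc.prems lift_div by (simp add: \<theta>_def)
  have \<theta>_odd: "\<theta> d (2 * t + 1) = d (2 * Suc t + 1)" for t
    by (simp add: \<theta>_def shift_source_def)
  have less: "\<theta> d k < K * w" for k
    using Suc.prems lift_less by (simp add: \<theta>_def)
  have "map (\<lambda>t. (\<theta> ^^ t) d 0 div w) [0..<Suc n] = d 0 div w # map (\<lambda>t. (\<theta> ^^ t) (\<theta> d) 0 div w) [0..<n]"
    unfolding upt by (simp add: funpow_swap1)
  also have "\<dots> = d 0 div w # walk (step (d 1) (d 0 div w)) (map (\<lambda>t. d (2 * Suc t + 1)) [0..<n])"
    unfolding Suc.IH[OF less] \<theta>0 \<theta>_odd ..
  also have "\<dots> = walk (d 0 div w) (map (\<lambda>t. d (2 * t + 1)) [0..<Suc n])"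
    unfolding upt by (simp add: comp_def)
  finally show ?case .
qed simp

lemma itinerary_walk:
  assumes y: "y \<in> {0..<1}"
  shows "itinerary n y = map col (walk (digit y 0 div w) (map (\<lambda>t. digit y (2 * t + 1)) [0..<n]))"
proof -
  have "idx K ((g ^^ t) y) = (\<theta> ^^ t) (digit y) 0 div w" for t
    using digit_g_pow[OF y, of t] idx_digit[of "(g ^^ t) y"] by metis
  then have "itinerary n y = map col (map (\<lambda>t. (\<theta> ^^ t) (digit y) 0 div w) [0..<n])"
    by (simp add: itinerary_def)
  then show ?thesis by (simp only: walk_\<theta>[OF digit_less])
qed

text \<open>
  Cover the set by cylinders: digit 0 and the first \<open>n\<close> odd digits determine the walk, and their
  values are equidistributed, so the count of walks becomes a measure.
\<close>

lemma measure_itinerary_near_word: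
  assumes q: "q = 1 / real w" and z: "z = 1 - 3 * q / 4" and v: "length v = n" and m: "8 * m \<le> n"
  shows "measure unit_interval {y \<in> {0..<1}. mismatch (itinerary n y) v \<le> m} \<le>
    3 / 2 * ((1 - q / 4) ^ n / z ^ m)"
proof -
  interpret prob_space unit_interval by (rule prob_space_unit_interval)
  define B where "B = {(i, as). i < K \<and> as \<in> letters n \<and> mismatch (map col (walk i as)) v \<le> m}"
  define A where "A = {(c, as). c < K * w \<and> as \<in> letters n \<and> mismatch (map col (walk (c div w) as)) v \<le> m}"
  define cyl where "cyl = (\<lambda>(c, as). {y \<in> {0..<1}. digit y 0 = c \<and> (\<forall>t<n. digit y (2 * t + 1) = as ! t)})"
  have finB: "finite B"
    by (rule finite_subset[of _ "{..<K} \<times> letters n"]) (auto simp: B_def)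
  have finA: "finite A"
    by (rule finite_subset[of _ "{..<K * w} \<times> letters n"]) (auto simp: A_def)
  have "card A \<le> card (B \<times> {..<w})"
  proof (rule card_inj_on_le)
    let ?f = "\<lambda>(c, as). ((c div w, as), c mod w)"
    show "inj_on ?f A" by (rule inj_onI) (auto, metis div_mult_mod_eq)
    show "?f ` A \<subseteq> B \<times> {..<w}"
      using w by (auto simp: A_def B_def less_mult_imp_div_less)
    show "finite (B \<times> {..<w})" using finB by simp
  qed
  then have cardA: "real (card A) \<le> real (card B) * real w"
    by (simp add: card_cartesian_product flip: of_nat_mult)
  have cardB: "real (card B) \<le> 3 / 2 * ((1 - q / 4) ^ n / z ^ m) * real K * real (K * w) ^ n"
    unfolding B_def using few_walks_near_word[OF q z, of m v] v m by simp
  have cyl: "cyl p \<in> sets unit_interval \<and> measure unit_interval (cyl p) = 1 / real (K * w) ^ Suc n" if p: "p \<in> A" for p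
  proof -
    obtain c as where p_eq: "p = (c, as)" by force
    define J where "J = insert 0 ((\<lambda>t. 2 * t + 1) ` {..<n})"
    define u where "u k = (if k = 0 then c else as ! (k div 2))" for k
    have u: "u 0 = c" "u (2 * t + 1) = as ! t" for t by (simp_all add: u_def)
    have as: "c < K * w" "length as = n" "set as \<subseteq> {..<K * w}"
      using p by (auto simp: A_def p_eq letters_def)
    have ast: "as ! t < K * w" if "t < n" for t
    proof -
      have "as ! t \<in> set as" using as(2) that by simp
      then show ?thesis using as(3) by blast
    qed
    have cyl_eq: "cyl p = {y \<in> {0..<1}. \<forall>k\<in>J. digit y k = u k}"
      unfolding cyl_def p_eq J_def using u by auto
    have finJ: "finite J" by (simp add: J_def)
    have 1: "cyl p \<in> sets unit_interval" unfolding cyl_eq by (rule sets_cylinder[OF finJ])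
    have "card J = Suc n"
    proof -
      have "inj_on (\<lambda>t. 2 * t + 1 :: nat) {..<n}" by (rule inj_onI) simp
      moreover have "0 \<notin> (\<lambda>t. 2 * t + 1 :: nat) ` {..<n}" by auto
      ultimately show ?thesis by (simp add: J_def card_image)
    qed
    moreover have "measure unit_interval {y \<in> {0..<1}. \<forall>k\<in>J. digit y k = u k} = 1 / real (K * w) ^ card J"
    proof (rule measure_cylinder[OF finJ])
      fix k assume "k \<in> J"
      then show "u k < K * w" unfolding J_def using u as ast by auto
    qed
    ultimately show ?thesis using 1 cyl_eq by simp
  qed
  have sub: "{y \<in> {0..<1}. mismatch (itinerary n y) v \<le> m} \<subseteq> (\<Union>p\<in>A. cyl p)"
  proof
    fix y assume "y \<in> {y \<in> {0..<1}. mismatch (itinerary n y) v \<le> m}"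
    then have y: "y \<in> {0..<1}" "mismatch (itinerary n y) v \<le> m" by blast+
    define as where "as = map (\<lambda>t. digit y (2 * t + 1)) [0..<n]"
    have "as \<in> letters n" using digit_less by (auto simp: letters_def as_def)
    then have "(digit y 0, as) \<in> A"
      using y digit_less[of y 0] itinerary_walk[OF y(1), of n] by (simp add: A_def as_def)
    moreover have "y \<in> cyl (digit y 0, as)" using y by (simp add: cyl_def as_def)
    ultimately show "y \<in> (\<Union>p\<in>A. cyl p)" by blast
  qed
  have "measure unit_interval {y \<in> {0..<1}. mismatch (itinerary n y) v \<le> m} \<le> measure unit_interval (\<Union>p\<in>A. cyl p)"
    using sub finA cyl by (intro finite_measure_mono sets.finite_UN) auto
  also have "\<dots> \<le> (\<Sum>p\<in>A. measure unit_interval (cyl p))"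
    using finA cyl by (intro measure_UNION_le) auto
  also have "\<dots> = (\<Sum>p\<in>A. 1 / real (K * w) ^ Suc n)"
    by (rule sum.cong[OF refl]) (simp add: cyl)
  also have "\<dots> = real (card A) / real (K * w) ^ Suc n" by simp
  also have "\<dots> \<le> (3 / 2 * ((1 - q / 4) ^ n / z ^ m) * real K * real (K * w) ^ n * real w) / real (K * w) ^ Suc n"
    using cardA cardB by (intro divide_right_mono order_trans[OF cardA] mult_right_mono) auto
  also have "\<dots> = 3 / 2 * ((1 - q / 4) ^ n / z ^ m)"
    using K w by simp
  finally show ?thesis .
qed

text \<open>Along multiples of 8 the bound is \<open>\<rho>\<^sup>m\<close> with \<open>\<rho> = (1 - q/4)\<^sup>8 / z < 1\<close>, and \<open>\<beta>\<close> is the eighth root of \<open>1 / \<rho>\<close>.\<close>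

lemma itinerary_balls_decay:
  "\<exists>\<beta>>1. \<forall>m v. length v = 8 * m \<longrightarrow>
     measure unit_interval {y \<in> {0..<1}. mismatch (itinerary (8 * m) y) v \<le> m} \<le> 3 / 2 / \<beta> ^ (8 * m)"
proof -
  define q where "q = 1 / real w"
  define z where "z = 1 - 3 * q / 4"
  define \<rho> where "\<rho> = (1 - q / 4) ^ 8 / z"
  have q: "0 < q" "q \<le> 1" using w by (auto simp: q_def)
  have z: "0 < z" using q by (simp add: z_def)
  have \<rho>: "0 < \<rho>" "\<rho> < 1"
    using rate_bound[OF q_def z_def] z q by (auto simp: \<rho>_def)
  define \<beta> where "\<beta> = root 8 (1 / \<rho>)"
  have \<beta>8: "\<beta> ^ 8 = 1 / \<rho>" using \<rho> by (simp add: \<beta>_def real_root_pow_pos2)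
  have "1 < \<beta>" using \<rho> by (simp add: \<beta>_def real_root_gt_1_iff)
  moreover have "measure unit_interval {y \<in> {0..<1}. mismatch (itinerary (8 * m) y) v \<le> m} \<le> 3 / 2 / \<beta> ^ (8 * m)"
    if v: "length v = 8 * m" for m v
  proof -
    have "(1 - q / 4) ^ (8 * m) / z ^ m = \<rho> ^ m"
      by (simp add: \<rho>_def power_mult power_divide)
    also have "\<dots> = 1 / \<beta> ^ (8 * m)"
      by (simp add: power_mult \<beta>8 power_one_over)
    finally show ?thesis
      using measure_itinerary_near_word[OF q_def z_def v, of m] by simp
  qed
  ultimately show ?thesis by blast
qed

lemma measure_resampled:
  "measure unit_interval {y \<in> {0..<1}. idx K (g y) \<noteq> \<pi> (idx K y)} \<le> 1 / real w"
proof -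
  interpret prob_space unit_interval by (rule prob_space_unit_interval)
  define cyl where "cyl a = {y \<in> {0..<1}. \<forall>k\<in>{1}. digit y k = a}" for a
  have cyl_sets: "cyl a \<in> sets unit_interval" for a
    unfolding cyl_def by (rule sets_cylinder) simp
  have "{y \<in> {0..<1}. idx K (g y) \<noteq> \<pi> (idx K y)} \<subseteq> (\<Union>a<K. cyl a)"
  proof
    fix y assume "y \<in> {y \<in> {0..<1}. idx K (g y) \<noteq> \<pi> (idx K y)}"
    then have y: "y \<in> {0..<1}" "idx K (g y) \<noteq> \<pi> (idx K y)" by blast+
    have "idx K (g y) = digit (g y) 0 div w" by (rule idx_digit[OF g_range[OF y(1)]])
    also have "\<dots> = lift (digit y 1) (digit y 0) div w" by (simp add: digit_g[OF y(1)] \<theta>_def)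
    also have "\<dots> = step (digit y 1) (idx K y)" by (simp add: lift_div digit_less idx_digit[OF y(1)])
    finally have "digit y 1 < K" using y(2) by (auto simp: step_def split: if_splits)
    then show "y \<in> (\<Union>a<K. cyl a)" using y by (auto simp: cyl_def)
  qed
  then have "measure unit_interval {y \<in> {0..<1}. idx K (g y) \<noteq> \<pi> (idx K y)} \<le> measure unit_interval (\<Union>a<K. cyl a)"
    using cyl_sets by (intro finite_measure_mono sets.finite_UN) auto
  also have "\<dots> \<le> (\<Sum>a<K. measure unit_interval (cyl a))"
    using cyl_sets by (intro measure_UNION_le) auto
  also have "\<dots> = (\<Sum>a<K. 1 / real (K * w))"
  proof (rule sum.cong[OF refl])
    fix a assume a: "a \<in> {..<K}"
    have "K * 1 \<le> K * w" using w by (intro mult_le_mono2) simp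
    then have "K \<le> K * w" by (simp only: mult_1_right)
    then have "a < K * w" using a by (meson lessThan_iff less_le_trans)
    then show "measure unit_interval (cyl a) = 1 / real (K * w)"
      unfolding cyl_def by (subst measure_cylinder) auto
  qed
  also have "\<dots> = 1 / real w" using K by simp
  finally show ?thesis .
qed

end

section \<open>Invertible measure-preserving maps\<close>

lemma mptD:
  assumes "T \<in> mpt M"
  shows mpt_measurable: "T \<in> measurable M M" and mpt_bij: "bij_betw T (space M) (space M)"
    and mpt_inv_measurable: "inv_into (space M) T \<in> measurable M M" and mpt_distr: "distr M M T = M"
  using assms unfolding mpt_def by blast+

lemma mpt_space: "T \<in> mpt M \<Longrightarrow> x \<in> space M \<Longrightarrow> T x \<in> space M"
  by (rule measurable_space[OF mpt_measurable])

lemma mpt_emeasure: "T \<in> mpt M \<Longrightarrow> A \<in> sets M \<Longrightarrow> emeasure M (T -` A \<inter> space M) = emeasure M A"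
  using emeasure_distr[OF mpt_measurable, of T M A] mpt_distr[of T M] by simp

lemma mpt_vimage_null: "T \<in> mpt M \<Longrightarrow> A \<in> null_sets M \<Longrightarrow> T -` A \<inter> space M \<in> null_sets M"
  using mpt_emeasure[of T M A] measurable_sets[OF mpt_measurable, of T M A] null_setsD1[of A M] null_setsD2[of A M]
  by (intro null_setsI) simp_all

lemma mptI:
  assumes T: "T \<in> measurable M M" and S: "S \<in> measurable M M"
    and TS: "\<And>x. x \<in> space M \<Longrightarrow> T (S x) = x" and ST: "\<And>x. x \<in> space M \<Longrightarrow> S (T x) = x"
    and pres: "\<And>A. A \<in> sets M \<Longrightarrow> emeasure M (T -` A \<inter> space M) = emeasure M A"
  shows "T \<in> mpt M"
proof -
  have sp: "T x \<in> space M" "S x \<in> space M" if "x \<in> space M" for x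
    using measurable_space[OF T that] measurable_space[OF S that] .
  have bij: "bij_betw T (space M) (space M)"
  proof (rule bij_betw_byWitness[where f' = S])
    show "\<forall>x\<in>space M. S (T x) = x" "\<forall>x\<in>space M. T (S x) = x" using ST TS by simp_all
    show "T ` space M \<subseteq> space M" "S ` space M \<subseteq> space M" using sp by blast+
  qed
  have "inv_into (space M) T \<in> measurable M M \<longleftrightarrow> S \<in> measurable M M"
  proof (rule measurable_cong)
    fix x assume x: "x \<in> space M"
    show "inv_into (space M) T x = S x"
      using bij_betw_imp_inj_on[OF bij] sp(2)[OF x] TS[OF x] by (rule inv_into_f_eq)
  qed
  then have inv: "inv_into (space M) T \<in> measurable M M" using S by (rule iffD2)
  have "distr M M T = M"
  proof (rule measure_eqI)
    fix A assume "A \<in> sets (distr M M T)"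
    then have A: "A \<in> sets M" by (simp only: sets_distr)
    show "emeasure (distr M M T) A = emeasure M A"
      unfolding emeasure_distr[OF T A] by (rule pres[OF A])
  qed (rule sets_distr)
  with T bij inv show ?thesis unfolding mpt_def by blast
qed

lemma mpt_inv_cancel:
  assumes "T \<in> mpt M" "x \<in> space M"
  shows "inv_into (space M) T (T x) = x" "T (inv_into (space M) T x) = x"
  using bij_betw_inv_into_left[OF mpt_bij[OF assms(1)] assms(2)]
    bij_betw_inv_into_right[OF mpt_bij[OF assms(1)] assms(2)] .

lemma mpt_inv:
  assumes T: "T \<in> mpt M"
  shows "inv_into (space M) T \<in> mpt M"
proof (rule mptI[OF mpt_inv_measurable[OF T] mpt_measurable[OF T]])
  fix A assume A: "A \<in> sets M"
  let ?S = "inv_into (space M) T"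
  have SA: "?S -` A \<inter> space M \<in> sets M" by (rule measurable_sets[OF mpt_inv_measurable[OF T] A])
  have "T -` (?S -` A \<inter> space M) \<inter> space M = A"
    using mpt_inv_cancel(1)[OF T] mpt_space[OF T] sets.sets_into_space[OF A] by auto
  then show "emeasure M (?S -` A \<inter> space M) = emeasure M A"
    using mpt_emeasure[OF T SA] by simp
qed (simp_all add: mpt_inv_cancel[OF T])

lemma mpt_extend:
  assumes S: "S \<in> sets N" and g: "g \<in> mpt (restrict_space N S)"
  shows "(\<lambda>y. if y \<in> S then g y else y) \<in> mpt N"
proof -
  let ?R = "restrict_space N S"
  have SN: "S \<subseteq> space N" by (rule sets.sets_into_space[OF S])
  have spR: "space ?R = S" using SN by (auto simp: space_restrict_space)
  have setsR: "A \<in> sets ?R \<longleftrightarrow> A \<in> sets N \<and> A \<subseteq> S" for A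
    using S SN by (subst sets_restrict_space_iff) (auto simp: Int_absorb1)
  have vim: "(\<lambda>y. if y \<in> S then h y else y) -` A \<inter> space N = (h -` (A \<inter> S) \<inter> space ?R) \<union> (A - S)"
    if h: "h \<in> mpt ?R" and A: "A \<in> sets N" for h A
    using mpt_space[OF h] SN sets.sets_into_space[OF A] unfolding spR by (auto split: if_splits)
  have hA: "h -` (A \<inter> S) \<inter> space ?R \<in> sets N" if h: "h \<in> mpt ?R" and A: "A \<in> sets N" for h A
  proof -
    have "A \<inter> S \<in> sets ?R" using A S by (simp add: setsR)
    then have "h -` (A \<inter> S) \<inter> space ?R \<in> sets ?R" by (rule measurable_sets[OF mpt_measurable[OF h]])
    then show ?thesis by (simp add: setsR)
  qed
  have meas: "(\<lambda>y. if y \<in> S then h y else y) \<in> measurable N N" if h: "h \<in> mpt ?R" for h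
  proof (rule measurableI)
    fix y assume "y \<in> space N"
    then show "(if y \<in> S then h y else y) \<in> space N" using mpt_space[OF h, of y] SN unfolding spR by auto
  next
    fix A assume A: "A \<in> sets N"
    show "(\<lambda>y. if y \<in> S then h y else y) -` A \<inter> space N \<in> sets N"
      unfolding vim[OF h A] using hA[OF h A] A S by (intro sets.Un sets.Diff)
  qed
  let ?k = "inv_into S g"
  have k: "?k \<in> mpt ?R" using mpt_inv[OF g] unfolding spR .
  have gS: "g y \<in> S" "?k y \<in> S" "g (?k y) = y" "?k (g y) = y" if "y \<in> S" for y
    using mpt_space[OF g, of y] mpt_space[OF k, of y] mpt_inv_cancel[OF g, of y] that unfolding spR by auto
  show ?thesis
  proof (rule mptI[OF meas[OF g] meas[OF k]])
    fix A assume A: "A \<in> sets N"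
    have AS: "A \<inter> S \<in> sets ?R" using A S by (simp add: setsR)
    have "emeasure N (g -` (A \<inter> S) \<inter> space ?R) = emeasure ?R (g -` (A \<inter> S) \<inter> space ?R)"
      using S SN unfolding spR by (subst emeasure_restrict_space) (auto simp: Int_absorb1)
    also have "\<dots> = emeasure ?R (A \<inter> S)" by (rule mpt_emeasure[OF g AS])
    also have "\<dots> = emeasure N (A \<inter> S)"
      using S SN by (subst emeasure_restrict_space) (auto simp: Int_absorb1)
    finally have eq: "emeasure N (g -` (A \<inter> S) \<inter> space ?R) = emeasure N (A \<inter> S)" .
    have "emeasure N ((g -` (A \<inter> S) \<inter> space ?R) \<union> (A - S)) =
        emeasure N (g -` (A \<inter> S) \<inter> space ?R) + emeasure N (A - S)"
      using hA[OF g A] A S unfolding spR by (intro plus_emeasure[symmetric]) auto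
    also have "\<dots> = emeasure N (A \<inter> S) + emeasure N (A - S)" by (simp only: eq)
    also have "\<dots> = emeasure N ((A \<inter> S) \<union> (A - S))"
      using A S by (intro plus_emeasure) auto
    also have "(A \<inter> S) \<union> (A - S) = A" by blast
    finally show "emeasure N ((\<lambda>y. if y \<in> S then g y else y) -` A \<inter> space N) = emeasure N A"
      unfolding vim[OF g A] .
  qed (auto simp: gS)
qed

lemma mpt_restrict:
  assumes Y: "Y \<in> sets N" and g: "g \<in> mpt N" and gY: "bij_betw g Y Y"
  shows "g \<in> mpt (restrict_space N Y)"
proof -
  let ?R = "restrict_space N Y" and ?k = "inv_into (space N) g"
  have YN: "Y \<subseteq> space N" by (rule sets.sets_into_space[OF Y])
  have spR: "space ?R = Y" using YN by (auto simp: space_restrict_space)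
  have setsR: "A \<in> sets ?R \<longleftrightarrow> A \<in> sets N \<and> A \<subseteq> Y" for A
    using Y YN by (subst sets_restrict_space_iff) (auto simp: Int_absorb1)
  have gin: "g y \<in> Y" if "y \<in> Y" for y using gY that by (rule bij_betw_apply)
  have kin: "?k y \<in> Y" if "y \<in> Y" for y
  proof -
    have "y \<in> g ` Y" using that bij_betw_imp_surj_on[OF gY] by simp
    then obtain x where "y = g x" "x \<in> Y" by (rule imageE)
    then show ?thesis using mpt_inv_cancel(1)[OF g, of x] YN by auto
  qed
  show ?thesis
  proof (rule mptI[where S = ?k])
    show "g \<in> measurable ?R ?R" "?k \<in> measurable ?R ?R"
      using gin kin by (auto intro: measurable_restrict_space3 mpt_measurable[OF g] mpt_inv_measurable[OF g])
    fix A assume "A \<in> sets ?R"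
    then have A: "A \<in> sets N" "A \<subseteq> Y" unfolding setsR by blast+
    have "g -` A \<inter> Y = g -` A \<inter> space N"
    proof -
      have "x \<in> Y" if "x \<in> space N" "g x \<in> A" for x
        using kin[of "g x"] mpt_inv_cancel(1)[OF g that(1)] A(2) that(2) by auto
      then show ?thesis using YN by blast
    qed
    then have "emeasure N (g -` A \<inter> Y) = emeasure N A" using mpt_emeasure[OF g A(1)] by simp
    then show "emeasure ?R (g -` A \<inter> space ?R) = emeasure ?R A"
      unfolding spR using Y YN A by (subst (1 2) emeasure_restrict_space) (auto simp: Int_absorb1)
  qed (use YN mpt_inv_cancel[OF g] in \<open>auto simp: spR\<close>)
qed

text \<open>
  A measure-preserving map pulls null sets back to null sets, hence it stays measurable for the completed sigma-algebra. This
  covers the standard spaces that are modelled on Lebesgue measurable sets.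
\<close>

lemma mpt_completion:
  assumes g: "g \<in> mpt N"
  shows "g \<in> mpt (completion N)"
proof -
  have meas: "h \<in> measurable (completion N) (completion N)" and
    pres: "distr (completion N) (completion N) h = completion N" if h: "h \<in> mpt N" for h
  proof -
    have h': "h \<in> measurable (completion N) N" by (rule measurable_completion[OF mpt_measurable[OF h]])
    have d: "distr (completion N) N h = N"
      using distr_completion[OF mpt_measurable[OF h]] mpt_distr[OF h] by simp
    show "h \<in> measurable (completion N) (completion N)"
      by (rule completion.measurable_completion2[OF h']) (simp only: d order_refl)
    show "distr (completion N) (completion N) h = completion N"
      using completion.completion_distr_eq[OF h'] unfolding d by simp
  qed
  show ?thesis
  proof (rule mptI[OF meas[OF g] meas[OF mpt_inv[OF g]]])
    fix A assume "A \<in> sets (completion N)"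
    then show "emeasure (completion N) (g -` A \<inter> space (completion N)) = emeasure (completion N) A"
      using emeasure_distr[OF meas[OF g], of A] unfolding pres[OF g] by simp
  qed (simp_all add: mpt_inv_cancel[OF g])
qed

text \<open>
  An isomorphism of spaces is only given off a null set, but a map can be transported
  only if the exceptional set is invariant. Removing all orbits through it achieves this.
\<close>

lemma invariant_conull_set:
  assumes g: "g \<in> mpt N" and B: "B \<in> null_sets N"
  shows "\<exists>Z\<in>null_sets N. B \<subseteq> Z \<and> bij_betw g (space N - Z) (space N - Z)"
proof -
  define h where "h = inv_into (space N) g"
  have h: "h \<in> mpt N" unfolding h_def by (rule mpt_inv[OF g])
  have pow: "{y \<in> space N. (f ^^ k) y \<in> B} \<in> null_sets N" if f: "f \<in> mpt N" for f k
  proof (induction k)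
    case 0
    have "{y \<in> space N. y \<in> B} = B" using sets.sets_into_space[OF null_setsD2[OF B]] by blast
    then show ?case using B by simp
  next
    case (Suc k)
    have "{y \<in> space N. (f ^^ Suc k) y \<in> B} = f -` {y \<in> space N. (f ^^ k) y \<in> B} \<inter> space N"
      using mpt_space[OF f] by (auto simp: funpow_swap1)
    then show ?case using mpt_vimage_null[OF f Suc] by simp
  qed
  \<comment> \<open>all points whose forward or backward orbit meets \<open>B\<close>\<close>
  define Z where "Z = (\<Union>k. {y \<in> space N. (g ^^ k) y \<in> B} \<union> {y \<in> space N. (h ^^ k) y \<in> B})"
  have Z: "Z \<in> null_sets N"
    unfolding Z_def using pow[OF g] pow[OF h] by (intro null_sets_UN null_sets.Un) auto
  have "B \<subseteq> Z"
  proof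
    fix y assume "y \<in> B"
    moreover then have "y \<in> space N" using sets.sets_into_space[OF null_setsD2[OF B]] by blast
    ultimately have "y \<in> {y \<in> space N. (g ^^ 0) y \<in> B}" by simp
    then show "y \<in> Z" unfolding Z_def by blast
  qed
  have step: "f y \<in> space N - (\<Union>k. {y \<in> space N. (f ^^ k) y \<in> B} \<union> {y \<in> space N. (f' ^^ k) y \<in> B})"
    if f: "f \<in> mpt N" and inv: "f' (f y) = y"
      and y: "y \<in> space N - (\<Union>k. {y \<in> space N. (f ^^ k) y \<in> B} \<union> {y \<in> space N. (f' ^^ k) y \<in> B})" for f f' y
  proof -
    have ys: "y \<in> space N" "\<And>k. (f ^^ k) y \<notin> B" "\<And>k. (f' ^^ k) y \<notin> B" using y by blast+
    have "(f ^^ k) (f y) \<notin> B" for k using ys(2)[of "Suc k"] by (simp add: funpow_swap1)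
    moreover have "(f' ^^ k) (f y) \<notin> B" for k
    proof (cases k)
      case 0 then show ?thesis using ys(2)[of 1] by simp
    next
      case (Suc j) then show ?thesis using ys(3)[of j] inv by (simp add: funpow_swap1)
    qed
    ultimately show ?thesis using mpt_space[OF f ys(1)] by blast
  qed
  have gZ: "g y \<in> space N - Z" if "y \<in> space N - Z" for y
    using step[OF g, of h y] mpt_inv_cancel(1)[OF g, of y] that unfolding Z_def h_def by blast
  have hZ: "h y \<in> space N - Z" if "y \<in> space N - Z" for y
    using step[OF h, of g y] mpt_inv_cancel(2)[OF g, of y] that unfolding Z_def h_def
    by (simp only: Un_commute) blast
  have "bij_betw g (space N - Z) (space N - Z)"
  proof (rule bij_betw_byWitness[where f' = h])
    show "\<forall>y\<in>space N - Z. h (g y) = y" "\<forall>y\<in>space N - Z. g (h y) = y"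
      using mpt_inv_cancel[OF g] by (simp_all add: h_def)
    show "g ` (space N - Z) \<subseteq> space N - Z" "h ` (space N - Z) \<subseteq> space N - Z"
      using gZ hZ by blast+
  qed
  with Z \<open>B \<subseteq> Z\<close> show ?thesis by blast
qed

section \<open>Transport along an isomorphism modulo null sets\<close>

locale mod_null_isomorphism =
  fixes M :: "'a measure" and N :: "'b measure" and A B f
  assumes A: "A \<in> null_sets M" and B: "B \<in> null_sets N"
    and bij: "bij_betw f (space M - A) (space N - B)"
    and f_measurable: "f \<in> measurable (restrict_space M (space M - A)) (restrict_space N (space N - B))"
    and f_inv_measurable: "inv_into (space M - A) f \<in>
      measurable (restrict_space N (space N - B)) (restrict_space M (space M - A))"
    and f_distr: "distr (restrict_space M (space M - A)) (restrict_space N (space N - B)) f =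
      restrict_space N (space N - B)"
begin

definition \<psi> :: "'b \<Rightarrow> 'a" where
  "\<psi> = inv_into (space M - A) f"

lemma restricts:
  "space M - A \<in> sets M" "space N - B \<in> sets N"
  "C \<in> sets (restrict_space M (space M - A)) \<longleftrightarrow> C \<in> sets M \<and> C \<subseteq> space M - A"
  "D \<in> sets (restrict_space N (space N - B)) \<longleftrightarrow> D \<in> sets N \<and> D \<subseteq> space N - B"
  "space (restrict_space M (space M - A)) = space M - A"
  "space (restrict_space N (space N - B)) = space N - B"
proof -
  show 1: "space M - A \<in> sets M" "space N - B \<in> sets N" using A B by auto
  show "C \<in> sets (restrict_space M (space M - A)) \<longleftrightarrow> C \<in> sets M \<and> C \<subseteq> space M - A"
    using 1 by (subst sets_restrict_space_iff) (auto simp: Int_absorb1)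
  show "D \<in> sets (restrict_space N (space N - B)) \<longleftrightarrow> D \<in> sets N \<and> D \<subseteq> space N - B"
    using 1 by (subst sets_restrict_space_iff) (auto simp: Int_absorb1)
qed (auto simp: space_restrict_space)

lemma f_in: "x \<in> space M - A \<Longrightarrow> f x \<in> space N - B"
  using bij by (rule bij_betw_apply)

lemma \<psi>_in: "y \<in> space N - B \<Longrightarrow> \<psi> y \<in> space M - A"
  unfolding \<psi>_def using bij_betw_inv_into[OF bij] by (rule bij_betw_apply)

lemma \<psi>_f: "x \<in> space M - A \<Longrightarrow> \<psi> (f x) = x"
  unfolding \<psi>_def using bij by (rule bij_betw_inv_into_left)

lemma f_\<psi>: "y \<in> space N - B \<Longrightarrow> f (\<psi> y) = y"
  unfolding \<psi>_def using bij by (rule bij_betw_inv_into_right)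

lemma f_vimage:
  assumes D: "D \<in> sets N"
  shows "{x \<in> space M - A. f x \<in> D} \<in> sets M" "emeasure M {x \<in> space M - A. f x \<in> D} = emeasure N D"
proof -
  let ?M = "restrict_space M (space M - A)" and ?N = "restrict_space N (space N - B)"
  have D': "D - B \<in> sets ?N" unfolding restricts(4) using D B sets.sets_into_space[OF D] by auto
  have eq: "f -` (D - B) \<inter> space ?M = {x \<in> space M - A. f x \<in> D}"
    unfolding restricts using f_in by auto
  have s: "{x \<in> space M - A. f x \<in> D} \<in> sets ?M"
    using measurable_sets[OF f_measurable D'] unfolding eq .
  then show "{x \<in> space M - A. f x \<in> D} \<in> sets M" unfolding restricts by blast
  have "emeasure M {x \<in> space M - A. f x \<in> D} = emeasure ?M {x \<in> space M - A. f x \<in> D}"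
    using restricts(1) by (subst emeasure_restrict_space) (auto simp: Int_absorb1)
  also have "\<dots> = emeasure (distr ?M ?N f) (D - B)"
    unfolding emeasure_distr[OF f_measurable D'] eq ..
  also have "\<dots> = emeasure N (D - B)"
    unfolding f_distr using restricts(2) sets.sets_into_space[OF D]
    by (subst emeasure_restrict_space) auto
  also have "\<dots> = emeasure N D" by (rule emeasure_Diff_null_set[OF B D])
  finally show "emeasure M {x \<in> space M - A. f x \<in> D} = emeasure N D" .
qed

lemma \<psi>_vimage:
  assumes C: "C \<in> sets M"
  shows "{y \<in> space N - B. \<psi> y \<in> C} \<in> sets N"
proof -
  let ?M = "restrict_space M (space M - A)" and ?N = "restrict_space N (space N - B)"
  have C': "C - A \<in> sets ?M" unfolding restricts(3) using C A sets.sets_into_space[OF C] by auto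
  have "\<psi> -` (C - A) \<inter> space ?N = {y \<in> space N - B. \<psi> y \<in> C}"
    unfolding restricts using \<psi>_in by auto
  then have "{y \<in> space N - B. \<psi> y \<in> C} \<in> sets ?N"
    using measurable_sets[OF f_inv_measurable C'] unfolding \<psi>_def by simp
  then show ?thesis unfolding restricts by blast
qed

text \<open>
  Conjugate \<open>g\<close> by \<open>f\<close> on an invariant conull set and use the identity elsewhere, so that the result is a
  bijection of the whole space.
\<close>

lemma mpt_lift:
  assumes g: "g \<in> mpt N"
  shows "\<exists>T\<in>mpt M. AE x in M. x \<in> space M - A \<and> T x \<in> space M - A \<and> f (T x) = g (f x)"
proof -
  obtain Z where Z: "Z \<in> null_sets N" "B \<subseteq> Z" and gZ: "bij_betw g (space N - Z) (space N - Z)"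
    using invariant_conull_set[OF g B] by blast
  define Y where "Y = space N - Z"
  have Y: "Y \<in> sets N" "Y \<subseteq> space N - B" using Z unfolding Y_def by auto
  define X where "X = {x \<in> space M - A. f x \<in> Y}"
  have X: "X \<in> sets M" unfolding X_def by (rule f_vimage(1)[OF Y(1)])
  have conull: "space M - X \<in> null_sets M"
  proof -
    have "{x \<in> space M - A. f x \<in> Z} \<in> null_sets M"
      using f_vimage[OF null_setsD2[OF Z(1)]] null_setsD1[OF Z(1)] by (intro null_setsI) simp_all
    then have "A \<union> {x \<in> space M - A. f x \<in> Z} \<in> null_sets M" using A by (intro null_sets.Un)
    moreover have "space M - X \<subseteq> A \<union> {x \<in> space M - A. f x \<in> Z}"
      using f_in unfolding X_def Y_def by blast
    moreover have "space M - X \<in> sets M" using X by blast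
    ultimately show ?thesis by (metis null_sets_subset)
  qed
  have \<psi>Y: "\<psi> y \<in> X" "f (\<psi> y) = y" if "y \<in> Y" for y
    using \<psi>_in[of y] f_\<psi>[of y] that Y(2) unfolding X_def by auto
  have Xf: "f x \<in> Y" "\<psi> (f x) = x" "x \<in> space M - A" if "x \<in> X" for x
    using that \<psi>_f[of x] unfolding X_def by auto
  define conj where "conj h x = (if x \<in> X then \<psi> (h (f x)) else x)" for h x
  have main: "conj h -` C \<inter> space M \<in> sets M \<and> emeasure M (conj h -` C \<inter> space M) = emeasure M C"
    if h: "h \<in> mpt N" and hY: "\<And>y. y \<in> Y \<Longrightarrow> h y \<in> Y" and C: "C \<in> sets M" for h C
  proof -
    define D where "D = {y \<in> space N - B. \<psi> y \<in> C} \<inter> Y"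
    have D: "D \<in> sets N" unfolding D_def using \<psi>_vimage[OF C] Y(1) by (rule sets.Int)
    define E where "E = (h -` D \<inter> space N) \<inter> Y"
    have hD: "h -` D \<inter> space N \<in> sets N" by (rule measurable_sets[OF mpt_measurable[OF h] D])
    have E: "E \<in> sets N" unfolding E_def using hD Y(1) by (rule sets.Int)
    have "E = (h -` D \<inter> space N) - Z" unfolding E_def Y_def by blast
    then have emE: "emeasure N E = emeasure N D"
      using emeasure_Diff_null_set[OF Z(1) hD] mpt_emeasure[OF h D] by simp
    have 1: "{x \<in> space M - A. f x \<in> E} = {x \<in> X. conj h x \<in> C}"
    proof (rule set_eqI)
      fix x
      show "x \<in> {x \<in> space M - A. f x \<in> E} \<longleftrightarrow> x \<in> {x \<in> X. conj h x \<in> C}"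
      proof (cases "x \<in> X")
        case True
        have fx: "f x \<in> Y" "h (f x) \<in> Y" using Xf(1)[OF True] hY by simp_all
        then have "f x \<in> E \<longleftrightarrow> \<psi> (h (f x)) \<in> C"
          using Y(2) unfolding E_def D_def by auto
        then show ?thesis using True Xf(3)[OF True] by (simp add: conj_def)
      next
        case False
        then show ?thesis unfolding X_def E_def by blast
      qed
    qed
    have 2: "{x \<in> space M - A. f x \<in> D} = X \<inter> C"
    proof (rule set_eqI)
      fix x
      show "x \<in> {x \<in> space M - A. f x \<in> D} \<longleftrightarrow> x \<in> X \<inter> C"
      proof (cases "x \<in> X")
        case True
        have "f x \<in> D \<longleftrightarrow> x \<in> C" using Xf(1,2)[OF True] Y(2) unfolding D_def by auto
        then show ?thesis using True Xf(3)[OF True] by simp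
      next
        case False
        then show ?thesis unfolding X_def D_def by blast
      qed
    qed
    have XM: "X \<subseteq> space M" by (rule sets.sets_into_space[OF X])
    have CM: "C \<subseteq> space M" by (rule sets.sets_into_space[OF C])
    have vim: "conj h -` C \<inter> space M = {x \<in> X. conj h x \<in> C} \<union> (C \<inter> (space M - X))"
      using XM CM unfolding conj_def by (auto split: if_splits)
    have s: "{x \<in> X. conj h x \<in> C} \<in> sets M" using f_vimage(1)[OF E] unfolding 1 .
    have nul: "C \<inter> (space M - X) \<in> null_sets M" using conull C by (intro null_set_Int1)
    have "emeasure M (conj h -` C \<inter> space M) = emeasure M {x \<in> X. conj h x \<in> C}"
      unfolding vim by (rule emeasure_Un_null_set[OF s nul])
    also have "\<dots> = emeasure M (X \<inter> C)"
      using f_vimage(2)[OF E] f_vimage(2)[OF D] emE unfolding 1 2 by simp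
    also have "\<dots> = emeasure M (X \<inter> C \<union> C \<inter> (space M - X))"
      using X C nul by (intro emeasure_Un_null_set[symmetric]) auto
    also have "X \<inter> C \<union> C \<inter> (space M - X) = C" using CM by blast
    finally show ?thesis unfolding vim using s nul by auto
  qed
  have conj_space: "conj h x \<in> space M" if hY: "\<And>y. y \<in> Y \<Longrightarrow> h y \<in> Y" and x: "x \<in> space M" for h x
  proof (cases "x \<in> X")
    case True
    then have "conj h x \<in> X" unfolding conj_def using \<psi>Y(1)[OF hY[OF Xf(1)[OF True]]] by simp
    then show ?thesis using sets.sets_into_space[OF X] by blast
  qed (simp add: conj_def x)
  have conj_meas: "conj h \<in> measurable M M" if h: "h \<in> mpt N" and hY: "\<And>y. y \<in> Y \<Longrightarrow> h y \<in> Y" for h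
    using main[OF h hY] conj_space[of h, OF hY] by (intro measurableI) blast+
  define k where "k = inv_into (space N) g"
  have k: "k \<in> mpt N" unfolding k_def by (rule mpt_inv[OF g])
  have gY: "g y \<in> Y" if "y \<in> Y" for y
    using bij_betw_apply[OF gZ] that unfolding Y_def by blast
  have kY: "k y \<in> Y" if "y \<in> Y" for y
  proof -
    have "y \<in> g ` Y" using bij_betw_imp_surj_on[OF gZ] that unfolding Y_def by simp
    then obtain x where x: "y = g x" "x \<in> Y" by (rule imageE)
    then have "x \<in> space N" unfolding Y_def by blast
    then show ?thesis using mpt_inv_cancel(1)[OF g, of x] x unfolding k_def by simp
  qed
  have cancel: "conj h (conj h' x) = x"
    if "\<And>y. y \<in> Y \<Longrightarrow> h' y \<in> Y" "\<And>y. y \<in> Y \<Longrightarrow> h (h' y) = y" for h h' x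
  proof (cases "x \<in> X")
    case True
    have "h' (f x) \<in> Y" by (rule that(1)[OF Xf(1)[OF True]])
    then show ?thesis using True \<psi>Y that(2) Xf[OF True] by (simp add: conj_def)
  qed (simp add: conj_def)
  have gk: "g (k y) = y" "k (g y) = y" if "y \<in> Y" for y
    using mpt_inv_cancel[OF g, of y] that unfolding k_def Y_def by auto
  have "conj g \<in> mpt M"
    by (rule mptI[OF conj_meas[OF g gY] conj_meas[OF k kY]])
      (use cancel[OF kY gk(1)] cancel[OF gY gk(2)] main[OF g gY] in auto)
  moreover have "AE x in M. x \<in> space M - A \<and> conj g x \<in> space M - A \<and> f (conj g x) = g (f x)"
  proof (rule AE_I'[OF conull])
    have "x \<in> space M - A \<and> conj g x \<in> space M - A \<and> f (conj g x) = g (f x)" if "x \<in> X" for x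
      using \<psi>Y[OF gY[OF Xf(1)[OF that]]] that Xf(3) by (simp add: conj_def)
    then show "{x \<in> space M. \<not> (x \<in> space M - A \<and> conj g x \<in> space M - A \<and> f (conj g x) = g (f x))} \<subseteq> space M - X"
      by blast
  qed
  ultimately show ?thesis by blast
qed

end

section \<open>Uniform coordinates on standard probability spaces\<close>

text \<open>
  All that is used of a standard space: a uniformly distributed real function that generates
  the sigma-algebra modulo null sets and along which automorphisms of the interval lift.
\<close>

locale uniform_coordinate = prob_space M for M :: "'a measure" +
  fixes u :: "'a \<Rightarrow> real"
  assumes u_measurable: "u \<in> measurable M unit_interval"
    and u_distr: "distr M unit_interval u = unit_interval"
    and u_generates: "\<And>C. C \<in> sets M \<Longrightarrow> \<exists>D\<in>sets borel. AE x in M. x \<in> C \<longleftrightarrow> u x \<in> D"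
    and u_lifts: "\<And>g. g \<in> mpt unit_interval \<Longrightarrow> \<exists>T\<in>mpt M. AE x in M. u (T x) = g (u x)"

lemma uniform_coordinate_if_isomorphic:
  fixes M :: "'a measure" and L :: "real measure"
  assumes L: "L = lborel \<or> L = lebesgue"
    and iso: "mod_null_isomorphism M (restrict_space L {0..1}) A B f"
  shows "\<exists>u. uniform_coordinate M u"
proof -
  let ?N = "restrict_space L {0..1::real}"
  interpret mod_null_isomorphism M ?N A B f by (rule iso)
  have borel_L: "D \<in> sets borel \<Longrightarrow> D \<in> sets L" for D using L by auto
  have em_L: "D \<in> sets borel \<Longrightarrow> emeasure L D = emeasure lborel D" for D using L by auto
  have spL: "space L = UNIV" using L by auto
  have spN: "space ?N = {0..1}" using spL by (simp add: space_restrict_space)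
  have setsN: "D \<in> sets ?N \<longleftrightarrow> D \<in> sets L \<and> D \<subseteq> {0..1}" for D
    using borel_L spL by (subst sets_restrict_space_iff) auto
  have emN: "emeasure ?N D = emeasure L D" if "D \<subseteq> {0..1}" for D
    using that borel_L spL by (subst emeasure_restrict_space) auto
  \<comment> \<open>The default value 0 keeps \<open>u\<close> in the half-open interval. It is taken on a null set only.\<close>
  define u where "u x = (if x \<in> space M - A \<and> f x < 1 then f x else 0)" for x
  have fx: "0 \<le> f x \<and> f x \<le> 1" if "x \<in> space M - A" for x using f_in[OF that] unfolding spN by auto
  have one: "{1} \<in> null_sets ?N"
  proof (rule null_setsI)
    show "emeasure ?N {1} = 0" using em_L[of "{1}"] by (subst emN) auto
    show "{1} \<in> sets ?N" using borel_L[of "{1}"] by (simp add: setsN)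
  qed
  have null_f: "{x \<in> space M - A. f x \<in> D} \<in> null_sets M" if "D \<in> null_sets ?N" for D
    using f_vimage[OF null_setsD2[OF that]] null_setsD1[OF that] by (intro null_setsI) simp_all
  have exc: "A \<union> {x \<in> space M - A. f x \<in> {1}} \<in> null_sets M"
    using A null_f[OF one] by (intro null_sets.Un)
  have AE_u: "AE x in M. x \<in> space M - A \<and> f x < 1 \<and> u x = f x"
  proof (rule AE_I'[OF exc])
    show "{x \<in> space M. \<not> (x \<in> space M - A \<and> f x < 1 \<and> u x = f x)} \<subseteq> A \<union> {x \<in> space M - A. f x \<in> {1}}"
      using fx by (force simp: u_def)
  qed
  have u_vim: "{x \<in> space M. u x \<in> D} \<in> sets M" if D: "D \<in> sets borel" for D
  proof -
    let ?V = "{x \<in> space M - A. f x \<in> {0..<1}}"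
    have V: "?V \<in> sets M" using borel_L[of "{0..<1}"] by (intro f_vimage(1)) (auto simp: setsN)
    have W: "{x \<in> space M - A. f x \<in> D \<inter> {0..<1}} \<in> sets M"
      using borel_L[of "D \<inter> {0..<1}"] D by (intro f_vimage(1)) (auto simp: setsN)
    have "{x \<in> space M. u x \<in> D} = {x \<in> space M - A. f x \<in> D \<inter> {0..<1}} \<union> (if 0 \<in> D then space M - ?V else {})"
    proof (rule set_eqI)
      fix x
      show "x \<in> {x \<in> space M. u x \<in> D} \<longleftrightarrow> x \<in> {x \<in> space M - A. f x \<in> D \<inter> {0..<1}} \<union> (if 0 \<in> D then space M - ?V else {})"
        using fx[of x] by (cases "x \<in> space M - A") (auto simp: u_def)
    qed
    then show ?thesis using V W by auto
  qed
  have u_range: "u x \<in> {0..<1}" for x using fx[of x] by (auto simp: u_def)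
  have u_meas: "u \<in> measurable M unit_interval"
  proof (rule measurableI)
    fix D assume "D \<in> sets unit_interval"
    then have "{x \<in> space M. u x \<in> D} \<in> sets M" by (intro u_vim) (simp add: sets_unit_interval)
    moreover have "u -` D \<inter> space M = {x \<in> space M. u x \<in> D}" by blast
    ultimately show "u -` D \<inter> space M \<in> sets M" by simp
  qed (use u_range in simp)
  have dist: "distr M unit_interval u = unit_interval"
  proof (rule measure_eqI)
    fix D assume "D \<in> sets (distr M unit_interval u)"
    then have D': "D \<in> sets unit_interval" by (simp only: sets_distr)
    then have D: "D \<in> sets borel" "D \<subseteq> {0..<1}" unfolding sets_unit_interval by blast+
    have DN: "D \<in> sets ?N" using D borel_L[OF D(1)] by (auto simp: setsN)
    have "emeasure (distr M unit_interval u) D = emeasure M {x \<in> space M. u x \<in> D}"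
      unfolding emeasure_distr[OF u_meas D'] by (rule arg_cong[where f = "emeasure M"]) blast
    also have "\<dots> = emeasure M {x \<in> space M - A. f x \<in> D}"
    proof (rule emeasure_eq_AE[OF _ u_vim[OF D(1)] f_vimage(1)[OF DN]])
      show "AE x in M. x \<in> {x \<in> space M. u x \<in> D} \<longleftrightarrow> x \<in> {x \<in> space M - A. f x \<in> D}"
        using AE_u by eventually_elim auto
    qed
    also have "\<dots> = emeasure ?N D" by (rule f_vimage(2)[OF DN])
    also have "\<dots> = emeasure lborel D" using D by (subst emN) (auto simp: em_L)
    also have "\<dots> = emeasure unit_interval D" using D by (subst emeasure_restrict_space) auto
    finally show "emeasure (distr M unit_interval u) D = emeasure unit_interval D" .
  qed (rule sets_distr)
  interpret prob_space M
  proof (rule prob_spaceI)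
    have "space unit_interval \<in> sets unit_interval" by (rule sets.top)
    then have "emeasure (distr M unit_interval u) (space unit_interval) = emeasure M (space M)"
      using emeasure_distr[OF u_meas] u_range by (simp add: vimage_def)
    then show "emeasure M (space M) = 1"
      unfolding dist using prob_space.emeasure_space_1[OF prob_space_unit_interval] by simp
  qed
  have gen: "\<exists>D\<in>sets borel. AE x in M. x \<in> C \<longleftrightarrow> u x \<in> D" if C: "C \<in> sets M" for C
  proof -
    define E where "E = {y \<in> space ?N - B. \<psi> y \<in> C}"
    have E: "E \<in> sets L" "E \<subseteq> {0..1}" using \<psi>_vimage[OF C] unfolding E_def[symmetric] setsN by blast+
    obtain D Z where D: "D \<in> sets borel" and Z: "Z \<in> null_sets lborel" and DZ: "(E - D) \<union> (D - E) \<subseteq> Z"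
    proof (cases "L = lborel")
      case True
      then show thesis using E by (intro that[of E "{}"]) auto
    next
      case False
      then have "E \<in> sets (completion lborel)" using L E by auto
      then obtain S P P' where "E = S \<union> P" "P \<subseteq> P'" "P' \<in> null_sets lborel" "S \<in> sets lborel"
        by (rule sets_completionE)
      then show thesis by (intro that[of S P']) auto
    qed
    have "Z \<inter> {0..1} \<in> null_sets ?N"
    proof (rule null_setsI)
      have Zb: "Z \<in> sets borel" "emeasure lborel Z = 0" using Z by auto
      then have "Z \<inter> {0..1} \<in> null_sets lborel" using Z by (intro null_set_Int2) auto
      then have "emeasure lborel (Z \<inter> {0..1}) = 0" by blast
      then show "emeasure ?N (Z \<inter> {0..1}) = 0" using Zb by (subst emN) (auto simp: em_L)
      show "Z \<inter> {0..1} \<in> sets ?N" using borel_L[of "Z \<inter> {0..1}"] Zb by (auto simp: setsN)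
    qed
    from AE_not_in[OF null_f[OF this]] AE_u
    have "AE x in M. x \<in> C \<longleftrightarrow> u x \<in> D"
    proof eventually_elim
      case (elim x)
      then have x: "x \<in> space M - A" "f x \<notin> Z" "u x = f x" using fx[of x] by auto
      have "x \<in> C \<longleftrightarrow> f x \<in> E" using f_in[OF x(1)] \<psi>_f[OF x(1)] unfolding E_def by simp
      also have "\<dots> \<longleftrightarrow> f x \<in> D" using DZ x(2) by blast
      finally show ?case using x(3) by simp
    qed
    with D show ?thesis by blast
  qed
  have lifts: "\<exists>T\<in>mpt M. AE x in M. u (T x) = g (u x)" if g: "g \<in> mpt unit_interval" for g
  proof -
    \<comment> \<open>Extending \<open>g\<close> to the whole line first lets the completion of Lebesgue measure be taken before the restriction to \<open>{0..1}\<close>.\<close>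
    define g1 where "g1 y = (if y \<in> {0..<1} then g y else y)" for y
    have "g1 \<in> mpt lborel" unfolding g1_def[abs_def] by (rule mpt_extend[OF _ g]) simp
    then have g1L: "g1 \<in> mpt L" using L mpt_completion by blast
    have g_bij: "bij_betw g {0..<1} {0..<1}" using mpt_bij[OF g] by simp
    have "bij_betw g1 {0..1} {0..1}"
    proof -
      have 1: "bij_betw g1 {0..<1} {0..<1}" using g_bij by (subst bij_betw_cong[where g = g]) (auto simp: g1_def)
      have 2: "bij_betw g1 {1} {1}" by (simp add: g1_def bij_betw_def)
      have "bij_betw g1 ({0..<1} \<union> {1}) ({0..<1} \<union> {1})" by (rule bij_betw_combine[OF 1 2]) auto
      moreover have "{0..<1} \<union> {1} = {0..1::real}" by auto
      ultimately show ?thesis by simp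
    qed
    then have "g1 \<in> mpt ?N" using borel_L[of "{0..1}"] by (intro mpt_restrict g1L) auto
    then obtain T where T: "T \<in> mpt M"
      and eq: "AE x in M. x \<in> space M - A \<and> T x \<in> space M - A \<and> f (T x) = g1 (f x)"
      using mpt_lift by blast
    have "AE x in M. u (T x) = g (u x)"
      using eq AE_u
    proof eventually_elim
      case (elim x)
      then have x: "x \<in> space M - A" "T x \<in> space M - A" "f (T x) = g1 (f x)" "f x < 1" "u x = f x" by auto
      have "g (f x) \<in> {0..<1}" using fx[OF x(1)] x(4) bij_betw_apply[OF g_bij, of "f x"] by auto
      then show ?case using x fx[OF x(1)] by (simp add: u_def g1_def)
    qed
    with T show ?thesis by blast
  qed
  have "uniform_coordinate M u"
    by unfold_locales (rule u_meas dist gen lifts; assumption?)+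
  then show ?thesis by blast
qed

lemma uniform_coordinate_exists:
  assumes "standard_prob_space M"
  shows "\<exists>u. uniform_coordinate M u"
proof -
  obtain L where L: "L = lborel \<or> L = lebesgue" and iso: "isomorphic_mod_null M (restrict_space L {0..1::real})"
    using assms unfolding standard_prob_space_def by blast
  obtain A B f where "mod_null_isomorphism M (restrict_space L {0..1}) A B f"
    using iso unfolding isomorphic_mod_null_def Let_def mod_null_isomorphism_def by blast
  then show ?thesis by (rule uniform_coordinate_if_isomorphic[OF L])
qed

section \<open>Composition, classes and Koopman operators\<close>

lemma sets_neq:
  fixes f g :: "'a \<Rightarrow> 'c::countable"
  assumes f: "f \<in> measurable M (count_space UNIV)" and g: "g \<in> measurable M (count_space UNIV)"
  shows "{x \<in> space M. f x \<noteq> g x} \<in> sets M"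
proof -
  have "(\<lambda>x. f x \<noteq> g x) \<in> measurable M (count_space UNIV)"
    by (rule measurable_compose_countable[OF _ f, where f = "\<lambda>i x. i \<noteq> g x"])
      (rule measurable_compose[OF g], simp)
  then show ?thesis by (rule sets_Collect_count[where Q = "\<lambda>b. b"])
qed

lemma mpt_id: "(\<lambda>x. x) \<in> mpt M"
  by (rule mptI[where S = "\<lambda>x. x"]) (auto intro: arg_cong[where f = "emeasure M"] dest: sets.sets_into_space)

lemma mpt_compose:
  assumes S: "S \<in> mpt M" and T: "T \<in> mpt M"
  shows "(\<lambda>x. S (T x)) \<in> mpt M"
proof (rule mptI[where S = "\<lambda>x. inv_into (space M) T (inv_into (space M) S x)"])
  show "(\<lambda>x. S (T x)) \<in> measurable M M"
    by (rule measurable_compose[OF mpt_measurable[OF T] mpt_measurable[OF S]])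
  show "(\<lambda>x. inv_into (space M) T (inv_into (space M) S x)) \<in> measurable M M"
    by (rule measurable_compose[OF mpt_inv_measurable[OF S] mpt_inv_measurable[OF T]])
  fix A assume A: "A \<in> sets M"
  have SA: "S -` A \<inter> space M \<in> sets M" by (rule measurable_sets[OF mpt_measurable[OF S] A])
  have "(\<lambda>x. S (T x)) -` A \<inter> space M = T -` (S -` A \<inter> space M) \<inter> space M"
    using mpt_space[OF T] by auto
  then show "emeasure M ((\<lambda>x. S (T x)) -` A \<inter> space M) = emeasure M A"
    using mpt_emeasure[OF T SA] mpt_emeasure[OF S A] by simp
next
  fix x assume x: "x \<in> space M"
  have Sx: "inv_into (space M) S x \<in> space M" by (rule mpt_space[OF mpt_inv[OF S] x])
  show "S (T (inv_into (space M) T (inv_into (space M) S x))) = x"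
    by (simp add: mpt_inv_cancel[OF T Sx] mpt_inv_cancel[OF S x])
  show "inv_into (space M) T (inv_into (space M) S (S (T x))) = x"
    by (simp add: mpt_inv_cancel[OF S mpt_space[OF T x]] mpt_inv_cancel[OF T x])
qed

lemma mpt_funpow: "T \<in> mpt M \<Longrightarrow> (T ^^ n) \<in> mpt M"
proof (induction n)
  case 0 then show ?case using mpt_id by (simp add: id_def)
next
  case (Suc n) then show ?case using mpt_compose[of T M "T ^^ n"] by (simp add: comp_def)
qed

lemma mpt_measure_vimage:
  assumes T: "T \<in> mpt M" and P: "{x \<in> space M. P x} \<in> sets M"
  shows "measure M {x \<in> space M. P (T x)} = measure M {x \<in> space M. P x}"
proof -
  have "T -` {x \<in> space M. P x} \<inter> space M = {x \<in> space M. P (T x)}" using mpt_space[OF T] by auto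
  then show ?thesis using mpt_emeasure[OF T P] by (simp add: measure_def)
qed

lemma mpt_AE:
  assumes T: "T \<in> mpt M" and P: "AE x in M. P x"
  shows "AE x in M. P (T x)"
proof -
  have "AE x in distr M M T. P x" unfolding mpt_distr[OF T] by (rule P)
  then show ?thesis by (rule AE_distrD[OF mpt_measurable[OF T]])
qed

lemma mpt_rel_class_iff: "S \<in> mpt_rel M `` {T} \<longleftrightarrow> S \<in> mpt M \<and> T \<in> mpt M \<and> (AE x in M. T x = S x)"
  by (auto simp: mpt_rel_def)

lemma mpt_class_self: "T \<in> mpt M \<Longrightarrow> T \<in> mpt_rel M `` {T}"
  unfolding mpt_rel_class_iff by simp

lemma mpt_classesI: "T \<in> mpt M \<Longrightarrow> mpt_rel M `` {T} \<in> mpt_classes M"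
  unfolding mpt_classes_def by (rule quotientI)

lemma mpt_classesE:
  assumes "c \<in> mpt_classes M" "T \<in> c"
  shows "T \<in> mpt M" "c = mpt_rel M `` {T}"
proof -
  obtain S where S: "S \<in> mpt M" "c = mpt_rel M `` {S}"
    using assms(1) unfolding mpt_classes_def by (rule quotientE)
  then show "T \<in> mpt M" using assms(2) unfolding S(2) mpt_rel_class_iff by simp
  have "(S, T) \<in> mpt_rel M" using assms(2) S(2) by simp
  then show "c = mpt_rel M `` {T}" using equiv_class_eq[OF equiv_mpt_rel] S(2) by metis
qed

lemma L2_measurable: "f \<in> L2_functions M \<Longrightarrow> f \<in> borel_measurable M"
  by (simp add: L2_functions_def)

lemma L2_diff_integrable:
  assumes f: "f \<in> L2_functions M" and g: "g \<in> L2_functions M"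
  shows "integrable M (\<lambda>x. (cmod (f x - g x))\<^sup>2)"
proof (rule Bochner_Integration.integrable_bound)
  show "integrable M (\<lambda>x. 2 * (cmod (f x))\<^sup>2 + 2 * (cmod (g x))\<^sup>2)"
    using f g by (simp add: L2_functions_def)
  show "(\<lambda>x. (cmod (f x - g x))\<^sup>2) \<in> borel_measurable M"
    using L2_measurable[OF f] L2_measurable[OF g] by measurable
  have "(cmod (a - b))\<^sup>2 \<le> 2 * (cmod a)\<^sup>2 + 2 * (cmod b)\<^sup>2" for a b
  proof -
    have "(cmod (a - b))\<^sup>2 \<le> (cmod a + cmod b)\<^sup>2" by (intro power_mono norm_triangle_ineq4) simp
    also have "\<dots> \<le> 2 * (cmod a)\<^sup>2 + 2 * (cmod b)\<^sup>2"
      using sum_squares_bound[of "cmod a" "cmod b"] by (simp add: power2_sum)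
    finally show ?thesis .
  qed
  then show "AE x in M. norm ((cmod (f x - g x))\<^sup>2) \<le> norm (2 * (cmod (f x))\<^sup>2 + 2 * (cmod (g x))\<^sup>2)"
    by (intro AE_I2) simp
qed

lemma L2_dist_nonneg: "0 \<le> L2_dist M f g"
  by (simp add: L2_dist_def)

lemma L2_dist_square: "(L2_dist M f g)\<^sup>2 = (LINT x|M. (cmod (f x - g x))\<^sup>2)"
  by (simp add: L2_dist_def)

lemma L2_dist_commute: "L2_dist M f g = L2_dist M g f"
  by (simp add: L2_dist_def norm_minus_commute)

lemma L2_dist_triangle:
  assumes f: "f \<in> L2_functions M" and g: "g \<in> L2_functions M" and h: "h \<in> L2_functions M"
  shows "L2_dist M f h \<le> L2_dist M f g + L2_dist M g h"
proof (rule field_le_epsilon)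
  fix e :: real assume e: "0 < e"
  \<comment> \<open>Integrate \<open>\<bar>s + t\<bar>\<^sup>2 \<le> (1 + b/a) s\<^sup>2 + (1 + a/b) t\<^sup>2\<close>. Adding \<open>e / 2\<close> keeps the denominators positive.\<close>
  define a where "a = L2_dist M f g + e / 2"
  define b where "b = L2_dist M g h + e / 2"
  have a: "0 < a" "L2_dist M f g \<le> a" and b: "0 < b" "L2_dist M g h \<le> b"
    using e L2_dist_nonneg[of M f g] L2_dist_nonneg[of M g h] by (auto simp: a_def b_def)
  have pt: "(cmod (f x - h x))\<^sup>2 \<le> (1 + b / a) * (cmod (f x - g x))\<^sup>2 + (1 + a / b) * (cmod (g x - h x))\<^sup>2" for x
  proof -
    define s where "s = cmod (f x - g x)"
    define t where "t = cmod (g x - h x)"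
    have "cmod (f x - h x) \<le> s + t"
      unfolding s_def t_def using norm_triangle_ineq[of "f x - g x" "g x - h x"] by simp
    then have "(cmod (f x - h x))\<^sup>2 \<le> (s + t)\<^sup>2" by (intro power_mono) auto
    also have "\<dots> \<le> (1 + b / a) * s\<^sup>2 + (1 + a / b) * t\<^sup>2"
    proof -
      have "0 \<le> (b * s - a * t)\<^sup>2 / (a * b)" using a b by (intro divide_nonneg_nonneg) auto
      also have "\<dots> = (1 + b / a) * s\<^sup>2 + (1 + a / b) * t\<^sup>2 - (s + t)\<^sup>2"
        using a b by (simp add: power2_eq_square field_simps)
      finally show ?thesis by simp
    qed
    finally show ?thesis by (simp add: s_def t_def)
  qed
  have "(L2_dist M f h)\<^sup>2 \<le> (LINT x|M. (1 + b / a) * (cmod (f x - g x))\<^sup>2 + (1 + a / b) * (cmod (g x - h x))\<^sup>2)"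
    unfolding L2_dist_square using L2_diff_integrable[OF f g] L2_diff_integrable[OF g h] L2_diff_integrable[OF f h] pt
    by (intro integral_mono) auto
  also have "\<dots> = (1 + b / a) * (L2_dist M f g)\<^sup>2 + (1 + a / b) * (L2_dist M g h)\<^sup>2"
    unfolding L2_dist_square using L2_diff_integrable[OF f g] L2_diff_integrable[OF g h] by simp
  also have "\<dots> \<le> (1 + b / a) * a\<^sup>2 + (1 + a / b) * b\<^sup>2"
    using a b L2_dist_nonneg[of M] by (intro add_mono mult_left_mono power_mono) auto
  also have "\<dots> = (a + b)\<^sup>2"
    using a b by (simp add: power2_eq_square field_simps)
  finally have "(L2_dist M f h)\<^sup>2 \<le> (a + b)\<^sup>2" .
  then have "L2_dist M f h \<le> a + b" by (rule power2_le_imp_le) (use a b in linarith)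
  then show "L2_dist M f h \<le> L2_dist M f g + L2_dist M g h + e" by (simp add: a_def b_def)
qed

lemma koopman_L2:
  assumes T: "T \<in> mpt M" and f: "f \<in> L2_functions M"
  shows "koopman T f \<in> L2_functions M"
proof -
  have "integrable (distr M M T) (\<lambda>x. (cmod (f x))\<^sup>2)" unfolding mpt_distr[OF T] using f by (simp add: L2_functions_def)
  then have "integrable M (\<lambda>x. (cmod (f (T x)))\<^sup>2)" by (rule integrable_distr[OF mpt_measurable[OF T]])
  moreover have "(\<lambda>x. f (T x)) \<in> borel_measurable M"
    by (rule measurable_compose[OF mpt_measurable[OF T] L2_measurable[OF f]])
  ultimately show ?thesis by (simp add: L2_functions_def koopman_def comp_def)
qed

lemma L2_dist_koopman:
  assumes T: "T \<in> mpt M" and f: "f \<in> L2_functions M" and g: "g \<in> L2_functions M"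
  shows "L2_dist M (koopman T f) (koopman T g) = L2_dist M f g"
proof -
  have "(LINT x|distr M M T. (cmod (f x - g x))\<^sup>2) = (LINT x|M. (cmod (f (T x) - g (T x)))\<^sup>2)"
    using L2_measurable[OF f] L2_measurable[OF g] by (intro integral_distr mpt_measurable[OF T]) measurable
  then show ?thesis unfolding mpt_distr[OF T] by (simp add: L2_dist_def koopman_def)
qed

text \<open>The distance does not depend on the representative of a class, so membership in a Koopman ball can be tested on any member.\<close>

lemma L2_dist_koopman_AE:
  assumes S: "S \<in> mpt M" and S': "S' \<in> mpt M" and eq: "AE x in M. S x = S' x"
    and f: "f \<in> borel_measurable M" and h: "h \<in> borel_measurable M"
  shows "L2_dist M (koopman S f) h = L2_dist M (koopman S' f) h"
proof -
  have m: "koopman S f \<in> borel_measurable M" if "S \<in> mpt M" for S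
    unfolding koopman_def comp_def using that by (intro measurable_compose[OF mpt_measurable f])
  have "(LINT x|M. (cmod (koopman S f x - h x))\<^sup>2) = (LINT x|M. (cmod (koopman S' f x - h x))\<^sup>2)"
  proof (rule integral_cong_AE)
    show "(\<lambda>x. (cmod (koopman S f x - h x))\<^sup>2) \<in> borel_measurable M"
      "(\<lambda>x. (cmod (koopman S' f x - h x))\<^sup>2) \<in> borel_measurable M"
      using m[OF S] m[OF S'] h by measurable
    show "AE x in M. (cmod (koopman S f x - h x))\<^sup>2 = (cmod (koopman S' f x - h x))\<^sup>2"
      using eq by eventually_elim (simp add: koopman_def)
  qed
  then show ?thesis by (simp add: L2_dist_def)
qed

definition koopman_ball :: "'a measure \<Rightarrow> ('a \<Rightarrow> complex) \<Rightarrow> ('a \<Rightarrow> 'a) \<Rightarrow> real \<Rightarrow> ('a \<Rightarrow> 'a) set set" where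
  "koopman_ball M f T e = {c \<in> mpt_classes M. \<exists>S\<in>c. L2_dist M (koopman S f) (koopman T f) < e}"

lemma weak_topology_koopman_balls:
  "weak_topology M = topology_generated_by
     {koopman_ball M f T e | f T e. f \<in> L2_functions M \<and> T \<in> mpt M \<and> e > 0}"
  unfolding weak_topology_def koopman_ball_def ..

lemma openin_koopman_ball:
  assumes "f \<in> L2_functions M" "T \<in> mpt M" "0 < e"
  shows "openin (weak_topology M) (koopman_ball M f T e)"
  unfolding weak_topology_koopman_balls using assms by (intro topology_generated_by_Basis) blast

lemma koopman_ball_dist:
  assumes c: "c \<in> koopman_ball M f T e" and S: "S \<in> c" and f: "f \<in> L2_functions M" and T: "T \<in> mpt M"
  shows "L2_dist M (koopman S f) (koopman T f) < e"
proof -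
  obtain S' where S': "S' \<in> c" "L2_dist M (koopman S' f) (koopman T f) < e" and cl: "c \<in> mpt_classes M"
    using c unfolding koopman_ball_def by blast
  have "S' \<in> mpt_rel M `` {S}" using S'(1) mpt_classesE(2)[OF cl S] by simp
  then have "S \<in> mpt M" "S' \<in> mpt M" "AE x in M. S x = S' x" unfolding mpt_rel_class_iff by blast+
  then have "L2_dist M (koopman S f) (koopman T f) = L2_dist M (koopman S' f) (koopman T f)"
    using L2_measurable[OF f] L2_measurable[OF koopman_L2[OF T f]] by (rule L2_dist_koopman_AE)
  with S'(2) show ?thesis by simp
qed

lemma (in prob_space) bounded_L2:
  assumes f: "f \<in> borel_measurable M" and C: "\<And>x. x \<in> space M \<Longrightarrow> cmod (f x) \<le> C"
  shows "f \<in> L2_functions M"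
proof -
  have "integrable M (\<lambda>x. (cmod (f x))\<^sup>2)"
  proof (rule integrable_const_bound[where B = "C\<^sup>2"])
    show "AE x in M. norm ((cmod (f x))\<^sup>2) \<le> C\<^sup>2"
      using C by (intro AE_I2) (simp add: power_mono)
    show "(\<lambda>x. (cmod (f x))\<^sup>2) \<in> borel_measurable M" using f by measurable
  qed
  then show ?thesis using f by (simp add: L2_functions_def)
qed

lemma (in prob_space) L2_dist_bounded_le:
  assumes f: "f \<in> L2_functions M" and g: "g \<in> L2_functions M"
    and C: "\<And>x. x \<in> space M \<Longrightarrow> cmod (f x - g x) \<le> C"
    and E: "E \<in> sets M" and eq: "\<And>x. x \<in> space M \<Longrightarrow> x \<notin> E \<Longrightarrow> f x = g x"
  shows "(L2_dist M f g)\<^sup>2 \<le> C\<^sup>2 * measure M E"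
proof -
  have "(L2_dist M f g)\<^sup>2 \<le> (LINT x|M. C\<^sup>2 * indicator E x)"
    unfolding L2_dist_square
  proof (rule integral_mono)
    show "integrable M (\<lambda>x. (cmod (f x - g x))\<^sup>2)" by (rule L2_diff_integrable[OF f g])
    show "integrable M (\<lambda>x. C\<^sup>2 * indicator E x)" using E by (intro integrable_mult_right integrable_real_indicator) (auto simp: less_top[symmetric])
    fix x assume x: "x \<in> space M"
    show "(cmod (f x - g x))\<^sup>2 \<le> C\<^sup>2 * indicator E x"
      using eq[OF x] power_mono[OF C[OF x], of 2] by (cases "x \<in> E") auto
  qed
  also have "\<dots> = C\<^sup>2 * measure M E" using E by simp
  finally show ?thesis .
qed

lemma (in prob_space) measure_neq_le_L2_dist:
  fixes F G :: "'a \<Rightarrow> nat"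
  assumes F: "(\<lambda>x. of_nat (F x)) \<in> L2_functions M" and G: "(\<lambda>x. of_nat (G x)) \<in> L2_functions M"
    and E: "{x \<in> space M. F x \<noteq> G x} \<in> sets M"
  shows "measure M {x \<in> space M. F x \<noteq> G x} \<le> (L2_dist M (\<lambda>x. of_nat (F x)) (\<lambda>x. of_nat (G x)))\<^sup>2"
proof -
  have "measure M {x \<in> space M. F x \<noteq> G x} = (LINT x|M. indicator {x \<in> space M. F x \<noteq> G x} x)"
    using E by simp
  also have "\<dots> \<le> (L2_dist M (\<lambda>x. of_nat (F x)) (\<lambda>x. of_nat (G x)))\<^sup>2"
    unfolding L2_dist_square
  proof (rule integral_mono)
    show "integrable M (indicator {x \<in> space M. F x \<noteq> G x} :: 'a \<Rightarrow> real)"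
      using E by (intro integrable_real_indicator) (auto simp: less_top[symmetric])
    show "integrable M (\<lambda>x. (cmod (of_nat (F x) - of_nat (G x)))\<^sup>2)" by (rule L2_diff_integrable[OF F G])
    fix x
    have "1 \<le> (cmod (of_nat (F x) - of_nat (G x)))\<^sup>2" if "F x \<noteq> G x"
    proof -
      have "of_nat (F x) - of_nat (G x) = (complex_of_real (real (F x) - real (G x)))" by simp
      then have "cmod (of_nat (F x) - of_nat (G x)) = \<bar>real (F x) - real (G x)\<bar>" by (metis norm_of_real)
      moreover have "1 \<le> \<bar>real (F x) - real (G x)\<bar>" using that by linarith
      ultimately show ?thesis using one_le_power[of "\<bar>real (F x) - real (G x)\<bar>" 2] by simp
    qed
    then show "indicator {x \<in> space M. F x \<noteq> G x} x \<le> (cmod (of_nat (F x) - of_nat (G x)))\<^sup>2"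
      by (auto simp: indicator_def)
  qed
  finally show ?thesis .
qed

section \<open>Words vary continuously in the weak topology\<close>

text \<open>
  The neighbourhood compares \<open>U\<^sub>S\<close> and \<open>U\<^sub>T\<close> on the functions \<open>F \<circ> T\<^sup>j\<close> for \<open>j < n\<close>. Replacing the
  \<open>i\<close> factors of \<open>S\<^sup>i\<close> one at a time by \<open>T\<close> then changes \<open>F \<circ> S\<^sup>i\<close> to \<open>F \<circ> T\<^sup>i\<close>, at a cost of
  \<open>\<eta>\<close> each, because \<open>S\<close> preserves the measure.
\<close>

lemma (in prob_space) itineraries_vary_continuously:
  fixes F :: "'a \<Rightarrow> nat"
  assumes T: "T \<in> mpt M" and F: "F \<in> measurable M (count_space UNIV)"
    and bound: "\<And>x. x \<in> space M \<Longrightarrow> F x \<le> r" and \<gamma>: "0 < \<gamma>"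
  shows "\<exists>V. openin (weak_topology M) V \<and> mpt_rel M `` {T} \<in> V \<and>
    (\<forall>c\<in>V. \<forall>S\<in>c. measure M {x \<in> space M. \<exists>i<n. F ((S ^^ i) x) \<noteq> F ((T ^^ i) x)} < \<gamma>)"
proof -
  define \<eta> where "\<eta> = \<gamma> / (real n * real n + 1)"
  have \<eta>: "0 < \<eta>" "real n * real n * \<eta> < \<gamma>"
  proof -
    have d: "0 < real n * real n + 1" by (simp add: add_nonneg_pos)
    then show "0 < \<eta>" using \<gamma> by (simp add: \<eta>_def)
    have "\<gamma> = (real n * real n + 1) * \<eta>" using d by (simp add: \<eta>_def)
    then show "real n * real n * \<eta> < \<gamma>" using \<open>0 < \<eta>\<close> by (simp add: algebra_simps)
  qed
  have comp_F: "(\<lambda>x. F (S x)) \<in> measurable M (count_space UNIV)" if "S \<in> mpt M" for S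
    by (rule measurable_compose[OF mpt_measurable[OF that] F])
  have neq_sets: "{x \<in> space M. F (S x) \<noteq> F (S' x)} \<in> sets M" if "S \<in> mpt M" "S' \<in> mpt M" for S S'
    by (rule sets_neq[OF comp_F[OF that(1)] comp_F[OF that(2)]])
  define f where "f j x = (of_nat (F ((T ^^ j) x)) :: complex)" for j x
  have f_L2: "(\<lambda>x. of_nat (F (S x))) \<in> L2_functions M" if S: "S \<in> mpt M" for S
  proof (rule bounded_L2[where C = "real r"])
    show "(\<lambda>x. of_nat (F (S x)) :: complex) \<in> borel_measurable M"
      by (rule measurable_compose[OF comp_F[OF S], where g = of_nat]) simp
    show "cmod (of_nat (F (S x))) \<le> real r" if "x \<in> space M" for x
      using bound[OF mpt_space[OF S that]] by simp
  qed
  have f: "f j \<in> L2_functions M" for j unfolding f_def[abs_def] by (rule f_L2[OF mpt_funpow[OF T]])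
  define V where "V = topspace (weak_topology M) \<inter> (\<Inter>j\<in>{..<n}. koopman_ball M (f j) T (sqrt \<eta>))"
  have "openin (weak_topology M) V"
  proof (cases "n = 0")
    case True
    then show ?thesis by (simp add: V_def)
  next
    case False
    then show ?thesis unfolding V_def using f T \<eta>
      by (intro openin_Int openin_topspace openin_Inter openin_koopman_ball) (auto intro: openin_koopman_ball)
  qed
  moreover have "mpt_rel M `` {T} \<in> V"
    unfolding V_def topspace_weak_topology koopman_ball_def
    using mpt_classesI[OF T] mpt_class_self[OF T] \<eta> by (auto simp: L2_dist_def intro!: bexI[of _ T])
  moreover have "measure M {x \<in> space M. \<exists>i<n. F ((S ^^ i) x) \<noteq> F ((T ^^ i) x)} < \<gamma>"
    if cV: "c \<in> V" and Sc: "S \<in> c" for c S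
  proof -
    have "c \<in> mpt_classes M" using cV unfolding V_def topspace_weak_topology by blast
    then have S: "S \<in> mpt M" using Sc by (rule mpt_classesE)
    have comp2: "(\<lambda>x. R (R' x)) \<in> mpt M" if "R \<in> mpt M" "R' \<in> mpt M" for R R'
      by (rule mpt_compose[OF that])
    note Tn = mpt_funpow[OF T] and Sn = mpt_funpow[OF S]
    have TjS: "(\<lambda>x. (T ^^ j) (S x)) \<in> mpt M" and TjT: "(\<lambda>x. (T ^^ j) (T x)) \<in> mpt M" for j
      by (rule comp2[OF Tn S], rule comp2[OF Tn T])
    have TjST: "{x \<in> space M. F ((T ^^ j) (S x)) \<noteq> F ((T ^^ j) (T x))} \<in> sets M" for j
      by (rule neq_sets[OF TjS TjT])
    have one: "measure M {x \<in> space M. F ((T ^^ j) (S x)) \<noteq> F ((T ^^ j) (T x))} \<le> \<eta>" if j: "j < n" for j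
    proof -
      have "c \<in> koopman_ball M (f j) T (sqrt \<eta>)" using cV j unfolding V_def by blast
      then have "L2_dist M (koopman S (f j)) (koopman T (f j)) < sqrt \<eta>"
        by (rule koopman_ball_dist[OF _ Sc f T])
      then have "(L2_dist M (koopman S (f j)) (koopman T (f j)))\<^sup>2 \<le> (sqrt \<eta>)\<^sup>2"
        by (intro power_mono L2_dist_nonneg) simp
      then have *: "(L2_dist M (\<lambda>x. of_nat (F ((T ^^ j) (S x)))) (\<lambda>x. of_nat (F ((T ^^ j) (T x)))))\<^sup>2 \<le> \<eta>"
        using \<eta> by (simp add: koopman_def comp_def f_def[abs_def])
      show ?thesis
        by (rule order_trans[OF measure_neq_le_L2_dist[OF f_L2[OF TjS[of j]] f_L2[OF TjT[of j]] TjST[of j]] *])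
    qed
    have "measure M {x \<in> space M. F ((T ^^ j) ((S ^^ i) x)) \<noteq> F ((T ^^ (j + i)) x)} \<le> real i * \<eta>"
      if "j + i \<le> n" for i j
      using that
    proof (induction i arbitrary: j)
      case 0
      then show ?case by simp
    next
      case (Suc i)
      define A where "A = {x \<in> space M. F ((T ^^ j) (S ((S ^^ i) x))) \<noteq> F ((T ^^ j) (T ((S ^^ i) x)))}"
      define B where "B = {x \<in> space M. F ((T ^^ Suc j) ((S ^^ i) x)) \<noteq> F ((T ^^ (Suc j + i)) x)}"
      have A: "A \<in> sets M" unfolding A_def by (rule neq_sets[OF comp2[OF TjS Sn] comp2[OF TjT Sn]])
      have B: "B \<in> sets M" unfolding B_def by (rule neq_sets[OF comp2[OF Tn Sn] Tn])
      have mA: "measure M A \<le> \<eta>"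
        unfolding A_def
        using mpt_measure_vimage[OF Sn, where P = "\<lambda>y. F ((T ^^ j) (S y)) \<noteq> F ((T ^^ j) (T y))", OF TjST]
          one[of j] Suc.prems by simp
      have mB: "measure M B \<le> real i * \<eta>" unfolding B_def using Suc.prems by (intro Suc.IH) simp
      have "{x \<in> space M. F ((T ^^ j) ((S ^^ Suc i) x)) \<noteq> F ((T ^^ (j + Suc i)) x)} \<subseteq> A \<union> B"
        unfolding A_def B_def by (auto simp: funpow_swap1)
      then have "measure M {x \<in> space M. F ((T ^^ j) ((S ^^ Suc i) x)) \<noteq> F ((T ^^ (j + Suc i)) x)} \<le> measure M (A \<union> B)"
        using A B by (intro finite_measure_mono) auto
      also have "\<dots> \<le> measure M A + measure M B" using A B by (rule measure_Un_le)
      finally show ?case using mA mB by (simp add: algebra_simps)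
    qed
    note tele = this
    have i: "measure M {x \<in> space M. F ((S ^^ i) x) \<noteq> F ((T ^^ i) x)} \<le> real n * \<eta>" if "i < n" for i
    proof -
      have "real i * \<eta> \<le> real n * \<eta>" using that \<eta> by (intro mult_right_mono) auto
      then show ?thesis using tele[of 0 i] that by simp
    qed
    have "{x \<in> space M. \<exists>i<n. F ((S ^^ i) x) \<noteq> F ((T ^^ i) x)} = (\<Union>i<n. {x \<in> space M. F ((S ^^ i) x) \<noteq> F ((T ^^ i) x)})"
      by auto
    also have "measure M \<dots> \<le> (\<Sum>i<n. measure M {x \<in> space M. F ((S ^^ i) x) \<noteq> F ((T ^^ i) x)})"
      by (rule measure_UNION_le) (simp_all add: neq_sets[OF Sn Tn])
    also have "\<dots> \<le> (\<Sum>i<n. real n * \<eta>)" by (intro sum_mono i) simp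
    also have "\<dots> < \<gamma>" using \<eta> by simp
    finally show ?thesis .
  qed
  ultimately show ?thesis by blast
qed

section \<open>Approximation by cells of the coordinate\<close>

lemma measurable_word:
  fixes c :: "nat \<Rightarrow> 'a \<Rightarrow> nat"
  assumes "\<And>t. c t \<in> measurable M (count_space UNIV)"
  shows "(\<lambda>x. map (\<lambda>t. c t x) [0..<n]) \<in> measurable M (count_space UNIV)"
proof (induction n)
  case (Suc n)
  have "(\<lambda>x. l @ [c n x]) \<in> measurable M (count_space UNIV)" for l
    by (rule measurable_compose[OF assms[of n]]) simp
  then have "(\<lambda>x. map (\<lambda>t. c t x) [0..<n] @ [c n x]) \<in> measurable M (count_space UNIV)"
    by (rule measurable_compose_countable[OF _ Suc])
  then show ?case by simp
qed simp

lemma sets_word: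
  fixes c :: "nat \<Rightarrow> 'a \<Rightarrow> nat"
  assumes "\<And>t. c t \<in> measurable M (count_space UNIV)"
  shows "{x \<in> space M. Q (map (\<lambda>t. c t x) [0..<n])} \<in> sets M"
  by (rule sets_Collect_count[OF measurable_word[OF assms]])

context uniform_coordinate
begin

lemma u_range: "x \<in> space M \<Longrightarrow> u x \<in> {0..<1}"
  using measurable_space[OF u_measurable] by simp

lemma measurable_cell: "(\<lambda>x. idx N (u x)) \<in> measurable M (count_space UNIV)"
  by (rule measurable_compose[OF u_measurable measurable_unit_intervalI[OF borel_measurable_idx]])

lemma sets_cell: "{x \<in> space M. P (idx N (u x))} \<in> sets M"
  by (rule sets_Collect_count[OF measurable_cell])

lemma cell_less: "0 < N \<Longrightarrow> x \<in> space M \<Longrightarrow> idx N (u x) < N"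
  using u_range idx_less by simp

lemma cell_div: "0 < L \<Longrightarrow> x \<in> space M \<Longrightarrow> idx (N * L) (u x) div L = idx N (u x)"
  using u_range idx_mult_div by simp

lemma sets_Collect_u:
  assumes "{y \<in> {0..<1}. P y} \<in> sets unit_interval"
  shows "{x \<in> space M. P (u x)} \<in> sets M"
proof -
  have "u -` {y \<in> {0..<1}. P y} \<inter> space M \<in> sets M" by (rule measurable_sets[OF u_measurable assms])
  moreover have "u -` {y \<in> {0..<1}. P y} \<inter> space M = {x \<in> space M. P (u x)}" using u_range by auto
  ultimately show ?thesis by (simp only:)
qed

lemma measure_u:
  assumes "{y \<in> {0..<1}. P y} \<in> sets unit_interval"
  shows "measure M {x \<in> space M. P (u x)} = measure unit_interval {y \<in> {0..<1}. P y}"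
proof -
  have "u -` {y \<in> {0..<1}. P y} \<inter> space M = {x \<in> space M. P (u x)}" using u_range by auto
  then have "emeasure (distr M unit_interval u) {y \<in> {0..<1}. P y} = emeasure M {x \<in> space M. P (u x)}"
    using emeasure_distr[OF u_measurable assms] by simp
  then show ?thesis unfolding u_distr by (simp add: measure_def)
qed

lemma measure_cell:
  assumes "0 < N" "j < N"
  shows "measure M {x \<in> space M. idx N (u x) = j} = 1 / real N"
proof -
  have "{y \<in> space unit_interval. idx N y = j} \<in> sets unit_interval"
    by (rule sets_Collect_count[OF measurable_unit_intervalI[OF borel_measurable_idx]])
  then show ?thesis using measure_u[of "\<lambda>y. idx N y = j"] measure_idx[OF assms] by simp
qed

lemma measure_cells:
  assumes K: "0 < K" and J: "J \<subseteq> {..<K}"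
  shows "measure M {x \<in> space M. idx K (u x) \<in> J} = real (card J) / real K"
proof -
  have fin: "finite J" using J by (rule finite_subset) simp
  have "{x \<in> space M. idx K (u x) \<in> J} = (\<Union>j\<in>J. {x \<in> space M. idx K (u x) = j})" by auto
  also have "measure M \<dots> = (\<Sum>j\<in>J. measure M {x \<in> space M. idx K (u x) = j})"
    using fin sets_cell by (intro finite_measure_finite_Union) (auto simp: disjoint_family_on_def)
  also have "\<dots> = (\<Sum>j\<in>J. 1 / real K)" using J by (intro sum.cong refl measure_cell K) auto
  finally show ?thesis by simp
qed

text \<open>The Borel sets of the line that unions of cells approximate. They turn out to be all Borel sets, as they form a sigma-algebra that contains the half-lines.\<close>

definition adic :: "real set \<Rightarrow> bool" where
  "adic D \<longleftrightarrow> D \<in> sets borel \<and>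
    (\<forall>e>0. \<exists>N>0. \<exists>J. measure M {x \<in> space M. (u x \<in> D) \<noteq> (idx N (u x) \<in> J)} < e)"

lemma sets_u:
  assumes "D \<in> sets borel"
  shows "{x \<in> space M. u x \<in> D} \<in> sets M"
proof (rule sets_Collect_u)
  have "D \<inter> {0..<1} \<in> sets borel" using assms by (rule sets.Int) simp
  moreover have "{y \<in> {0..<1}. y \<in> D} = D \<inter> {0..<1}" by blast
  ultimately show "{y \<in> {0..<1}. y \<in> D} \<in> sets unit_interval" unfolding sets_unit_interval by simp
qed

lemma sets_u_cell:
  "D \<in> sets borel \<Longrightarrow> {x \<in> space M. (u x \<in> D) \<noteq> (idx N (u x) \<in> J)} \<in> sets M"
  by (rule sets_Collect_xor[OF sets_u sets_cell])

lemma adic_lessThan: "adic {..<a}"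
  unfolding adic_def
proof (intro conjI allI impI)
  fix e :: real assume e: "0 < e"
  obtain N :: nat where N: "1 / e < real N" using reals_Archimedean2 by blast
  then have N0: "0 < N" using e by (metis divide_pos_pos less_trans of_nat_0_less_iff zero_less_one)
  define J where "J = {k. real k + 1 \<le> real N * a}"
  \<comment> \<open>the cell that contains \<open>a\<close>, the only one where the two sets can differ\<close>
  define k0 where "k0 = nat \<lfloor>real N * a\<rfloor>"
  have "{x \<in> space M. (u x \<in> {..<a}) \<noteq> (idx N (u x) \<in> J)} \<subseteq> {x \<in> space M. idx N (u x) \<in> {k0} \<inter> {..<N}}"
  proof
    fix x assume x: "x \<in> {x \<in> space M. (u x \<in> {..<a}) \<noteq> (idx N (u x) \<in> J)}"
    then have xs: "x \<in> space M" by blast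
    have b: "real (idx N (u x)) \<le> real N * u x" "real N * u x < real (idx N (u x)) + 1"
      using idx_bounds[of "u x" N] u_range[OF xs] by auto
    have "idx N (u x) \<notin> J"
    proof
      assume "idx N (u x) \<in> J"
      then have "real N * u x < real N * a" using b unfolding J_def by simp
      then have "u x < a" using N0 by simp
      with x \<open>idx N (u x) \<in> J\<close> show False by auto
    qed
    then have "u x < a" "real N * a < real (idx N (u x)) + 1" using x unfolding J_def by auto
    moreover then have "real N * u x < real N * a" using N0 by simp
    ultimately have "\<lfloor>real N * a\<rfloor> = int (idx N (u x))" using b by (intro floor_unique) auto
    then have "idx N (u x) = k0" by (simp add: k0_def)
    then show "x \<in> {x \<in> space M. idx N (u x) \<in> {k0} \<inter> {..<N}}" using xs cell_less[OF N0 xs] by simp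
  qed
  then have "measure M {x \<in> space M. (u x \<in> {..<a}) \<noteq> (idx N (u x) \<in> J)} \<le>
      measure M {x \<in> space M. idx N (u x) \<in> {k0} \<inter> {..<N}}"
    by (rule finite_measure_mono) (rule sets_cell)
  also have "\<dots> = real (card ({k0} \<inter> {..<N})) / real N" by (rule measure_cells[OF N0]) simp
  also have "\<dots> \<le> 1 / real N" using card_mono[of "{k0}" "{k0} \<inter> {..<N}"] by (intro divide_right_mono) auto
  also have "\<dots> < e" using N N0 e by (simp add: field_simps)
  finally show "\<exists>N>0. \<exists>J. measure M {x \<in> space M. (u x \<in> {..<a}) \<noteq> (idx N (u x) \<in> J)} < e"
    using N0 by blast
qed simp

lemma adic_Un:
  assumes D: "adic D" and E: "adic E"
  shows "adic (D \<union> E)"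
  unfolding adic_def
proof (intro conjI allI impI)
  have Db: "D \<in> sets borel" "E \<in> sets borel" using D E by (auto simp: adic_def)
  then show "D \<union> E \<in> sets borel" by blast
  fix e :: real assume "0 < e"
  then have e: "0 < e / 2" by simp
  obtain N1 J1 where 1: "0 < N1" "measure M {x \<in> space M. (u x \<in> D) \<noteq> (idx N1 (u x) \<in> J1)} < e / 2"
    using D e unfolding adic_def by blast
  obtain N2 J2 where 2: "0 < N2" "measure M {x \<in> space M. (u x \<in> E) \<noteq> (idx N2 (u x) \<in> J2)} < e / 2"
    using E e unfolding adic_def by blast
  define J where "J = {k. k div N2 \<in> J1 \<or> k div N1 \<in> J2}"
  let ?A = "{x \<in> space M. (u x \<in> D) \<noteq> (idx N1 (u x) \<in> J1)}"
  let ?B = "{x \<in> space M. (u x \<in> E) \<noteq> (idx N2 (u x) \<in> J2)}"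
  have "{x \<in> space M. (u x \<in> D \<union> E) \<noteq> (idx (N1 * N2) (u x) \<in> J)} \<subseteq> ?A \<union> ?B"
  proof
    fix x assume x: "x \<in> {x \<in> space M. (u x \<in> D \<union> E) \<noteq> (idx (N1 * N2) (u x) \<in> J)}"
    then have "idx (N1 * N2) (u x) div N2 = idx N1 (u x)" "idx (N1 * N2) (u x) div N1 = idx N2 (u x)"
      using cell_div[OF 2(1), of x N1] cell_div[OF 1(1), of x N2] by (simp_all add: mult.commute)
    then show "x \<in> ?A \<union> ?B" using x unfolding J_def by auto
  qed
  then have "measure M {x \<in> space M. (u x \<in> D \<union> E) \<noteq> (idx (N1 * N2) (u x) \<in> J)} \<le> measure M (?A \<union> ?B)"
    by (rule finite_measure_mono) (intro sets.Un sets_u_cell Db)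
  also have "\<dots> \<le> measure M ?A + measure M ?B" by (intro measure_Un_le sets_u_cell Db)
  also have "\<dots> < e" using 1 2 by simp
  finally show "\<exists>N>0. \<exists>J. measure M {x \<in> space M. (u x \<in> D \<union> E) \<noteq> (idx N (u x) \<in> J)} < e"
    using 1(1) 2(1) by (intro exI[of _ "N1 * N2"]) auto
qed

lemma adic_borel:
  assumes "D \<in> sets borel"
  shows "adic D"
proof -
  have "D \<in> sigma_sets UNIV (range lessThan)"
    using assms unfolding borel_Iio by (simp add: sets_measure_of)
  then show ?thesis
  proof induction
    case (Basic D)
    then show ?case using adic_lessThan by blast
  next
    case Empty
    have "measure M {x \<in> space M. (u x \<in> {}) \<noteq> (idx 1 (u x) \<in> {})} = 0" by simp
    then show ?case unfolding adic_def by (metis sets.empty_sets zero_less_one)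
  next
    case (Compl D)
    show ?case unfolding adic_def
    proof (intro conjI allI impI)
      show "UNIV - D \<in> sets borel" using Compl by (auto simp: adic_def)
      fix e :: real assume "0 < e"
      then obtain N J where N: "0 < N" "measure M {x \<in> space M. (u x \<in> D) \<noteq> (idx N (u x) \<in> J)} < e"
        using Compl(2) unfolding adic_def by blast
      have "{x \<in> space M. (u x \<in> UNIV - D) \<noteq> (idx N (u x) \<in> - J)} = {x \<in> space M. (u x \<in> D) \<noteq> (idx N (u x) \<in> J)}"
        by auto
      with N show "\<exists>N>0. \<exists>J. measure M {x \<in> space M. (u x \<in> UNIV - D) \<noteq> (idx N (u x) \<in> J)} < e"
        by (intro exI[of _ N] conjI exI[of _ "- J"]) simp_all
    qed
  next
    case (Union D)
    have Db: "D i \<in> sets borel" for i using Union by (auto simp: adic_def)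
    define E where "E n = (\<Union>i\<le>n. D i)" for n
    have Eb: "E n \<in> sets borel" for n unfolding E_def using Db by blast
    have adE: "adic (E n)" for n
    proof (induction n)
      case 0
      show ?case using Union(2)[of 0] by (simp add: E_def)
    next
      case (Suc n)
      have "E (Suc n) = E n \<union> D (Suc n)" by (auto simp: E_def atMost_Suc)
      then show ?case using adic_Un[OF Suc Union(2)[of "Suc n"]] by simp
    qed
    show ?case unfolding adic_def
    proof (intro conjI allI impI)
      show Ub: "(\<Union>i. D i) \<in> sets borel" using Db by blast
      fix e :: real assume "0 < e"
      then have e: "0 < e / 2" by simp
      define X where "X n = {x \<in> space M. u x \<in> E n}" for n
      have X: "X n \<in> sets M" for n unfolding X_def by (rule sets_u[OF Eb])
      have "incseq X" unfolding X_def E_def by (rule incseq_SucI) (auto simp: atMost_Suc)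
      then have "(\<lambda>n. measure M (X n)) \<longlonglongrightarrow> measure M (\<Union>n. X n)"
        using X by (intro finite_Lim_measure_incseq) auto
      then obtain n where n: "\<bar>measure M (X n) - measure M (\<Union>n. X n)\<bar> < e / 2"
        using e unfolding LIMSEQ_def dist_real_def by blast
      have UX: "(\<Union>n. X n) = {x \<in> space M. u x \<in> (\<Union>i. D i)}" unfolding X_def E_def by auto
      obtain N J where N: "0 < N" "measure M {x \<in> space M. (u x \<in> E n) \<noteq> (idx N (u x) \<in> J)} < e / 2"
        using adE[of n] e unfolding adic_def by blast
      let ?A = "{x \<in> space M. (u x \<in> E n) \<noteq> (idx N (u x) \<in> J)}" and ?B = "(\<Union>n. X n) - X n"
      have "{x \<in> space M. (u x \<in> (\<Union>i. D i)) \<noteq> (idx N (u x) \<in> J)} \<subseteq> ?A \<union> ?B"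
        unfolding UX unfolding X_def E_def by auto
      then have "measure M {x \<in> space M. (u x \<in> (\<Union>i. D i)) \<noteq> (idx N (u x) \<in> J)} \<le> measure M (?A \<union> ?B)"
        using X by (intro finite_measure_mono sets.Un sets_u_cell Eb) auto
      also have "\<dots> \<le> measure M ?A + measure M ?B"
        using X by (intro measure_Un_le sets_u_cell Eb) auto
      also have "measure M ?B = measure M (\<Union>n. X n) - measure M (X n)"
        using X by (intro finite_measure_Diff) auto
      finally have "measure M {x \<in> space M. (u x \<in> (\<Union>i. D i)) \<noteq> (idx N (u x) \<in> J)} < e"
        using n N(2) by linarith
      then show "\<exists>N>0. \<exists>J. measure M {x \<in> space M. (u x \<in> (\<Union>i. D i)) \<noteq> (idx N (u x) \<in> J)} < e"
        using N(1) by blast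
    qed
  qed
qed

lemma set_approximation:
  assumes C: "C \<in> sets M" and e: "0 < e"
  shows "\<exists>N>0. \<exists>J. measure M {x \<in> space M. (x \<in> C) \<noteq> (idx N (u x) \<in> J)} < e"
proof -
  obtain D where D: "D \<in> sets borel" and eq: "AE x in M. x \<in> C \<longleftrightarrow> u x \<in> D" using u_generates[OF C] by blast
  obtain N J where N: "0 < N" "measure M {x \<in> space M. (u x \<in> D) \<noteq> (idx N (u x) \<in> J)} < e"
    using adic_borel[OF D] e unfolding adic_def by blast
  have s: "{x \<in> space M. (x \<in> C) \<noteq> (idx N (u x) \<in> J)} \<in> sets M"
    using C by (intro sets_Collect_xor sets_cell) simp
  have "measure M {x \<in> space M. (x \<in> C) \<noteq> (idx N (u x) \<in> J)} = measure M {x \<in> space M. (u x \<in> D) \<noteq> (idx N (u x) \<in> J)}"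
  proof (rule measure_eq_AE[OF _ s sets_u_cell[OF D]])
    show "AE x in M. x \<in> {x \<in> space M. (x \<in> C) \<noteq> (idx N (u x) \<in> J)} \<longleftrightarrow>
        x \<in> {x \<in> space M. (u x \<in> D) \<noteq> (idx N (u x) \<in> J)}"
      using eq by eventually_elim simp
  qed
  with N show ?thesis by (intro exI[of _ N] conjI exI[of _ J]) simp_all
qed

text \<open>
  Adds the values one by one. Both uses rely on the control of the values of \<open>\<phi>\<close>: it bounds the error in the mean square, and
  it makes \<open>\<phi>\<close> a colouring of cells by cells.
\<close>

lemma finite_valued_approximation:
  fixes F :: "'a \<Rightarrow> 'c"
  assumes F: "F \<in> measurable M (count_space UNIV)" and R: "finite R" and e: "0 < e"
  shows "\<exists>N>0. \<exists>\<phi>. range \<phi> \<subseteq> insert c0 R \<and> measure M {x \<in> space M. F x \<in> R \<and> F x \<noteq> \<phi> (idx N (u x))} < e"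
  using R e
proof (induction arbitrary: e)
  case empty
  then show ?case by (intro exI[of _ 1] conjI exI[of _ "\<lambda>_. c0"]) simp_all
next
  case (insert c R)
  have e2: "0 < e / 2" using insert.prems by simp
  obtain N1 \<phi>1 where 1: "0 < N1" "range \<phi>1 \<subseteq> insert c0 R"
    "measure M {x \<in> space M. F x \<in> R \<and> F x \<noteq> \<phi>1 (idx N1 (u x))} < e / 2"
    using insert.IH[OF e2] by blast
  define C where "C = F -` {c} \<inter> space M"
  have C: "C \<in> sets M" unfolding C_def by (rule measurable_sets[OF F]) simp
  obtain N2 J where 2: "0 < N2" "measure M {x \<in> space M. (x \<in> C) \<noteq> (idx N2 (u x) \<in> J)} < e / 2"
    using set_approximation[OF C e2] by blast
  define \<phi> where "\<phi> k = (if k div N1 \<in> J then c else \<phi>1 (k div N2))" for k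
  let ?A = "{x \<in> space M. F x \<in> R \<and> F x \<noteq> \<phi>1 (idx N1 (u x))}"
  let ?B = "{x \<in> space M. (x \<in> C) \<noteq> (idx N2 (u x) \<in> J)}"
  have pair: "(\<lambda>x. (F x, \<phi>1 (idx N1 (u x)))) \<in> measurable M (count_space UNIV)"
    by (rule measurable_compose_countable[OF _ measurable_cell, where f = "\<lambda>k x. (F x, \<phi>1 k)"])
      (rule measurable_compose[OF F], simp)
  have A: "?A \<in> sets M" using sets_Collect_count[OF pair, of "\<lambda>p. fst p \<in> R \<and> fst p \<noteq> snd p"] by simp
  have B: "?B \<in> sets M" using C by (intro sets_Collect_xor sets_cell) simp
  have "{x \<in> space M. F x \<in> insert c R \<and> F x \<noteq> \<phi> (idx (N1 * N2) (u x))} \<subseteq> ?A \<union> ?B"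
  proof
    fix x assume x: "x \<in> {x \<in> space M. F x \<in> insert c R \<and> F x \<noteq> \<phi> (idx (N1 * N2) (u x))}"
    then have "idx (N1 * N2) (u x) div N2 = idx N1 (u x)" "idx (N1 * N2) (u x) div N1 = idx N2 (u x)"
      using cell_div[OF 2(1), of x N1] cell_div[OF 1(1), of x N2] by (simp_all add: mult.commute)
    then show "x \<in> ?A \<union> ?B" using x unfolding \<phi>_def C_def by (auto split: if_splits)
  qed
  then have "measure M {x \<in> space M. F x \<in> insert c R \<and> F x \<noteq> \<phi> (idx (N1 * N2) (u x))} \<le> measure M (?A \<union> ?B)"
    using A B by (intro finite_measure_mono) auto
  also have "\<dots> \<le> measure M ?A + measure M ?B" using A B by (rule measure_Un_le)
  also have "\<dots> < e" using 1 2 by simp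
  finally have "measure M {x \<in> space M. F x \<in> insert c R \<and> F x \<noteq> \<phi> (idx (N1 * N2) (u x))} < e" .
  moreover have "range \<phi> \<subseteq> insert c0 (insert c R)" using 1(2) by (auto simp: \<phi>_def)
  ultimately show ?case using 1(1) 2(1) by (intro exI[of _ "N1 * N2"] conjI exI[of _ \<phi>]) simp_all
qed

lemma step_function_measurable: "(\<lambda>x. (\<phi> :: nat \<Rightarrow> complex) (idx N (u x))) \<in> borel_measurable M"
  by (rule measurable_compose[OF measurable_cell]) simp

lemma step_function_L2:
  assumes "0 < N"
  shows "(\<lambda>x. (\<phi> :: nat \<Rightarrow> complex) (idx N (u x))) \<in> L2_functions M"
proof (rule bounded_L2[OF step_function_measurable])
  fix x assume "x \<in> space M"
  then show "cmod (\<phi> (idx N (u x))) \<le> (\<Sum>k<N. cmod (\<phi> k))"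
    using cell_less[OF assms] by (intro member_le_sum) auto
qed

lemma step_functions_dense:
  assumes f: "f \<in> L2_functions M" and e: "0 < e"
  shows "\<exists>N>0. \<exists>\<phi>. L2_dist M f (\<lambda>x. \<phi> (idx N (u x))) < e"
proof -
  have fm: "f \<in> borel_measurable M" by (rule L2_measurable[OF f])
  obtain s where s: "\<And>i. simple_function M (s i)" "\<And>x. x \<in> space M \<Longrightarrow> (\<lambda>i. s i x) \<longlonglongrightarrow> f x"
    "\<And>i x. x \<in> space M \<Longrightarrow> dist (s i x) 0 \<le> 2 * dist (f x) 0"
    using borel_measurable_implies_sequence_metric[OF fm, of 0] by blast
  have sm: "s i \<in> borel_measurable M" for i by (rule borel_measurable_simple_function[OF s(1)])
  have lim: "(\<lambda>i. LINT x|M. (cmod (f x - s i x))\<^sup>2) \<longlonglongrightarrow> (LINT x|M. 0)"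
  proof (rule integral_dominated_convergence[where w = "\<lambda>x. 9 * (cmod (f x))\<^sup>2"])
    show "integrable M (\<lambda>x. 9 * (cmod (f x))\<^sup>2)" using f by (simp add: L2_functions_def)
    show "AE x in M. (\<lambda>i. (cmod (f x - s i x))\<^sup>2) \<longlonglongrightarrow> 0"
    proof (rule AE_I2)
      fix x assume "x \<in> space M"
      then have "(\<lambda>i. (cmod (f x - s i x))\<^sup>2) \<longlonglongrightarrow> (cmod (f x - f x))\<^sup>2"
        by (intro tendsto_intros s(2))
      then show "(\<lambda>i. (cmod (f x - s i x))\<^sup>2) \<longlonglongrightarrow> 0" by simp
    qed
    fix i
    show "AE x in M. norm ((cmod (f x - s i x))\<^sup>2) \<le> 9 * (cmod (f x))\<^sup>2"
    proof (rule AE_I2)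
      fix x assume "x \<in> space M"
      then have "cmod (f x - s i x) \<le> 3 * cmod (f x)"
        using s(3)[of x i] norm_triangle_ineq4[of "f x" "s i x"] by simp
      then have "(cmod (f x - s i x))\<^sup>2 \<le> (3 * cmod (f x))\<^sup>2" by (intro power_mono) auto
      then show "norm ((cmod (f x - s i x))\<^sup>2) \<le> 9 * (cmod (f x))\<^sup>2" by (simp add: power_mult_distrib)
    qed
    show "(\<lambda>x. (cmod (f x - s i x))\<^sup>2) \<in> borel_measurable M" using fm sm[of i] by measurable
  qed simp
  have "0 < (e / 2)\<^sup>2" using e by simp
  then obtain i where "norm ((LINT x|M. (cmod (f x - s i x))\<^sup>2) - (LINT x|M. 0)) < (e / 2)\<^sup>2"
    using LIMSEQ_D[OF lim] by blast
  then have i: "\<bar>LINT x|M. (cmod (f x - s i x))\<^sup>2\<bar> < (e / 2)\<^sup>2" by simp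
  then have "(L2_dist M f (s i))\<^sup>2 < (e / 2)\<^sup>2" unfolding L2_dist_square by linarith
  then have near: "L2_dist M f (s i) < e / 2" by (rule power_less_imp_less_base) (use e in simp)
  define R where "R = s i ` space M"
  have R: "finite R" unfolding R_def using s(1)[of i] by (simp add: simple_function_def)
  define B where "B = (\<Sum>r\<in>R. cmod r)"
  have B: "cmod r \<le> B" if "r \<in> insert 0 R" for r
    using that R unfolding B_def by (auto intro: member_le_sum intro!: sum_nonneg)
  have B0: "0 \<le> B" using B[of 0] by simp
  have pos: "0 < (e / 2)\<^sup>2 / ((2 * B)\<^sup>2 + 1)" using e by (intro divide_pos_pos add_nonneg_pos) auto
  then obtain N \<phi> where N: "0 < N" "range \<phi> \<subseteq> insert 0 R"
    "measure M {x \<in> space M. s i x \<in> R \<and> s i x \<noteq> \<phi> (idx N (u x))} < (e / 2)\<^sup>2 / ((2 * B)\<^sup>2 + 1)"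
    using finite_valued_approximation[OF measurable_simple_function[OF s(1)[of i]] R pos, of 0] by blast
  define E where "E = {x \<in> space M. s i x \<in> R \<and> s i x \<noteq> \<phi> (idx N (u x))}"
  have EE: "E = {x \<in> space M. s i x \<noteq> \<phi> (idx N (u x))}" by (auto simp: E_def R_def)
  have E: "E \<in> sets M"
    unfolding EE using sm[of i] step_function_measurable[of \<phi> N] by measurable
  have sL2: "s i \<in> L2_functions M"
    by (rule bounded_L2[OF sm, of _ B]) (rule B, simp add: R_def)
  have \<phi>L2: "(\<lambda>x. \<phi> (idx N (u x))) \<in> L2_functions M" by (rule step_function_L2[OF N(1)])
  have "(L2_dist M (s i) (\<lambda>x. \<phi> (idx N (u x))))\<^sup>2 \<le> (2 * B)\<^sup>2 * measure M E"
  proof (rule L2_dist_bounded_le[OF sL2 \<phi>L2 _ E])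
    fix x assume x: "x \<in> space M"
    have in_R: "s i x \<in> insert 0 R" "\<phi> (idx N (u x)) \<in> insert 0 R" using x N(2) unfolding R_def by blast+
    have "cmod (s i x) \<le> B" "cmod (\<phi> (idx N (u x))) \<le> B" by (rule B[OF in_R(1)], rule B[OF in_R(2)])
    then show "cmod (s i x - \<phi> (idx N (u x))) \<le> 2 * B"
      using norm_triangle_ineq4[of "s i x" "\<phi> (idx N (u x))"] by linarith
  qed (auto simp: EE)
  also have "\<dots> \<le> ((2 * B)\<^sup>2 + 1) * measure M E" by (simp add: algebra_simps)
  also have "\<dots> < (e / 2)\<^sup>2"
  proof -
    have p: "0 < (2 * B)\<^sup>2 + 1" by (intro add_nonneg_pos) auto
    show ?thesis using N(3) unfolding E_def[symmetric] pos_less_divide_eq[OF p] by (simp only: mult.commute)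
  qed
  finally have "L2_dist M (s i) (\<lambda>x. \<phi> (idx N (u x))) < e / 2"
    by (rule power_less_imp_less_base) (use e in simp)
  then have "L2_dist M f (\<lambda>x. \<phi> (idx N (u x))) < e"
    using L2_dist_triangle[OF f sL2 \<phi>L2] near by linarith
  with N(1) show ?thesis by blast
qed

text \<open>
  A square-integrable function is close to a step function \<open>\<phi> \<circ> idx N \<circ> u\<close>. As Koopman operators are isometries,
  \<open>U\<^sub>S f\<close> is close to \<open>U\<^bsub>S0\<^esub> f\<close> once \<open>S\<close> and \<open>S0\<close> send most points to the same cell.
\<close>

lemma weak_neighbourhood_by_cells:
  assumes W: "openin (weak_topology M) W" and S0: "S0 \<in> mpt M" and cW: "mpt_rel M `` {S0} \<in> W"
  shows "\<exists>N>0. \<exists>\<eta>>0. \<forall>S\<in>mpt M. measure M {x \<in> space M. idx N (u (S x)) \<noteq> idx N (u (S0 x))} < \<eta> \<longrightarrow>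
    mpt_rel M `` {S} \<in> W"
proof -
  have neq_sets: "{x \<in> space M. idx N (u (S x)) \<noteq> idx N' (u (S' x))} \<in> sets M"
    if "S \<in> mpt M" "S' \<in> mpt M" for S S' N N'
    by (rule sets_neq[OF measurable_compose[OF mpt_measurable[OF that(1)] measurable_cell]
      measurable_compose[OF mpt_measurable[OF that(2)] measurable_cell]])
  have "generate_topology_on {koopman_ball M f T e | f T e. f \<in> L2_functions M \<and> T \<in> mpt M \<and> e > 0} W"
    using W unfolding weak_topology_koopman_balls openin_topology_generated_by_iff .
  then show ?thesis using cW
  proof induction
    case Empty
    then show ?case by simp
  next
    case (Int V W)
    obtain N1 \<eta>1 where 1: "0 < N1" "0 < \<eta>1"
      "\<And>S. S \<in> mpt M \<Longrightarrow> measure M {x \<in> space M. idx N1 (u (S x)) \<noteq> idx N1 (u (S0 x))} < \<eta>1 \<Longrightarrow> mpt_rel M `` {S} \<in> V"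
      using Int by blast
    obtain N2 \<eta>2 where 2: "0 < N2" "0 < \<eta>2"
      "\<And>S. S \<in> mpt M \<Longrightarrow> measure M {x \<in> space M. idx N2 (u (S x)) \<noteq> idx N2 (u (S0 x))} < \<eta>2 \<Longrightarrow> mpt_rel M `` {S} \<in> W"
      using Int by blast
    show ?case
    proof (intro exI[of _ "N1 * N2"] exI[of _ "min \<eta>1 \<eta>2"] conjI ballI impI)
      show "0 < N1 * N2" "0 < min \<eta>1 \<eta>2" using 1 2 by simp_all
      fix S assume S: "S \<in> mpt M"
        and lt: "measure M {x \<in> space M. idx (N1 * N2) (u (S x)) \<noteq> idx (N1 * N2) (u (S0 x))} < min \<eta>1 \<eta>2"
      have sp: "S x \<in> space M" "S0 x \<in> space M" if "x \<in> space M" for x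
        using mpt_space[OF S that] mpt_space[OF S0 that] .
      have "{x \<in> space M. idx N1 (u (S x)) \<noteq> idx N1 (u (S0 x))} \<subseteq>
          {x \<in> space M. idx (N1 * N2) (u (S x)) \<noteq> idx (N1 * N2) (u (S0 x))}"
      proof -
        have "idx N1 (u (S x)) = idx N1 (u (S0 x))" if x: "x \<in> space M" and eq: "idx (N1 * N2) (u (S x)) = idx (N1 * N2) (u (S0 x))" for x
          using cell_div[OF 2(1) sp(1)[OF x], of N1] cell_div[OF 2(1) sp(2)[OF x], of N1] eq by simp
        then show ?thesis by blast
      qed
      from finite_measure_mono[OF this neq_sets[OF S S0]]
      have "measure M {x \<in> space M. idx N1 (u (S x)) \<noteq> idx N1 (u (S0 x))} < \<eta>1"
        using lt by linarith
      then have V: "mpt_rel M `` {S} \<in> V" by (rule 1(3)[OF S])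
      have "{x \<in> space M. idx N2 (u (S x)) \<noteq> idx N2 (u (S0 x))} \<subseteq>
          {x \<in> space M. idx (N1 * N2) (u (S x)) \<noteq> idx (N1 * N2) (u (S0 x))}"
      proof -
        have "idx N2 (u (S x)) = idx N2 (u (S0 x))" if x: "x \<in> space M" and eq: "idx (N1 * N2) (u (S x)) = idx (N1 * N2) (u (S0 x))" for x
          using cell_div[OF 1(1) sp(1)[OF x], of N2, unfolded mult.commute[of N2 N1]] cell_div[OF 1(1) sp(2)[OF x], of N2, unfolded mult.commute[of N2 N1]] eq by simp
        then show ?thesis by blast
      qed
      from finite_measure_mono[OF this neq_sets[OF S S0]]
      have "measure M {x \<in> space M. idx N2 (u (S x)) \<noteq> idx N2 (u (S0 x))} < \<eta>2"
        using lt by linarith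
      then have "mpt_rel M `` {S} \<in> W" by (rule 2(3)[OF S])
      with V show "mpt_rel M `` {S} \<in> V \<inter> W" by blast
    qed
  next
    case (UN \<W>)
    then obtain V where V: "V \<in> \<W>" "mpt_rel M `` {S0} \<in> V" by blast
    then show ?case using UN.IH[OF V] by (meson UnionI)
  next
    case (Basis W)
    then obtain f T e where W: "W = koopman_ball M f T e" and f: "f \<in> L2_functions M" and T: "T \<in> mpt M" and e: "0 < e"
      by blast
    define d where "d = (e - L2_dist M (koopman S0 f) (koopman T f)) / 3"
    have d: "0 < d"
      using koopman_ball_dist[OF _ mpt_class_self[OF S0] f T, of e] Basis W by (simp add: d_def)
    obtain N \<phi> where N: "0 < N" and near: "L2_dist M f (\<lambda>x. \<phi> (idx N (u x))) < d"
      using step_functions_dense[OF f d] by blast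
    let ?h = "\<lambda>x. \<phi> (idx N (u x))"
    have h: "?h \<in> L2_functions M" by (rule step_function_L2[OF N])
    define B where "B = (\<Sum>k<N. cmod (\<phi> k))"
    have B: "cmod (\<phi> k) \<le> B" if "k < N" for k using that unfolding B_def by (intro member_le_sum) auto
    define \<eta> where "\<eta> = d\<^sup>2 / ((2 * B)\<^sup>2 + 1)"
    have p: "0 < (2 * B)\<^sup>2 + 1" by (intro add_nonneg_pos) auto
    have \<eta>: "0 < \<eta>" unfolding \<eta>_def using d p by simp
    have "mpt_rel M `` {S} \<in> W"
      if S: "S \<in> mpt M" and lt: "measure M {x \<in> space M. idx N (u (S x)) \<noteq> idx N (u (S0 x))} < \<eta>" for S
    proof -
      let ?E = "{x \<in> space M. idx N (u (S x)) \<noteq> idx N (u (S0 x))}"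
      note kL = koopman_L2[OF S f] koopman_L2[OF S h] koopman_L2[OF S0 f] koopman_L2[OF S0 h] koopman_L2[OF T f]
      have "(L2_dist M (koopman S ?h) (koopman S0 ?h))\<^sup>2 \<le> (2 * B)\<^sup>2 * measure M ?E"
      proof (rule L2_dist_bounded_le[OF kL(2) kL(4) _ neq_sets[OF S S0]])
        fix x assume x: "x \<in> space M"
        have "cmod (\<phi> (idx N (u (S x)))) \<le> B" "cmod (\<phi> (idx N (u (S0 x)))) \<le> B"
          by (intro B cell_less[OF N] mpt_space[OF S x] mpt_space[OF S0 x])+
        then show "cmod (koopman S ?h x - koopman S0 ?h x) \<le> 2 * B"
          using norm_triangle_ineq4[of "\<phi> (idx N (u (S x)))" "\<phi> (idx N (u (S0 x)))"] by (simp add: koopman_def)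
      qed (auto simp: koopman_def)
      also have "\<dots> \<le> ((2 * B)\<^sup>2 + 1) * measure M ?E" by (simp add: algebra_simps)
      also have "\<dots> < d\<^sup>2"
        using lt unfolding \<eta>_def pos_less_divide_eq[OF p] by (simp only: mult.commute)
      finally have mid: "L2_dist M (koopman S ?h) (koopman S0 ?h) < d"
        by (rule power_less_imp_less_base) (use d in simp)
      have "L2_dist M (koopman S f) (koopman T f) \<le>
          L2_dist M (koopman S f) (koopman S0 f) + L2_dist M (koopman S0 f) (koopman T f)"
        by (rule L2_dist_triangle[OF kL(1) kL(3) kL(5)])
      moreover have "L2_dist M (koopman S f) (koopman S0 f) \<le>
          L2_dist M (koopman S f) (koopman S ?h) + L2_dist M (koopman S ?h) (koopman S0 f)"
        by (rule L2_dist_triangle[OF kL(1) kL(2) kL(3)])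
      moreover have "L2_dist M (koopman S ?h) (koopman S0 f) \<le>
          L2_dist M (koopman S ?h) (koopman S0 ?h) + L2_dist M (koopman S0 ?h) (koopman S0 f)"
        by (rule L2_dist_triangle[OF kL(2) kL(4) kL(3)])
      moreover have "L2_dist M (koopman S f) (koopman S ?h) < d"
        using near L2_dist_koopman[OF S f h] by simp
      moreover have "L2_dist M (koopman S0 ?h) (koopman S0 f) < d"
        using near L2_dist_koopman[OF S0 h f] L2_dist_commute[of M ?h f] by simp
      moreover have "3 * d = e - L2_dist M (koopman S0 f) (koopman T f)" by (simp add: d_def)
      ultimately have "L2_dist M (koopman S f) (koopman T f) < e" using mid by linarith
      then show ?thesis
        unfolding W koopman_ball_def using mpt_classesI[OF S] mpt_class_self[OF S] by blast
    qed
    with N \<eta> show ?case by blast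
  qed
qed

end

context uniform_coordinate
begin

section \<open>Density of transformations with exponentially many words\<close>

text \<open>
  Up to small measure, the target cell \<open>F x\<close> is a function \<open>\<psi>\<close> of the fine cell of \<open>x\<close>. Since \<open>S\<close> preserves the measure, the fibres of \<open>\<psi>\<close>
  have almost the same sizes as those of \<open>k \<mapsto> k div L\<close>, so few cells are mismatched by the best permutation.
\<close>

lemma permutation_approximation:
  assumes S: "S \<in> mpt M" and N: "0 < N" and \<eta>: "0 < \<eta>"
  shows "\<exists>L \<pi>. 0 < L \<and> even L \<and> \<pi> permutes {..<N * L} \<and>
    measure M {x \<in> space M. idx N (u (S x)) \<noteq> \<pi> (idx (N * L) (u x)) div L} < \<eta>"
proof -
  define F where "F x = idx N (u (S x))" for x
  have Fm: "F \<in> measurable M (count_space UNIV)"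
    unfolding F_def[abs_def] by (rule measurable_compose[OF mpt_measurable[OF S] measurable_cell])
  have F_less: "F x < N" if "x \<in> space M" for x
    unfolding F_def by (rule cell_less[OF N mpt_space[OF S that]])
  have F_meas: "measure M {x \<in> space M. F x = j} = 1 / real N" if "j < N" for j
    using mpt_measure_vimage[OF S, of "\<lambda>x. idx N (u x) = j"] sets_cell measure_cell[OF N that]
    by (simp add: F_def)
  have "0 < \<eta> / 2" using \<eta> by simp
  then obtain N' \<phi> where N': "0 < N'" "range \<phi> \<subseteq> insert 0 {..<N}"
    and near: "measure M {x \<in> space M. F x \<in> {..<N} \<and> F x \<noteq> \<phi> (idx N' (u x))} < \<eta> / 2"
    using finite_valued_approximation[OF Fm, of "{..<N}" "\<eta> / 2" 0] by blast
  define L where "L = 2 * N'"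
  \<comment> \<open>A common refinement of the \<open>N\<close> cells and the \<open>N'\<close> cells. The factor 2
    in \<open>L\<close> makes their number even, so that no cell contains points of both colours.\<close>
  define K where "K = N * L"
  have L: "0 < L" and K: "0 < K" using N N' by (simp_all add: L_def K_def)
  define \<psi> where "\<psi> k = \<phi> (k div (2 * N))" for k
  have \<psi>_cell: "\<psi> (idx K (u x)) = \<phi> (idx N' (u x))" if "x \<in> space M" for x
  proof -
    have "K = N' * (2 * N)" by (simp add: K_def L_def)
    then show ?thesis using cell_div[of "2 * N" x N'] N that by (simp add: \<psi>_def)
  qed
  have \<psi>_less: "\<psi> k < N" for k
  proof -
    have "\<phi> (k div (2 * N)) \<in> insert 0 {..<N}" using N'(2) by blast
    then show ?thesis using N by (auto simp: \<psi>_def)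
  qed
  have neq: "{x \<in> space M. F x \<noteq> \<psi> (idx K (u x))} \<in> sets M"
    by (rule sets_neq[OF Fm measurable_compose[OF measurable_cell]]) simp
  have near': "measure M {x \<in> space M. F x \<noteq> \<psi> (idx K (u x))} < \<eta> / 2"
  proof -
    have "{x \<in> space M. F x \<noteq> \<psi> (idx K (u x))} = {x \<in> space M. F x \<in> {..<N} \<and> F x \<noteq> \<phi> (idx N' (u x))}"
      using \<psi>_cell F_less by auto
    then show ?thesis using near by simp
  qed
  obtain \<pi> where \<pi>: "\<pi> permutes {..<K}" and fibres: "\<And>j. card {k\<in>{..<K}. \<psi> k = j \<and> \<pi> k div L \<noteq> j} \<le>
      card {k\<in>{..<K}. \<psi> k = j} - card {k\<in>{..<K}. k div L = j}"
    using permutation_matching_fibres[of "{..<K}" \<psi> "\<lambda>k. k div L"] by blast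
  define D where "D j = {x \<in> space M. \<psi> (idx K (u x)) = j \<and> F x \<noteq> j}" for j
  have D: "D j \<in> sets M" for j
  proof -
    have "D j = {x \<in> space M. \<psi> (idx K (u x)) = j} \<inter> {x \<in> space M. F x \<noteq> \<psi> (idx K (u x))}"
      by (auto simp: D_def)
    then show ?thesis by (simp only:) (rule sets.Int[OF sets_cell neq])
  qed
  have fibre: "real (card {k\<in>{..<K}. \<psi> k = j \<and> \<pi> k div L \<noteq> j}) / real K \<le> measure M (D j)" if j: "j < N" for j
  proof -
    have c1: "real (card {k\<in>{..<K}. \<psi> k = j}) / real K = measure M {x \<in> space M. \<psi> (idx K (u x)) = j}"
    proof -
      have eq: "{x \<in> space M. idx K (u x) \<in> {k\<in>{..<K}. \<psi> k = j}} = {x \<in> space M. \<psi> (idx K (u x)) = j}"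
        using cell_less[OF K] by auto
      have "{k\<in>{..<K}. \<psi> k = j} \<subseteq> {..<K}" by blast
      from measure_cells[OF K this] show ?thesis unfolding eq by (rule sym)
    qed
    have c2: "real (card {k\<in>{..<K}. k div L = j}) / real K = 1 / real N"
    proof -
      have eq: "{x \<in> space M. idx K (u x) \<in> {k\<in>{..<K}. k div L = j}} = {x \<in> space M. idx N (u x) = j}"
        using cell_less[OF K] cell_div[OF L, of _ N] by (auto simp: K_def)
      have "{k\<in>{..<K}. k div L = j} \<subseteq> {..<K}" by blast
      from measure_cells[OF K this] show ?thesis unfolding eq measure_cell[OF N j] by (rule sym)
    qed
    have "measure M {x \<in> space M. \<psi> (idx K (u x)) = j} \<le> measure M ({x \<in> space M. F x = j} \<union> D j)"
    proof (rule finite_measure_mono)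
      show "{x \<in> space M. F x = j} \<union> D j \<in> sets M" by (intro sets.Un sets_Collect_count[OF Fm] D)
    qed (auto simp: D_def)
    also have "\<dots> \<le> measure M {x \<in> space M. F x = j} + measure M (D j)"
      by (intro measure_Un_le sets_Collect_count[OF Fm] D)
    finally have le: "real (card {k\<in>{..<K}. \<psi> k = j}) / real K - real (card {k\<in>{..<K}. k div L = j}) / real K \<le> measure M (D j)"
      using c1 c2 F_meas[OF j] by simp
    have "real (card {k\<in>{..<K}. \<psi> k = j \<and> \<pi> k div L \<noteq> j}) / real K \<le>
        real (card {k\<in>{..<K}. \<psi> k = j} - card {k\<in>{..<K}. k div L = j}) / real K"
      using fibres[of j] by (intro divide_right_mono) auto
    also have "\<dots> \<le> measure M (D j)"
    proof (cases "card {k\<in>{..<K}. k div L = j} \<le> card {k\<in>{..<K}. \<psi> k = j}")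
      case True
      then show ?thesis using le by (simp add: of_nat_diff diff_divide_distrib)
    qed simp
    finally show ?thesis .
  qed
  define E where "E = {k\<in>{..<K}. \<pi> k div L \<noteq> \<psi> k}"
  have "E = (\<Union>j<N. {k\<in>{..<K}. \<psi> k = j \<and> \<pi> k div L \<noteq> j})"
    using \<psi>_less by (auto simp: E_def)
  then have "card E \<le> (\<Sum>j<N. card {k\<in>{..<K}. \<psi> k = j \<and> \<pi> k div L \<noteq> j})"
    by (simp only:) (rule card_UN_le, simp)
  then have "real (card E) / real K \<le> (\<Sum>j<N. real (card {k\<in>{..<K}. \<psi> k = j \<and> \<pi> k div L \<noteq> j}) / real K)"
    unfolding sum_divide_distrib[symmetric] of_nat_sum[symmetric]
    by (intro divide_right_mono) (simp_all only: of_nat_le_iff of_nat_0_le_iff)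
  also have "\<dots> \<le> (\<Sum>j<N. measure M (D j))" by (intro sum_mono fibre) simp
  also have "\<dots> = measure M (\<Union>j<N. D j)"
  proof (rule finite_measure_finite_Union[symmetric])
    show "D ` {..<N} \<subseteq> sets M" using D by blast
    show "disjoint_family_on D {..<N}" unfolding disjoint_family_on_def D_def by blast
  qed simp
  also have "\<dots> \<le> measure M {x \<in> space M. F x \<noteq> \<psi> (idx K (u x))}"
    by (rule finite_measure_mono[OF _ neq]) (auto simp: D_def)
  finally have cE: "real (card E) / real K \<le> measure M {x \<in> space M. F x \<noteq> \<psi> (idx K (u x))}" .
  have E: "measure M {x \<in> space M. idx K (u x) \<in> E} < \<eta> / 2"
  proof -
    have "E \<subseteq> {..<K}" by (auto simp: E_def)
    from measure_cells[OF K this] near' show ?thesis using cE by linarith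
  qed
  have "{x \<in> space M. F x \<noteq> \<pi> (idx K (u x)) div L} \<subseteq>
      {x \<in> space M. F x \<noteq> \<psi> (idx K (u x))} \<union> {x \<in> space M. idx K (u x) \<in> E}"
    using cell_less[OF K] by (auto simp: E_def)
  then have "measure M {x \<in> space M. F x \<noteq> \<pi> (idx K (u x)) div L} \<le>
      measure M ({x \<in> space M. F x \<noteq> \<psi> (idx K (u x))} \<union> {x \<in> space M. idx K (u x) \<in> E})"
    by (rule finite_measure_mono) (intro sets.Un neq sets_cell)
  also have "\<dots> \<le> measure M {x \<in> space M. F x \<noteq> \<psi> (idx K (u x))} + measure M {x \<in> space M. idx K (u x) \<in> E}"
    by (intro measure_Un_le neq sets_cell)
  also have "\<dots> < \<eta>" using E near' by simp
  finally have "measure M {x \<in> space M. idx N (u (S x)) \<noteq> \<pi> (idx (N * L) (u x)) div L} < \<eta>"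
    by (simp add: F_def K_def)
  moreover have "even L" by (simp add: L_def)
  ultimately show ?thesis using L \<pi> unfolding K_def by blast
qed

definition colour :: "'a \<Rightarrow> nat" where
  "colour x = (if u x < 1 / 2 then 1 else 2)"

definition colour_word :: "('a \<Rightarrow> 'a) \<Rightarrow> nat \<Rightarrow> 'a \<Rightarrow> nat list" where
  "colour_word T n x = map (\<lambda>t. colour ((T ^^ t) x)) [0..<n]"

lemma measurable_colour: "colour \<in> measurable M (count_space UNIV)"
proof -
  have "(\<lambda>y::real. if y < 1 / 2 then 1 else (2::nat)) \<in> measurable borel (count_space UNIV)" by measurable
  then have "(\<lambda>x. if u x < 1 / 2 then 1 else (2::nat)) \<in> measurable M (count_space UNIV)"
    by (rule measurable_compose[OF u_measurable measurable_unit_intervalI])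
  then show ?thesis unfolding colour_def[abs_def] .
qed

lemma sets_colour_word: "T \<in> mpt M \<Longrightarrow> {x \<in> space M. Q (colour_word T n x)} \<in> sets M"
  unfolding colour_word_def
  by (rule sets_word) (rule measurable_compose[OF mpt_measurable[OF mpt_funpow] measurable_colour])

text \<open>
  The constants are those of \<open>itinerary_balls_decay\<close>. A multiple of 8 as length makes the radius \<open>1 / 8\<close> a whole
  number of mismatches.
\<close>

definition exponentially_many_words :: "('a \<Rightarrow> 'a) \<Rightarrow> bool" where
  "exponentially_many_words T \<longleftrightarrow> (\<exists>\<beta>>1. \<forall>m v. length v = 8 * m \<longrightarrow>
     measure M {x \<in> space M. mismatch (colour_word T (8 * m) x) v \<le> m} \<le> 3 / 2 / \<beta> ^ (8 * m))"

lemma AE_funpow: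
  assumes T: "T \<in> mpt M" and eq: "AE x in M. u (T x) = g (u x)"
  shows "AE x in M. \<forall>t. u ((T ^^ t) x) = (g ^^ t) (u x)"
proof -
  have "AE x in M. u ((T ^^ t) x) = (g ^^ t) (u x)" for t
  proof (induction t)
    case (Suc t)
    have "AE x in M. u (T ((T ^^ t) x)) = g (u ((T ^^ t) x))"
      by (rule mpt_AE[OF mpt_funpow[OF T] eq])
    with Suc show ?case by eventually_elim simp
  qed simp
  then show ?thesis by (simp add: AE_all_countable)
qed

lemma half_balanced:
  assumes "even K"
  shows "K \<le> 2 * card {i\<in>{..<K}. (if 2 * i < K then 1 else 2::nat) \<noteq> c}"
proof -
  obtain k where k: "K = 2 * k" using assms by (rule evenE)
  let ?A = "{i\<in>{..<K}. (if 2 * i < K then 1 else 2::nat) \<noteq> c}"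
  have fin: "finite ?A" by simp
  consider "c = 1" | "c \<noteq> 1" by blast
  then show ?thesis
  proof cases
    case 1
    then have "{k..<K} \<subseteq> ?A" using k by auto
    then have "card {k..<K} \<le> card ?A" by (rule card_mono[OF fin])
    then show ?thesis using k by simp
  next
    case 2
    then have "{..<k} \<subseteq> ?A" using k by auto
    then have "card {..<k} \<le> card ?A" by (rule card_mono[OF fin])
    then show ?thesis using k by simp
  qed
qed

lemma colour_cell:
  assumes K: "even K" "0 < K" and x: "x \<in> space M"
  shows "colour x = (if 2 * idx K (u x) < K then 1 else 2)"
proof -
  obtain k where k: "K = 2 * k" using K(1) by (rule evenE)
  have b: "real (idx K (u x)) \<le> real K * u x" "real K * u x < real (idx K (u x)) + 1"
    using idx_bounds[of "u x" K] u_range[OF x] by auto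
  have "u x < 1 / 2 \<longleftrightarrow> real K * u x < real k" using K(2) k by (simp add: field_simps)
  also have "\<dots> \<longleftrightarrow> idx K (u x) < k"
  proof
    assume "real K * u x < real k"
    then have "real (idx K (u x)) < real k" using b(1) by linarith
    then show "idx K (u x) < k" by simp
  next
    assume "idx K (u x) < k"
    then have "real (idx K (u x)) + 1 \<le> real k" by linarith
    then show "real K * u x < real k" using b(2) by linarith
  qed
  finally show ?thesis using k by (simp add: colour_def)
qed

text \<open>
  Lift the resampling shift over the approximating permutation. Richness is asserted for all maps that agree with
  \<open>S\<close> almost everywhere, because it has to be a property of the class.
\<close>

lemma exponentially_many_words_dense:
  assumes S0: "S0 \<in> mpt M" and N: "0 < N" and \<eta>: "0 < \<eta>"
  shows "\<exists>S\<in>mpt M. measure M {x \<in> space M. idx N (u (S x)) \<noteq> idx N (u (S0 x))} < \<eta> \<and>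
    (\<forall>T\<in>mpt M. (AE x in M. S x = T x) \<longrightarrow> exponentially_many_words T)"
proof -
  obtain L \<pi> where L: "0 < L" "even L" and \<pi>: "\<pi> permutes {..<N * L}"
    and near: "measure M {x \<in> space M. idx N (u (S0 x)) \<noteq> \<pi> (idx (N * L) (u x)) div L} < \<eta> / 2"
    using permutation_approximation[OF S0 N, of "\<eta> / 2"] \<eta> by auto
  define K where "K = N * L"
  have K: "0 < K" "even K" using N L by (simp_all add: K_def)
  obtain w0 :: nat where w0: "2 / \<eta> < real w0" using reals_Archimedean2 by blast
  define w where "w = max 2 w0"
  have w: "2 \<le> w" "1 / real w < \<eta> / 2"
  proof -
    show "2 \<le> w" by (simp add: w_def)
    have "2 / \<eta> < real w" using w0 by (simp add: w_def)
    then show "1 / real w < \<eta> / 2" using \<eta> \<open>2 \<le> w\<close> by (simp add: field_simps)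
  qed
  define col :: "nat \<Rightarrow> nat" where "col i = (if 2 * i < K then 1 else 2)" for i
  interpret W: resampling_shift K w \<pi> col
  proof
    show "0 < K" "0 < w" "2 \<le> w" using K w by simp_all
    show "\<pi> permutes {..<K}" using \<pi> by (simp add: K_def)
    show "K \<le> 2 * card {i\<in>{..<K}. col i \<noteq> c}" for c unfolding col_def by (rule half_balanced[OF K(2)])
  qed
  obtain S where S: "S \<in> mpt M" and Sg: "AE x in M. u (S x) = W.g (u x)"
    using u_lifts[OF W.g_mpt] by blast
  have g_cell: "(\<lambda>y. idx K ((W.g ^^ t) y)) \<in> measurable unit_interval (count_space UNIV)" for t
    by (rule measurable_compose[OF mpt_measurable[OF mpt_funpow[OF W.g_mpt]] measurable_unit_intervalI[OF borel_measurable_idx]])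
  have "measure M {x \<in> space M. idx K (u (S x)) \<noteq> \<pi> (idx K (u x))} \<le> 1 / real w"
  proof -
    have s: "{y \<in> {0..<1}. idx K (W.g y) \<noteq> \<pi> (idx K y)} \<in> sets unit_interval"
      using sets_neq[OF g_cell[of 1] measurable_compose[OF g_cell[of 0], of \<pi> "count_space UNIV"]] by simp
    have "measure M {x \<in> space M. idx K (u (S x)) \<noteq> \<pi> (idx K (u x))} =
        measure M {x \<in> space M. idx K (W.g (u x)) \<noteq> \<pi> (idx K (u x))}"
    proof (rule measure_eq_AE)
      show "AE x in M. x \<in> {x \<in> space M. idx K (u (S x)) \<noteq> \<pi> (idx K (u x))} \<longleftrightarrow>
          x \<in> {x \<in> space M. idx K (W.g (u x)) \<noteq> \<pi> (idx K (u x))}"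
        using Sg by eventually_elim simp
      show "{x \<in> space M. idx K (u (S x)) \<noteq> \<pi> (idx K (u x))} \<in> sets M"
        by (rule sets_neq[OF measurable_compose[OF mpt_measurable[OF S] measurable_cell] measurable_compose[OF measurable_cell]]) simp
      show "{x \<in> space M. idx K (W.g (u x)) \<noteq> \<pi> (idx K (u x))} \<in> sets M"
        by (rule sets_Collect_u[OF s])
    qed
    also have "\<dots> \<le> 1 / real w" using measure_u[OF s] W.measure_resampled by simp
    finally show ?thesis .
  qed
  then have resampled: "measure M {x \<in> space M. idx K (u (S x)) \<noteq> \<pi> (idx K (u x))} < \<eta> / 2"
    using w(2) by linarith
  let ?A = "{x \<in> space M. idx K (u (S x)) \<noteq> \<pi> (idx K (u x))}"
  let ?B = "{x \<in> space M. idx N (u (S0 x)) \<noteq> \<pi> (idx K (u x)) div L}"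
  have A: "?A \<in> sets M"
    by (rule sets_neq[OF measurable_compose[OF mpt_measurable[OF S] measurable_cell] measurable_compose[OF measurable_cell]]) simp
  have B: "?B \<in> sets M"
    by (rule sets_neq[OF measurable_compose[OF mpt_measurable[OF S0] measurable_cell] measurable_compose[OF measurable_cell]]) simp
  have "{x \<in> space M. idx N (u (S x)) \<noteq> idx N (u (S0 x))} \<subseteq> ?A \<union> ?B"
  proof -
    have "idx N (u (S x)) = idx K (u (S x)) div L" if "x \<in> space M" for x
      using cell_div[OF L(1) mpt_space[OF S that], of N] by (simp add: K_def)
    then show ?thesis by auto
  qed
  then have "measure M {x \<in> space M. idx N (u (S x)) \<noteq> idx N (u (S0 x))} \<le> measure M (?A \<union> ?B)"
    using A B by (intro finite_measure_mono) auto
  also have "\<dots> \<le> measure M ?A + measure M ?B" using A B by (rule measure_Un_le)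
  also have "\<dots> < \<eta>" using resampled near by (simp add: K_def)
  finally have close: "measure M {x \<in> space M. idx N (u (S x)) \<noteq> idx N (u (S0 x))} < \<eta>" .
  have "exponentially_many_words T" if T: "T \<in> mpt M" and ST: "AE x in M. S x = T x" for T
  proof -
    obtain \<beta> where \<beta>: "1 < \<beta>" "\<And>m v. length v = 8 * m \<Longrightarrow>
        measure unit_interval {y \<in> {0..<1}. mismatch (W.itinerary (8 * m) y) v \<le> m} \<le> 3 / 2 / \<beta> ^ (8 * m)"
      using W.itinerary_balls_decay by blast
    have "AE x in M. u (T x) = W.g (u x)" using ST Sg by eventually_elim simp
    then have pow: "AE x in M. \<forall>t. u ((T ^^ t) x) = (W.g ^^ t) (u x)" by (rule AE_funpow[OF T])
    have "measure M {x \<in> space M. mismatch (colour_word T (8 * m) x) v \<le> m} \<le> 3 / 2 / \<beta> ^ (8 * m)"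
      if v: "length v = 8 * m" for m v
    proof -
      have s: "{y \<in> {0..<1}. mismatch (W.itinerary (8 * m) y) v \<le> m} \<in> sets unit_interval"
      proof -
        have "(\<lambda>y. col (idx K ((W.g ^^ t) y))) \<in> measurable unit_interval (count_space UNIV)" for t
          by (rule measurable_compose[OF g_cell]) simp
        from sets_word[OF this, where Q = "\<lambda>l. mismatch l v \<le> m" and n = "8 * m"] show ?thesis
          unfolding W.itinerary_def space_unit_interval .
      qed
      have "measure M {x \<in> space M. mismatch (colour_word T (8 * m) x) v \<le> m} =
          measure M {x \<in> space M. mismatch (W.itinerary (8 * m) (u x)) v \<le> m}"
      proof (rule measure_eq_AE)
        show "AE x in M. x \<in> {x \<in> space M. mismatch (colour_word T (8 * m) x) v \<le> m} \<longleftrightarrow>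
            x \<in> {x \<in> space M. mismatch (W.itinerary (8 * m) (u x)) v \<le> m}"
          using pow
        proof eventually_elim
          case (elim x)
          have "colour_word T (8 * m) x = W.itinerary (8 * m) (u x)" if x: "x \<in> space M"
          proof -
            have "colour ((T ^^ t) x) = col (idx K ((W.g ^^ t) (u x)))" for t
              using colour_cell[OF K(2,1) mpt_space[OF mpt_funpow[OF T] x], of t] elim by (simp add: col_def)
            then show ?thesis by (simp add: colour_word_def W.itinerary_def)
          qed
          then show ?case by auto
        qed
        show "{x \<in> space M. mismatch (colour_word T (8 * m) x) v \<le> m} \<in> sets M" by (rule sets_colour_word[OF T])
        show "{x \<in> space M. mismatch (W.itinerary (8 * m) (u x)) v \<le> m} \<in> sets M" by (rule sets_Collect_u[OF s])
      qed
      also have "\<dots> \<le> 3 / 2 / \<beta> ^ (8 * m)" using measure_u[OF s] \<beta>(2)[OF v] by simp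
      finally show ?thesis .
    qed
    with \<beta>(1) show ?thesis unfolding exponentially_many_words_def by blast
  qed
  with S close show ?thesis by blast
qed

end

context uniform_coordinate
begin

section \<open>Covering numbers of the partition into halves\<close>

definition halves :: "nat \<times> (nat \<Rightarrow> 'a set)" where
  "halves = (2, \<lambda>j. {x \<in> space M. colour x = j})"

lemma colour_range: "colour x \<in> {1..2}"
  by (simp add: colour_def)

lemma halves_partition: "halves \<in> finite_partitions M"
proof -
  have "{x \<in> space M. colour x = j} \<in> sets M" for j by (rule sets_Collect_count[OF measurable_colour])
  moreover have "disjoint_family_on (\<lambda>j. {x \<in> space M. colour x = j}) {1..2}"
    unfolding disjoint_family_on_def by blast
  moreover have "(\<Union>j\<in>{1..2}. {x \<in> space M. colour x = j}) = space M"
    using colour_range by blast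
  ultimately show ?thesis unfolding finite_partitions_def halves_def by blast
qed

lemma name_of_halves:
  assumes T: "T \<in> mpt M" and x: "x \<in> space M"
  shows "name_of T halves n x = colour_word T n x"
proof -
  have "cell_of halves y = colour y" if "y \<in> space M" for y
    unfolding cell_of_def halves_def using that colour_range by (intro the_equality) auto
  then show ?thesis
    unfolding name_of_def colour_word_def using mpt_space[OF mpt_funpow[OF T] x] by simp
qed

lemma hamming_ball_halves:
  assumes T: "T \<in> mpt M"
  shows "hamming_ball M T halves \<epsilon> w =
    {x \<in> space M. real (mismatch (colour_word T (length w) x) w) / real (length w) < \<epsilon>}"
  unfolding hamming_ball_def
  using name_of_halves[OF T] by (auto simp: hamming_def mismatch_def colour_word_def)

lemma sets_hamming_balls:
  assumes T: "T \<in> mpt M"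
  shows "(\<Union>v\<in>set vs. hamming_ball M T halves \<epsilon> v) \<in> sets M"
  unfolding hamming_ball_halves[OF T] by (intro sets.finite_UN sets_colour_word[OF T]) simp

abbreviation cov :: "('a \<Rightarrow> 'a) \<Rightarrow> nat \<Rightarrow> nat" where
  "cov T n \<equiv> covering_number M halves T n (1 / 8) (1 / 2)"

definition covers :: "('a \<Rightarrow> 'a) \<Rightarrow> nat \<Rightarrow> real \<Rightarrow> real \<Rightarrow> nat list list \<Rightarrow> bool" where
  "covers T n \<epsilon> \<delta> vs \<longleftrightarrow> set vs \<subseteq> words 2 n \<and>
     measure M (\<Union>v\<in>set vs. hamming_ball M T halves \<epsilon> v) \<ge> 1 - \<delta>"

lemma covering_number_halves: "covering_number M halves T n \<epsilon> \<delta> = (LEAST k. \<exists>vs. length vs = k \<and> covers T n \<epsilon> \<delta> vs)"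
  unfolding covering_number_def covers_def by (simp add: halves_def)

lemma covering_number_le: "covers T n \<epsilon> \<delta> vs \<Longrightarrow> covering_number M halves T n \<epsilon> \<delta> \<le> length vs"
  unfolding covering_number_halves by (rule Least_le) blast

lemma finite_words: "finite (words r n)"
proof -
  have "words r n = {w. set w \<subseteq> {1..r} \<and> length w = n}" unfolding words_def by blast
  then show ?thesis using finite_lists_length_eq[of "{1..r}" n] by simp
qed

text \<open>The balls around all words cover the space, so the minimum in the covering number is attained.\<close>

lemma minimal_cover:
  assumes T: "T \<in> mpt M" and \<epsilon>: "0 < \<epsilon>" and \<delta>: "0 \<le> \<delta>"
  shows "\<exists>vs. length vs = covering_number M halves T n \<epsilon> \<delta> \<and> covers T n \<epsilon> \<delta> vs"
proof -
  obtain ws where ws: "set ws = words 2 n" using finite_list[OF finite_words] by blast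
  have "x \<in> (\<Union>v\<in>set ws. hamming_ball M T halves \<epsilon> v)" if x: "x \<in> space M" for x
  proof -
    define v where "v = colour_word T n x"
    have len: "length v = n" by (simp add: v_def colour_word_def)
    have "set v \<subseteq> {1..2}" unfolding v_def colour_word_def using colour_range by auto
    then have "v \<in> set ws" unfolding ws words_def using len by blast
    moreover have "mismatch v v = 0" by (simp add: mismatch_def)
    then have "x \<in> hamming_ball M T halves \<epsilon> v"
      unfolding hamming_ball_halves[OF T] using x \<epsilon> len by (simp add: v_def[symmetric])
    ultimately show ?thesis by blast
  qed
  then have "(\<Union>v\<in>set ws. hamming_ball M T halves \<epsilon> v) = space M"
    using sets.sets_into_space[OF sets_hamming_balls[OF T]] by blast
  then have "covers T n \<epsilon> \<delta> ws" unfolding covers_def using ws \<delta> by (simp add: prob_space)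
  then have "\<exists>k vs. length vs = k \<and> covers T n \<epsilon> \<delta> vs" by blast
  then show ?thesis unfolding covering_number_halves by (rule LeastI_ex)
qed

lemma covering_number_antimono:
  assumes T: "T \<in> mpt M" and \<epsilon>: "0 < \<epsilon>" "\<epsilon> \<le> \<epsilon>'" and \<delta>: "0 \<le> \<delta>" "\<delta> \<le> \<delta>'"
  shows "covering_number M halves T n \<epsilon>' \<delta>' \<le> covering_number M halves T n \<epsilon> \<delta>"
proof -
  obtain vs where vs: "length vs = covering_number M halves T n \<epsilon> \<delta>" "covers T n \<epsilon> \<delta> vs"
    using minimal_cover[OF T \<epsilon>(1) \<delta>(1)] by blast
  have "hamming_ball M T halves \<epsilon> v \<subseteq> hamming_ball M T halves \<epsilon>' v" for v
    unfolding hamming_ball_def using \<epsilon>(2) by auto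
  then have "measure M (\<Union>v\<in>set vs. hamming_ball M T halves \<epsilon> v) \<le> measure M (\<Union>v\<in>set vs. hamming_ball M T halves \<epsilon>' v)"
    by (intro finite_measure_mono sets_hamming_balls[OF T] UN_mono) auto
  then have "covers T n \<epsilon>' \<delta>' vs" using vs(2) \<delta>(2) unfolding covers_def by auto
  then show ?thesis using covering_number_le vs(1) by metis
qed

lemma covering_number_exponential:
  assumes T: "T \<in> mpt M" and \<beta>: "0 < \<beta>"
    and decay: "\<And>v. length v = 8 * m \<Longrightarrow>
      measure M {x \<in> space M. mismatch (colour_word T (8 * m) x) v \<le> m} \<le> 3 / 2 / \<beta> ^ (8 * m)"
    and m: "0 < m"
  shows "\<beta> ^ (8 * m) / 3 \<le> real (cov T (8 * m))"
proof -
  obtain vs where vs: "length vs = cov T (8 * m)" "covers T (8 * m) (1 / 8) (1 / 2) vs"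
    using minimal_cover[OF T, of "1 / 8" "1 / 2"] by auto
  have ball: "measure M (hamming_ball M T halves (1 / 8) v) \<le> 3 / 2 / \<beta> ^ (8 * m)" if v: "v \<in> set vs" for v
  proof -
    have len: "length v = 8 * m" using vs(2) v unfolding covers_def words_def by blast
    have "hamming_ball M T halves (1 / 8) v \<subseteq> {x \<in> space M. mismatch (colour_word T (8 * m) x) v \<le> m}"
      unfolding hamming_ball_halves[OF T] len using m by (auto simp: field_simps)
    then have "measure M (hamming_ball M T halves (1 / 8) v) \<le> measure M {x \<in> space M. mismatch (colour_word T (8 * m) x) v \<le> m}"
      by (rule finite_measure_mono) (rule sets_colour_word[OF T])
    also have "\<dots> \<le> 3 / 2 / \<beta> ^ (8 * m)" by (rule decay[OF len])
    finally show ?thesis .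
  qed
  have "1 / 2 \<le> measure M (\<Union>v\<in>set vs. hamming_ball M T halves (1 / 8) v)"
    using vs(2) unfolding covers_def by simp
  also have "\<dots> \<le> (\<Sum>v\<in>set vs. measure M (hamming_ball M T halves (1 / 8) v))"
  proof (rule measure_UNION_le)
    show "hamming_ball M T halves (1 / 8) v \<in> sets M" for v
      unfolding hamming_ball_halves[OF T] by (rule sets_colour_word[OF T])
  qed simp
  also have "\<dots> \<le> (\<Sum>v\<in>set vs. 3 / 2 / \<beta> ^ (8 * m))" by (rule sum_mono[OF ball])
  also have "\<dots> = real (card (set vs)) * (3 / 2 / \<beta> ^ (8 * m))" by simp
  also have "\<dots> \<le> real (length vs) * (3 / 2 / \<beta> ^ (8 * m))"
    using card_length[of vs] \<beta> by (intro mult_right_mono) auto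
  finally show ?thesis using \<beta> vs(1) by (simp add: field_simps)
qed

section \<open>The residual set\<close>

text \<open>
  Using \<open>R\<close> both as the threshold for \<open>n\<close> and as the rate parameter lets countably many conditions control all \<open>t > 0\<close>.
\<close>

definition beats_rate :: "(nat \<Rightarrow> real \<Rightarrow> real) \<Rightarrow> nat \<Rightarrow> ('a \<Rightarrow> 'a) set set" where
  "beats_rate a R = {c \<in> mpt_classes M. \<forall>T\<in>c. \<exists>n\<ge>R.
     real R * a n (real R) < real (cov T n)}"

text \<open>
  If \<open>S\<close> needed fewer balls than \<open>T\<close>, a family of words that fails to cover for \<open>T\<close> would cover for \<open>S\<close>. The words of \<open>S\<close> and \<open>T\<close>
  differ on a set that is too small for this.
\<close>

lemma covering_number_lower_semicontinuous:
  assumes T: "T \<in> mpt M" and \<epsilon>: "0 < \<epsilon>" and \<delta>: "0 \<le> \<delta>"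
  shows "\<exists>V. openin (weak_topology M) V \<and> mpt_rel M `` {T} \<in> V \<and>
    (\<forall>c\<in>V. \<forall>S\<in>c. covering_number M halves T n \<epsilon> \<delta> \<le> covering_number M halves S n \<epsilon> \<delta>)"
proof -
  let ?k = "covering_number M halves T n \<epsilon> \<delta>"
  \<comment> \<open>Each of the finitely many families that fail to cover for \<open>T\<close> fails by a positive margin, and \<open>\<gamma>\<close> is the least margin.\<close>
  define \<V> where "\<V> = {vs. set vs \<subseteq> words 2 n \<and> length vs \<le> ?k \<and> \<not> covers T n \<epsilon> \<delta> vs}"
  have fin: "finite \<V>"
    by (rule finite_subset[OF _ finite_lists_length_le[OF finite_words[of 2 n], of ?k]]) (auto simp: \<V>_def)
  define gap where "gap vs = 1 - \<delta> - measure M (\<Union>v\<in>set vs. hamming_ball M T halves \<epsilon> v)" for vs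
  define \<gamma> where "\<gamma> = Min (insert 1 (gap ` \<V>))"
  have "0 < gap vs" if "vs \<in> \<V>" for vs
    using that unfolding \<V>_def covers_def gap_def by auto
  then have \<gamma>: "0 < \<gamma>" unfolding \<gamma>_def using fin by (subst Min_gr_iff) auto
  have \<gamma>_le: "\<gamma> \<le> gap vs" if "vs \<in> \<V>" for vs
    unfolding \<gamma>_def using fin that by (intro Min_le) auto
  have "colour x \<le> 2" for x using colour_range[of x] by simp
  then obtain V where V: "openin (weak_topology M) V" "mpt_rel M `` {T} \<in> V"
    and close: "\<And>c S. c \<in> V \<Longrightarrow> S \<in> c \<Longrightarrow> measure M {x \<in> space M. \<exists>i<n. colour ((S ^^ i) x) \<noteq> colour ((T ^^ i) x)} < \<gamma>"
    using itineraries_vary_continuously[OF T measurable_colour _ \<gamma>, of 2 n] by blast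
  have "?k \<le> covering_number M halves S n \<epsilon> \<delta>" if c: "c \<in> V" "S \<in> c" for c S
  proof (rule ccontr)
    assume less: "\<not> ?k \<le> covering_number M halves S n \<epsilon> \<delta>"
    have "c \<in> mpt_classes M" using openin_subset[OF V(1)] c(1) unfolding topspace_weak_topology by blast
    then have S: "S \<in> mpt M" using c(2) by (rule mpt_classesE)
    obtain vs where vs: "length vs = covering_number M halves S n \<epsilon> \<delta>" "covers S n \<epsilon> \<delta> vs"
      using minimal_cover[OF S \<epsilon> \<delta>] by blast
    have "\<not> covers T n \<epsilon> \<delta> vs" using covering_number_le[of T n \<epsilon> \<delta> vs] less vs(1) by linarith
    then have "vs \<in> \<V>" using vs less unfolding \<V>_def covers_def by auto
    note gap = \<gamma>_le[OF this]
    let ?D = "{x \<in> space M. \<exists>i<n. colour ((S ^^ i) x) \<noteq> colour ((T ^^ i) x)}"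
    have D: "?D \<in> sets M"
    proof -
      have "{x \<in> space M. colour ((S ^^ i) x) \<noteq> colour ((T ^^ i) x)} \<in> sets M" for i
        by (rule sets_neq[OF measurable_compose[OF mpt_measurable[OF mpt_funpow[OF S]] measurable_colour]
            measurable_compose[OF mpt_measurable[OF mpt_funpow[OF T]] measurable_colour]])
      then have "(\<Union>i<n. {x \<in> space M. colour ((S ^^ i) x) \<noteq> colour ((T ^^ i) x)}) \<in> sets M" by blast
      moreover have "(\<Union>i<n. {x \<in> space M. colour ((S ^^ i) x) \<noteq> colour ((T ^^ i) x)}) = ?D" by blast
      ultimately show ?thesis by (simp only:)
    qed
    have len: "length v = n" if "v \<in> set vs" for v
      using vs(2) that unfolding covers_def words_def by blast
    have "(\<Union>v\<in>set vs. hamming_ball M S halves \<epsilon> v) \<subseteq> (\<Union>v\<in>set vs. hamming_ball M T halves \<epsilon> v) \<union> ?D"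
    proof
      fix x assume "x \<in> (\<Union>v\<in>set vs. hamming_ball M S halves \<epsilon> v)"
      then obtain v where v: "v \<in> set vs" "x \<in> hamming_ball M S halves \<epsilon> v" by blast
      then have x: "x \<in> space M" unfolding hamming_ball_def by blast
      show "x \<in> (\<Union>v\<in>set vs. hamming_ball M T halves \<epsilon> v) \<union> ?D"
      proof (cases "x \<in> ?D")
        case False
        then have "colour_word S n x = colour_word T n x" using x by (auto simp: colour_word_def)
        then have "x \<in> hamming_ball M T halves \<epsilon> v"
          using v(2) unfolding hamming_ball_halves[OF S] hamming_ball_halves[OF T] len[OF v(1)] by simp
        then show ?thesis using v(1) by blast
      qed blast
    qed
    then have "measure M (\<Union>v\<in>set vs. hamming_ball M S halves \<epsilon> v) \<le>
        measure M ((\<Union>v\<in>set vs. hamming_ball M T halves \<epsilon> v) \<union> ?D)"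
      by (rule finite_measure_mono) (intro sets.Un sets_hamming_balls[OF T] D)
    also have "\<dots> \<le> measure M (\<Union>v\<in>set vs. hamming_ball M T halves \<epsilon> v) + measure M ?D"
      by (intro measure_Un_le sets_hamming_balls[OF T] D)
    also have "\<dots> < 1 - \<delta>" using close[OF c] gap unfolding gap_def by linarith
    finally show False using vs(2) unfolding covers_def by linarith
  qed
  with V show ?thesis by blast
qed

lemma openin_beats_rate: "openin (weak_topology M) (beats_rate a R)"
proof (subst openin_subopen, intro ballI)
  fix c assume c: "c \<in> beats_rate a R"
  then have cl: "c \<in> mpt_classes M" unfolding beats_rate_def by blast
  then obtain T where T: "T \<in> mpt M" "c = mpt_rel M `` {T}" unfolding mpt_classes_def by (rule quotientE)
  then have "T \<in> c" using mpt_class_self by blast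
  then obtain n where n: "R \<le> n" "real R * a n (real R) < real (cov T n)"
    using c unfolding beats_rate_def by blast
  obtain V where V: "openin (weak_topology M) V" "mpt_rel M `` {T} \<in> V"
    and le: "\<And>c S. c \<in> V \<Longrightarrow> S \<in> c \<Longrightarrow> cov T n \<le> covering_number M halves S n (1 / 8) (1 / 2)"
    using covering_number_lower_semicontinuous[OF T(1), of "1 / 8" "1 / 2" n] by auto
  have "V \<subseteq> beats_rate a R"
  proof
    fix c' assume c': "c' \<in> V"
    have "c' \<in> mpt_classes M" using openin_subset[OF V(1)] c' unfolding topspace_weak_topology by blast
    moreover have "\<exists>n\<ge>R. real R * a n (real R) < real (cov S n)" if "S \<in> c'" for S
    proof -
      have "real (cov T n) \<le> real (cov S n)"
        using le[OF c' that] by simp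
      then show ?thesis using n by (intro exI[of _ n]) linarith
    qed
    ultimately show "c' \<in> beats_rate a R" unfolding beats_rate_def by blast
  qed
  then show "\<exists>V. openin (weak_topology M) V \<and> c \<in> V \<and> V \<subseteq> beats_rate a R" using V T(2) by blast
qed

lemma exponential_beats_rate:
  assumes sub: "subexponential a" and T: "T \<in> mpt M" and exp: "exponentially_many_words T" and R: "0 < R"
  shows "\<exists>n\<ge>R. real R * a n (real R) < real (cov T n)"
proof -
  obtain \<beta> where \<beta>: "1 < \<beta>" and decay: "\<And>m v. length v = 8 * m \<Longrightarrow>
      measure M {x \<in> space M. mismatch (colour_word T (8 * m) x) v \<le> m} \<le> 3 / 2 / \<beta> ^ (8 * m)"
    using exp unfolding exponentially_many_words_def by blast
  have "(\<lambda>n. a n (real R) / \<beta> ^ n) \<longlonglongrightarrow> 0" using sub \<beta> R unfolding subexponential_def by simp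
  moreover have "0 < 1 / (3 * real R)" using R by simp
  ultimately have "\<forall>\<^sub>F n in sequentially. a n (real R) / \<beta> ^ n < 1 / (3 * real R)" by (rule order_tendstoD(2))
  then obtain N where N: "\<And>n. N \<le> n \<Longrightarrow> a n (real R) / \<beta> ^ n < 1 / (3 * real R)"
    unfolding eventually_sequentially by blast
  define n where "n = 8 * (N + R)"
  have "real R * a n (real R) < \<beta> ^ n / 3"
    using N[of n] R \<beta> by (simp add: n_def field_simps)
  also have "\<dots> \<le> real (cov T n)"
    unfolding n_def using R \<beta> by (intro covering_number_exponential[OF T] decay) auto
  finally show ?thesis by (intro exI[of _ n]) (auto simp: n_def)
qed

text \<open>
  Covering numbers at the fixed scale \<open>1/8\<close>, \<open>1/2\<close> bound those at all smaller scales from below, so every \<open>t > 0\<close> lies in the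
  upper slow set.
\<close>

lemma upper_slow_value_infinite:
  assumes rate: "rate_function a" and T: "T \<in> mpt M"
    and beats: "\<And>R. 0 < R \<Longrightarrow> \<exists>n\<ge>R. real R * a n (real R) < real (cov T n)"
    and \<epsilon>: "0 < \<epsilon>" "\<epsilon> \<le> 1 / 8" and \<delta>: "0 < \<delta>" "\<delta> \<le> 1 / 2"
  shows "upper_slow_value M a T halves \<epsilon> \<delta> = \<infinity>"
proof -
  have in_set: "t \<in> upper_slow_set M a T halves \<epsilon> \<delta>" if t: "0 < t" for t
  proof -
    let ?X = "\<lambda>n. ereal (real (covering_number M halves T n \<epsilon> \<delta>) / a n t)"
    have "\<not> limsup ?X < 1"
    proof
      assume "limsup ?X < 1"
      then have "\<forall>\<^sub>F n in sequentially. ?X n < 1" by (rule Limsup_lessD)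
      then obtain N where N: "\<And>n. N \<le> n \<Longrightarrow> ?X n < 1" unfolding eventually_sequentially by blast
      \<comment> \<open>\<open>R \<ge> t\<close> puts \<open>a n t\<close> below \<open>a n R\<close>, and \<open>R \<ge> N\<close> makes the index \<open>n \<ge> R\<close> contradict the choice of \<open>N\<close>.\<close>
      define R where "R = N + nat \<lceil>t\<rceil> + 1"
      have R: "0 < R" "N \<le> R" "t < real R"
        unfolding R_def by (simp, simp, linarith)
      obtain n where n: "R \<le> n" "real R * a n (real R) < real (cov T n)"
        using beats[OF R(1)] by blast
      have n1: "1 \<le> n" using n R by linarith
      have a: "0 < a n t" "a n t \<le> a n (real R)"
        using rate n1 t R unfolding rate_function_def by simp_all
      have "a n t \<le> a n (real R)" by (rule a(2))
      also have "\<dots> \<le> real R * a n (real R)" using R a by (simp add: mult_le_cancel_right1)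
      also have "\<dots> \<le> real (cov T n)" using n by simp
      also have "\<dots> \<le> real (covering_number M halves T n \<epsilon> \<delta>)"
        using covering_number_antimono[OF T \<epsilon> _ \<delta>(2), of n] \<delta> by simp
      finally have "1 \<le> real (covering_number M halves T n \<epsilon> \<delta>) / a n t" using a by simp
      then have "1 \<le> ?X n" by (simp add: one_ereal_def)
      moreover have "?X n < 1" using N[of n] n R by simp
      ultimately show False by simp
    qed
    then have "1 \<le> limsup ?X" by simp
    then have "0 < limsup ?X" by (rule less_le_trans[rotated]) simp
    then show ?thesis using t unfolding upper_slow_set_def by blast
  qed
  have "(SUP t\<in>upper_slow_set M a T halves \<epsilon> \<delta>. ereal t) = \<infinity>"
  proof (rule SUP_PInfty)
    fix n :: nat
    show "\<exists>t\<in>upper_slow_set M a T halves \<epsilon> \<delta>. ereal (real n) \<le> ereal t"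
      using in_set[of "real n + 1"] by (intro bexI[of _ "real n + 1"]) auto
  qed
  moreover have "upper_slow_set M a T halves \<epsilon> \<delta> \<noteq> {}" using in_set[of 1] by auto
  ultimately show ?thesis unfolding upper_slow_value_def by simp
qed

lemma upper_slow_entropy_infinite:
  assumes rate: "rate_function a" and T: "T \<in> mpt M"
    and beats: "\<And>R. 0 < R \<Longrightarrow> \<exists>n\<ge>R. real R * a n (real R) < real (cov T n)"
  shows "upper_slow_entropy M a T = \<infinity>"
proof -
  have lim: "Lim (at_right (0::real)) f = (\<infinity>::ereal)" if "0 < b" "\<And>s. 0 < s \<Longrightarrow> s < b \<Longrightarrow> f s = \<infinity>" for f b
  proof (rule tendsto_Lim)
    have "\<forall>\<^sub>F s in at_right 0. f s = \<infinity>"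
      unfolding eventually_at_right_field using that by blast
    then show "(f \<longlongrightarrow> \<infinity>) (at_right 0)" by (rule tendsto_eventually)
  qed simp
  have inner: "Lim (at_right 0) (\<lambda>\<epsilon>. upper_slow_value M a T halves \<epsilon> \<delta>) = \<infinity>" if "0 < \<delta>" "\<delta> < 1 / 2" for \<delta>
    using that by (intro lim[of "1 / 8"] upper_slow_value_infinite[OF rate T beats]) auto
  have "upper_slow_entropy_partition M a T halves = \<infinity>"
    unfolding upper_slow_entropy_partition_def
    by (rule lim[of "1 / 2"], simp) (rule inner)
  then have "\<infinity> \<le> upper_slow_entropy M a T"
    unfolding upper_slow_entropy_def using halves_partition by (metis SUP_upper)
  then show ?thesis by simp
qed

theorem residual_infinite_upper_slow_entropy:
  assumes rate: "rate_function a" and sub: "subexponential a"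
  shows "\<exists>G. G \<subseteq> mpt_classes M \<and> gdelta_in (weak_topology M) G \<and>
    weak_topology M closure_of G = mpt_classes M \<and> (\<forall>c\<in>G. \<forall>T\<in>c. upper_slow_entropy M a T = \<infinity>)"
proof -
  define G where "G = (\<Inter>R. beats_rate a (Suc R))"
  have G_sub: "G \<subseteq> mpt_classes M" unfolding G_def beats_rate_def by blast
  moreover have "gdelta_in (weak_topology M) G"
    unfolding G_def by (rule gdelta_in_Inter) (auto intro: open_imp_gdelta_in openin_beats_rate)
  moreover have "weak_topology M closure_of G = mpt_classes M"
  proof
    show "weak_topology M closure_of G \<subseteq> mpt_classes M"
      using closure_of_subset_topspace[of "weak_topology M" G] unfolding topspace_weak_topology .
    show "mpt_classes M \<subseteq> weak_topology M closure_of G"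
    proof
      fix c assume c: "c \<in> mpt_classes M"
      then obtain S0 where S0: "S0 \<in> mpt M" "c = mpt_rel M `` {S0}" unfolding mpt_classes_def by (rule quotientE)
      have "\<exists>c'\<in>G. c' \<in> W" if W: "c \<in> W" "openin (weak_topology M) W" for W
      proof -
        obtain N \<eta> where N: "0 < N" "0 < \<eta>" and nbhd: "\<And>S. S \<in> mpt M \<Longrightarrow>
            measure M {x \<in> space M. idx N (u (S x)) \<noteq> idx N (u (S0 x))} < \<eta> \<Longrightarrow> mpt_rel M `` {S} \<in> W"
          using weak_neighbourhood_by_cells[OF W(2) S0(1)] W(1) S0(2) by blast
        obtain S where S: "S \<in> mpt M"
          "measure M {x \<in> space M. idx N (u (S x)) \<noteq> idx N (u (S0 x))} < \<eta>"
          and exp: "\<And>T. T \<in> mpt M \<Longrightarrow> AE x in M. S x = T x \<Longrightarrow> exponentially_many_words T"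
          using exponentially_many_words_dense[OF S0(1) N] by blast
        have "mpt_rel M `` {S} \<in> beats_rate a (Suc R)" for R
          unfolding beats_rate_def mem_Collect_eq
        proof (intro conjI ballI)
          show "mpt_rel M `` {S} \<in> mpt_classes M" by (rule mpt_classesI[OF S(1)])
          fix T assume "T \<in> mpt_rel M `` {S}"
          then have T: "T \<in> mpt M" "AE x in M. S x = T x" unfolding mpt_rel_class_iff by blast+
          show "\<exists>n\<ge>Suc R. real (Suc R) * a n (real (Suc R)) < real (cov T n)"
            by (rule exponential_beats_rate[OF sub T(1) exp[OF T]]) simp
        qed
        then have "mpt_rel M `` {S} \<in> G" unfolding G_def by blast
        with nbhd[OF S] show ?thesis by blast
      qed
      then show "c \<in> weak_topology M closure_of G"
        using c unfolding in_closure_of topspace_weak_topology by blast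
    qed
  qed
  moreover have "upper_slow_entropy M a T = \<infinity>" if c: "c \<in> G" "T \<in> c" for c T
  proof (rule upper_slow_entropy_infinite[OF rate])
    show "T \<in> mpt M" using G_sub c by (blast intro: mpt_classesE)
    fix R :: nat assume "0 < R"
    then obtain R' where "R = Suc R'" by (cases R) auto
    moreover have "c \<in> beats_rate a (Suc R')" using c(1) unfolding G_def by blast
    ultimately show "\<exists>n\<ge>R. real R * a n (real R) < real (cov T n)"
      using c(2) unfolding beats_rate_def by blast
  qed
  ultimately show ?thesis by blast
qed

end

theorem theorem1:
  fixes M :: "'a measure" and a :: "nat \<Rightarrow> real \<Rightarrow> real"
  assumes "standard_prob_space M"
    and "rate_function a"
    and "subexponential a"
  shows "\<exists>G. G \<subseteq> mpt_classes M \<and>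
             gdelta_in (weak_topology M) G \<and>
             weak_topology M closure_of G = mpt_classes M \<and>
             (\<forall>c\<in>G. \<forall>T\<in>c. upper_slow_entropy M a T = \<infinity>)"
proof -
  obtain u where "uniform_coordinate M u" using uniform_coordinate_exists[OF assms(1)] by blast
  then interpret uniform_coordinate M u .
  show ?thesis by (rule residual_infinite_upper_slow_entropy[OF assms(2,3)])
qed

end
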